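(* Let $w\in\mathfrak S_n$ and $I\subseteq J(w)$, where $J(w)=\{j\in[n-1]: w^{-1}(j)>w^{-1}(j+1)\}$. The Schubert variety $X_w\subseteq GL_n/B$ is $L_I$-spherical if and only if $w$ is $I$-spherical.
   Context: $GL_n$ is the group of invertible $n\times n$ complex matrices, $B$ the subgroup of upper triangular matrices, and $X_w=\overline{BwB/B}\subseteq GL_n/B$ the Schubert variety of $w$ (viewed as a permutation matrix). Write $D=[n-1]\setminus I=\{d_1<\dots<d_k\}$, $d_0=0$, $d_{k+1}=n$. $L_I\cong GL_{d_1-d_0}\times\cdots\times GL_{d_{k+1}-d_k}$ is the Levi subgroup of invertible block diagonal matrices with consecutive blocks of sizes $d_1-d_0,\dots,d_{k+1}-d_k$; since $I\subseteq J(w)$, $L_I$ acts on $X_w$ by left multiplication. $X_w$ is called $L_I$-spherical if $X_w$ has a dense orbit of a Borel subgroup of $L_I$. $w$ is called $I$-spherical if $w_0(I)w$ is a standard Coxeter element of some parabolic subgroup of $\mathfrak S_n$, i.e. a product of distinct simple transpositions $s_i=(i\ i{+}1)$ (each used at most once, in some order), where $w_0(I)$ is the longest element of the subgroup generated by $\{s_i:i\in I\}$. (Equivalently, as the paper shows, there is a reduced expression $w=s_{i_1}\cdots s_{i_{\ell(w)}}$ in which each $s_{d_i}$ appears at most once and $\#\{m:d_{t-1}<i_m<d_t\}<\binom{d_t-d_{t-1}+1}{2}$ for $1\le t\le k+1$.) *)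

theory Defs
  imports
    "HOL-Analysis.Abstract_Topology"
    "HOL-Algebra.Left_Coset"
    "HOL-Algebra.Group_Action"
    "HOL-Algebra.Sym_Groups"
    "Jordan_Normal_Form.Matrix"
begin

section \<open>The symmetric group\<close>

text \<open>
  The group \<open>sym_group n\<close> consists of the permutations of \<open>{1..n}\<close>, with composition as
  multiplication.
\<close>

definition simple_transposition :: "nat \<Rightarrow> nat \<Rightarrow> nat" where
  "simple_transposition i = transpose i (Suc i)"

definition word_product :: "nat \<Rightarrow> nat list \<Rightarrow> nat \<Rightarrow> nat" where
  "word_product n is = foldr (\<otimes>\<^bsub>sym_group n\<^esub>) (map simple_transposition is) \<one>\<^bsub>sym_group n\<^esub>"

definition coxeter_length :: "nat \<Rightarrow> (nat \<Rightarrow> nat) \<Rightarrow> nat" where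
  "coxeter_length n w =
     (LEAST l. \<exists>is. set is \<subseteq> {1..<n} \<and> word_product n is = w \<and> length is = l)"

definition parabolic_subgroup :: "nat \<Rightarrow> nat set \<Rightarrow> (nat \<Rightarrow> nat) set" where
  "parabolic_subgroup n I = generate (sym_group n) (simple_transposition ` I)"

text \<open>The element of maximal length in a standard parabolic subgroup is unique.\<close>

definition longest_element :: "nat \<Rightarrow> nat set \<Rightarrow> nat \<Rightarrow> nat" where
  "longest_element n I = arg_max_on (coxeter_length n) (parabolic_subgroup n I)"

definition standard_coxeter_element :: "nat \<Rightarrow> nat set \<Rightarrow> (nat \<Rightarrow> nat) \<Rightarrow> bool" where
  "standard_coxeter_element n J c \<longleftrightarrow> (\<exists>is. distinct is \<and> set is = J \<and> c = word_product n is)"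

definition I_spherical :: "nat \<Rightarrow> nat set \<Rightarrow> (nat \<Rightarrow> nat) \<Rightarrow> bool" where
  "I_spherical n I w \<longleftrightarrow>
     (\<exists>J \<subseteq> {1..<n}. standard_coxeter_element n J (longest_element n I \<otimes>\<^bsub>sym_group n\<^esub> w))"

definition left_descents :: "nat \<Rightarrow> (nat \<Rightarrow> nat) \<Rightarrow> nat set" where
  "left_descents n w = {j \<in> {1..<n}. inv' w j > inv' w (j + 1)}"


section \<open>The general linear group and its Zariski topology\<close>

definition GL :: "nat \<Rightarrow> complex mat monoid" where
  "GL n = units_of (ring_mat TYPE(complex) n ())"

text \<open>
  \<open>GL n\<close> carries the subspace topology of the Zariski topology on all matrices. Inverting the
  determinant gives more regular functions on \<open>GL n\<close>, but no further zero loci.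
\<close>

inductive_set polynomial_functions :: "nat \<Rightarrow> (complex mat \<Rightarrow> complex) set" for n where
  const: "(\<lambda>A. c) \<in> polynomial_functions n"
| entry: "i < n \<Longrightarrow> j < n \<Longrightarrow> (\<lambda>A. A $$ (i, j)) \<in> polynomial_functions n"
| add: "f \<in> polynomial_functions n \<Longrightarrow> g \<in> polynomial_functions n
          \<Longrightarrow> (\<lambda>A. f A + g A) \<in> polynomial_functions n"
| mult: "f \<in> polynomial_functions n \<Longrightarrow> g \<in> polynomial_functions n
          \<Longrightarrow> (\<lambda>A. f A * g A) \<in> polynomial_functions n"

definition zero_locus :: "nat \<Rightarrow> (complex mat \<Rightarrow> complex) set \<Rightarrow> complex mat set" where
  "zero_locus n F = {A \<in> carrier_mat n n. \<forall>f\<in>F. f A = 0}"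

definition zariski :: "nat \<Rightarrow> complex mat topology" where
  "zariski n = topology (\<lambda>U. U \<subseteq> carrier_mat n n \<and>
     (\<exists>F \<subseteq> polynomial_functions n. carrier_mat n n - U = zero_locus n F))"

lemma istopology_zariski:
  "istopology (\<lambda>U. U \<subseteq> carrier_mat n n \<and>
     (\<exists>F \<subseteq> polynomial_functions n. carrier_mat n n - U = zero_locus n F))"
  unfolding istopology_def
proof (intro conjI allI impI; (elim conjE exE)?)
  fix S T F G
  assume *: "S \<subseteq> carrier_mat n n" "F \<subseteq> polynomial_functions n" "carrier_mat n n - S = zero_locus n F"
    "T \<subseteq> carrier_mat n n" "G \<subseteq> polynomial_functions n" "carrier_mat n n - T = zero_locus n G"
  show "S \<inter> T \<subseteq> carrier_mat n n" using * by blast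
  define H where "H = (\<lambda>(f, g) A. f A * g A) ` (F \<times> G)"
  have "H \<subseteq> polynomial_functions n"
    using * by (auto simp: H_def intro!: polynomial_functions.mult)
  moreover have "zero_locus n H = zero_locus n F \<union> zero_locus n G"
    by (auto simp: zero_locus_def H_def)
  moreover have "carrier_mat n n - S \<inter> T = (carrier_mat n n - S) \<union> (carrier_mat n n - T)"
    by blast
  ultimately have "H \<subseteq> polynomial_functions n" "carrier_mat n n - S \<inter> T = zero_locus n H"
    by (simp_all only: *)
  then show "\<exists>F \<subseteq> polynomial_functions n. carrier_mat n n - S \<inter> T = zero_locus n F"
    by blast
next
  fix \<U>
  assume *: "\<forall>U\<in>\<U>. U \<subseteq> carrier_mat n n \<and>
     (\<exists>F \<subseteq> polynomial_functions n. carrier_mat n n - U = zero_locus n F)"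
  show "\<Union>\<U> \<subseteq> carrier_mat n n" using * by blast
  have "\<forall>U\<in>\<U>. \<exists>F. F \<subseteq> polynomial_functions n \<and> carrier_mat n n - U = zero_locus n F"
    using * by blast
  then obtain F where F: "\<And>U. U \<in> \<U> \<Longrightarrow> F U \<subseteq> polynomial_functions n"
    "\<And>U. U \<in> \<U> \<Longrightarrow> carrier_mat n n - U = zero_locus n (F U)"
    unfolding bchoice_iff by blast
  have "A \<in> carrier_mat n n - \<Union>\<U> \<longleftrightarrow> A \<in> zero_locus n (\<Union>(F ` \<U>))" for A
  proof -
    have "A \<in> carrier_mat n n - \<Union>\<U> \<longleftrightarrow> A \<in> carrier_mat n n \<and> (\<forall>U\<in>\<U>. A \<in> carrier_mat n n - U)"
      by blast
    also have "\<dots> \<longleftrightarrow> A \<in> carrier_mat n n \<and> (\<forall>U\<in>\<U>. A \<in> zero_locus n (F U))"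
      by (simp only: F(2) cong: ball_cong)
    also have "\<dots> \<longleftrightarrow> A \<in> zero_locus n (\<Union>(F ` \<U>))"
      by (auto simp: zero_locus_def)
    finally show ?thesis .
  qed
  then have "carrier_mat n n - \<Union>\<U> = zero_locus n (\<Union>(F ` \<U>))" by blast
  moreover have "\<Union>(F ` \<U>) \<subseteq> polynomial_functions n" using F(1) by blast
  ultimately show "\<exists>F \<subseteq> polynomial_functions n. carrier_mat n n - \<Union>\<U> = zero_locus n F" by blast
qed

lemma openin_zariski:
  "openin (zariski n) U \<longleftrightarrow> U \<subseteq> carrier_mat n n \<and>
     (\<exists>F \<subseteq> polynomial_functions n. carrier_mat n n - U = zero_locus n F)"
  unfolding zariski_def by (subst topology_inverse'[OF istopology_zariski]) (rule refl)

lemma topspace_zariski [simp]: "topspace (zariski n) = carrier_mat n n"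
proof -
  have "carrier_mat n n - carrier_mat n n = zero_locus n {\<lambda>A. 1}"
    by (auto simp: zero_locus_def)
  then have "openin (zariski n) (carrier_mat n n)"
    unfolding openin_zariski
    by (intro conjI exI[of _ "{\<lambda>A. 1}"]) (simp_all add: polynomial_functions.const)
  then show ?thesis
    by (intro subset_antisym openin_subset)
      (use openin_zariski[of n "topspace (zariski n)"] in simp_all)
qed

lemma closedin_zariski:
  "closedin (zariski n) C \<longleftrightarrow> (\<exists>F \<subseteq> polynomial_functions n. C = zero_locus n F)"
proof (cases "C \<subseteq> carrier_mat n n")
  case True
  then have "carrier_mat n n - (carrier_mat n n - C) = C" by blast
  then show ?thesis
    unfolding closedin_def openin_zariski topspace_zariski by (simp only: True Diff_subset simp_thms)
next
  case False
  moreover have "zero_locus n F \<subseteq> carrier_mat n n" for F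
    unfolding zero_locus_def by blast
  ultimately show ?thesis
    unfolding closedin_def topspace_zariski by blast
qed

definition GL_topology :: "nat \<Rightarrow> complex mat topology" where
  "GL_topology n = subtopology (zariski n) (carrier (GL n))"

definition closed_connected_solvable_subgroup :: "nat \<Rightarrow> complex mat set \<Rightarrow> complex mat set \<Rightarrow> bool" where
  "closed_connected_solvable_subgroup n H K \<longleftrightarrow>
     subgroup K (GL n) \<and> K \<subseteq> H \<and>
     closedin (subtopology (GL_topology n) H) K \<and>
     connectedin (GL_topology n) K \<and>
     solvable ((GL n)\<lparr>carrier := K\<rparr>)"

text \<open>
  Borel subgroups of a closed subgroup \<open>H\<close> of \<open>GL n\<close>: the maximal elements among the
  Zariski-closed connected solvable subgroups of \<open>H\<close>.
\<close>

definition borel_subgroup :: "nat \<Rightarrow> complex mat set \<Rightarrow> complex mat set \<Rightarrow> bool" where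
  "borel_subgroup n H K \<longleftrightarrow>
     closed_connected_solvable_subgroup n H K \<and>
     (\<forall>K'. closed_connected_solvable_subgroup n H K' \<and> K \<subseteq> K' \<longrightarrow> K' = K)"


section \<open>The flag variety and Schubert varieties\<close>

definition upper_borel :: "nat \<Rightarrow> complex mat set" where
  "upper_borel n = {A \<in> carrier (GL n). upper_triangular A}"

definition flag_variety :: "nat \<Rightarrow> complex mat set set" where
  "flag_variety n = lcosets\<^bsub>GL n\<^esub> (upper_borel n)"

text \<open>
  The Zariski topology of the variety \<open>GL n / B\<close> is the quotient topology, since a geometric
  quotient map is open and surjective.
\<close>

definition flag_topology :: "nat \<Rightarrow> complex mat set topology" where
  "flag_topology n = topology (\<lambda>U. U \<subseteq> flag_variety n \<and>
     openin (GL_topology n) {A \<in> carrier (GL n). A <#\<^bsub>GL n\<^esub> upper_borel n \<in> U})"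

lemma topspace_GL_topology [simp]: "topspace (GL_topology n) = carrier (GL n)"
proof -
  have "carrier (GL n) \<subseteq> carrier_mat n n"
    by (auto simp: GL_def units_of_def Units_def ring_mat_def)
  then show ?thesis by (auto simp: GL_topology_def)
qed

lemma istopology_flag:
  "istopology (\<lambda>U. U \<subseteq> flag_variety n \<and>
     openin (GL_topology n) {A \<in> carrier (GL n). A <#\<^bsub>GL n\<^esub> upper_borel n \<in> U})"
  unfolding istopology_def
proof (intro conjI allI impI; (elim conjE)?)
  let ?p = "\<lambda>U. {A \<in> carrier (GL n). A <#\<^bsub>GL n\<^esub> upper_borel n \<in> U}"
  fix S T
  assume *: "S \<subseteq> flag_variety n" "openin (GL_topology n) (?p S)" "openin (GL_topology n) (?p T)"
  show "S \<inter> T \<subseteq> flag_variety n" using * by blast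
  have "?p (S \<inter> T) = ?p S \<inter> ?p T" by blast
  then show "openin (GL_topology n) (?p (S \<inter> T))" using * openin_Int by simp
next
  let ?p = "\<lambda>U. {A \<in> carrier (GL n). A <#\<^bsub>GL n\<^esub> upper_borel n \<in> U}"
  fix \<U>
  assume *: "\<forall>U\<in>\<U>. U \<subseteq> flag_variety n \<and> openin (GL_topology n) (?p U)"
  show "\<Union>\<U> \<subseteq> flag_variety n" using * by blast
  have "?p (\<Union>\<U>) = \<Union>(?p ` \<U>)" by blast
  moreover have "openin (GL_topology n) (\<Union>(?p ` \<U>))" using * by (intro openin_Union) blast
  ultimately show "openin (GL_topology n) (?p (\<Union>\<U>))" by simp
qed

lemma openin_flag:
  "openin (flag_topology n) U \<longleftrightarrow> U \<subseteq> flag_variety n \<and>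
     openin (GL_topology n) {A \<in> carrier (GL n). A <#\<^bsub>GL n\<^esub> upper_borel n \<in> U}"
  unfolding flag_topology_def by (subst topology_inverse'[OF istopology_flag]) (rule refl)

lemma topspace_flag_topology [simp]: "topspace (flag_topology n) = flag_variety n"
proof -
  have "{A \<in> carrier (GL n). A <#\<^bsub>GL n\<^esub> upper_borel n \<in> flag_variety n} = topspace (GL_topology n)"
    by (auto simp: flag_variety_def LCOSETS_def)
  then have "openin (flag_topology n) (flag_variety n)"
    unfolding openin_flag by (metis openin_topspace order_refl)
  then show ?thesis
    by (intro subset_antisym openin_subset)
      (use openin_flag[of n "topspace (flag_topology n)"] in simp_all)
qed

lemma quotient_map_flag_topology:
  "quotient_map (GL_topology n) (flag_topology n) (\<lambda>A. A <#\<^bsub>GL n\<^esub> upper_borel n)"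
proof -
  have "(\<lambda>A. A <#\<^bsub>GL n\<^esub> upper_borel n) ` carrier (GL n) = flag_variety n"
    by (auto simp: flag_variety_def LCOSETS_def)
  then show ?thesis
    unfolding quotient_map_def by (auto simp: openin_flag)
qed

text \<open>
  The permutation matrix of \<open>w\<close> sends the \<open>j\<close>-th basis vector to the \<open>w j\<close>-th one, so that
  left multiplication by a transposition of the values \<open>j\<close> and \<open>j + 1\<close> exchanges rows, and left
  descents of \<open>w\<close> correspond to the minimal parabolic subgroups acting on the Schubert variety.
  Matrix indices start at \<open>0\<close>, whereas \<open>w\<close> permutes \<open>{1..n}\<close>.
\<close>

definition permutation_matrix :: "nat \<Rightarrow> (nat \<Rightarrow> nat) \<Rightarrow> complex mat" where
  "permutation_matrix n w = mat n n (\<lambda>(i, j). if Suc i = w (Suc j) then 1 else 0)"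

definition schubert_cell :: "nat \<Rightarrow> (nat \<Rightarrow> nat) \<Rightarrow> complex mat set set" where
  "schubert_cell n w =
     {(b \<otimes>\<^bsub>GL n\<^esub> permutation_matrix n w) <#\<^bsub>GL n\<^esub> upper_borel n | b. b \<in> upper_borel n}"

definition schubert_variety :: "nat \<Rightarrow> (nat \<Rightarrow> nat) \<Rightarrow> complex mat set set" where
  "schubert_variety n w = Abstract_Topology.closure_of (flag_topology n) (schubert_cell n w)"


section \<open>Levi subgroups and sphericality\<close>

text \<open>
  With \<open>d\<^sub>1 < \<dots> < d\<^sub>k\<close> the elements of \<open>{1..<n} - I\<close>, \<open>d\<^sub>0 = 0\<close> and \<open>d\<close> with index \<open>k + 1\<close> equal
  to \<open>n\<close>, these are the consecutive differences.
\<close>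

definition levi_block_sizes :: "nat \<Rightarrow> nat set \<Rightarrow> nat list" where
  "levi_block_sizes n I =
     (let ds = sorted_list_of_set ({1..<n} - I) in map2 (\<lambda>d d'. d' - d) (0 # ds) (ds @ [n]))"

definition levi :: "nat \<Rightarrow> nat set \<Rightarrow> complex mat set" where
  "levi n I = {diag_block_mat As | As.
     map dim_row As = levi_block_sizes n I \<and> map dim_col As = levi_block_sizes n I} \<inter> carrier (GL n)"

definition flag_action :: "nat \<Rightarrow> complex mat \<Rightarrow> complex mat set \<Rightarrow> complex mat set" where
  "flag_action n g x = g <#\<^bsub>GL n\<^esub> x"


definition has_dense_orbit :: "nat \<Rightarrow> complex mat set \<Rightarrow> complex mat set set \<Rightarrow> bool" where
  "has_dense_orbit n K X \<longleftrightarrow>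
     (\<exists>x\<in>X. Abstract_Topology.closure_of (subtopology (flag_topology n) X)
                 (orbit ((GL n)\<lparr>carrier := K\<rparr>) (flag_action n) x) = X)"
definition levi_spherical :: "nat \<Rightarrow> nat set \<Rightarrow> complex mat set set \<Rightarrow> bool" where
  "levi_spherical n I X \<longleftrightarrow> (\<exists>K. borel_subgroup n (levi n I) K \<and> has_dense_orbit n K X)"
end

theory Submission
  imports Defs "Jordan_Normal_Form.Determinant" "Jordan_Normal_Form.Spectral_Radius"
begin

text \<open>
  Closures in the flag variety can be computed upstairs, in \<open>GL\<^sub>n\<close>. By Lie--Kolchin, a Borel subgroup of
  \<open>L\<^sub>I\<close> is conjugate to the group \<open>B\<^sub>I\<close> of its upper triangular elements, so \<open>X\<^sub>w\<close> is spherical if and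
  only if some double coset \<open>B\<^sub>I y B\<close> is dense in the closure of \<open>B w B\<close>. Put \<open>u = w\<^sub>0(I) w\<close>;
  multiplication with \<open>w\<^sub>0(I)\<close> turns \<open>B\<^sub>I\<close> into lower triangular matrices. A minor with rows \<open>R\<close> and
  the first columns is semi-invariant under the lower triangular block matrices and \<open>B\<close> if \<open>R\<close> meets
  every block in an initial segment, and two semi-invariants of the same weight have a constant ratio
  on a dense orbit. If \<open>u\<close> contains the pattern 321 or 3412, there are products of such minors with a
  non-constant ratio; if it contains neither, \<open>u\<close> is a product of distinct simple transpositions.
  Conversely, for such a product every element of \<open>B u B\<close> is, up to \<open>B\<close> on the right, a product of one
  factor per transposition, each with one free coordinate, and the diagonal matrices scale these
  coordinates independently.
\<close>

text \<open>The two patterns come from a dimension count. Modulo the unipotent part of the Borel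
  subgroup, the cell is an affine space with one coordinate for each inversion of u, which the torus
  scales through the root of that inversion; a dense orbit calls for linearly independent roots.
  Values a < b < c forming 321 give the relation (a,b) + (b,c) = (a,c), and values a < b < c < d
  forming 3412 give (a,c) + (b,d) = (a,d) + (b,c). The proof does not build this affine space:
  products of minors turn each relation into polynomial identities, and these survive the passage to
  closures. Density is tested throughout with the polynomials vanishing on a set. A degenerate point
  is reached along a curve of matrices, polynomial in one complex parameter, that may leave the good
  set for finitely many parameters only. Connectedness is what Lie--Kolchin needs: eigenvalues range
  over a finite set and so cannot vary along a connected group.\<close>

lemma carrier_GL: "A \<in> carrier (GL n) \<longleftrightarrow> A \<in> carrier_mat n n \<and> det A \<noteq> 0"
proof
  assume "A \<in> carrier (GL n)"
  then obtain B where A: "A \<in> carrier_mat n n" and B: "B \<in> carrier_mat n n" "A * B = 1\<^sub>m n"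
    by (auto simp: GL_def units_of_def Units_def ring_mat_def)
  then have "det A * det B = 1" by (metis det_mult det_one)
  with A show "A \<in> carrier_mat n n \<and> det A \<noteq> 0" by auto
next
  assume "A \<in> carrier_mat n n \<and> det A \<noteq> 0"
  then have "A \<in> Units (ring_mat TYPE(complex) n ())"
    by (intro det_non_zero_imp_unit) auto
  then show "A \<in> carrier (GL n)" by (simp add: GL_def units_of_def)
qed

lemma GL_mult [simp]: "A \<otimes>\<^bsub>GL n\<^esub> B = A * B"
  by (simp add: GL_def units_of_def ring_mat_def)

lemma GL_one [simp]: "\<one>\<^bsub>GL n\<^esub> = 1\<^sub>m n"
  by (simp add: GL_def units_of_def ring_mat_def)

lemma group_GL: "group (GL n)"
proof -
  interpret ring "ring_mat TYPE(complex) n ()" by (rule ring_mat)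
  show ?thesis unfolding GL_def by (rule units_group)
qed

abbreviation GL_inv :: "nat \<Rightarrow> complex mat \<Rightarrow> complex mat" where
  "GL_inv n A \<equiv> inv\<^bsub>GL n\<^esub> A"

lemma GL_carrier_mat: "A \<in> carrier (GL n) \<Longrightarrow> A \<in> carrier_mat n n"
  by (simp add: carrier_GL)

lemma GL_mult_closed: "A \<in> carrier (GL n) \<Longrightarrow> B \<in> carrier (GL n) \<Longrightarrow> A * B \<in> carrier (GL n)"
  using monoid.m_closed[OF group.is_monoid[OF group_GL[of n]]] by simp

lemma one_GL: "1\<^sub>m n \<in> carrier (GL n)"
  by (simp add: carrier_GL)

lemma GL_inv_closed: "A \<in> carrier (GL n) \<Longrightarrow> GL_inv n A \<in> carrier (GL n)"
  by (rule group.inv_closed[OF group_GL])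

lemma GL_inv_right: "A \<in> carrier (GL n) \<Longrightarrow> A * GL_inv n A = 1\<^sub>m n"
  using group.r_inv[OF group_GL[of n]] by simp

lemma GL_inv_left: "A \<in> carrier (GL n) \<Longrightarrow> GL_inv n A * A = 1\<^sub>m n"
  using group.l_inv[OF group_GL[of n]] by simp

lemma GL_inv_unique:
  assumes "A \<in> carrier_mat n n" "B \<in> carrier_mat n n" "A * B = 1\<^sub>m n"
  shows "A \<in> carrier (GL n)" "B \<in> carrier (GL n)" "GL_inv n A = B"
proof -
  have "det A * det B = 1" by (metis det_mult det_one assms)
  then show A: "A \<in> carrier (GL n)" and B: "B \<in> carrier (GL n)"
    using assms by (auto simp: carrier_GL)
  have "B * A = 1\<^sub>m n" using assms mat_mult_left_right_inverse by blast
  then show "GL_inv n A = B"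
    using group.inv_equality[OF group_GL[of n], of B A] A B by simp
qed

lemma mat_mult_entry:
  assumes "A \<in> carrier_mat n m" "B \<in> carrier_mat m k" "i < n" "j < k"
  shows "(A * B) $$ (i, j) = (\<Sum>l<m. A $$ (i, l) * B $$ (l, j))"
  using assms by (auto simp: scalar_prod_def atLeast0LessThan intro!: sum.cong)

subsection \<open>Polynomial maps\<close>

text \<open>\<open>polynomial_functions\<close> consists of functions on matrices of all sizes. A
  function such as \<open>det\<close> agrees with a polynomial in the entries only on
  \<open>carrier_mat n n\<close>, so agreement is required only there.\<close>

definition pf :: "nat \<Rightarrow> (complex mat \<Rightarrow> complex) \<Rightarrow> bool" where
  "pf n f \<longleftrightarrow> (\<exists>g\<in>polynomial_functions n. \<forall>A\<in>carrier_mat n n. f A = g A)"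

lemma pf_polynomial_functions: "f \<in> polynomial_functions n \<Longrightarrow> pf n f"
  unfolding pf_def by blast

lemma pf_const [intro]: "pf n (\<lambda>A. c)"
  by (intro pf_polynomial_functions polynomial_functions.const)

lemma pf_entry [intro]: "i < n \<Longrightarrow> j < n \<Longrightarrow> pf n (\<lambda>A. A $$ (i, j))"
  by (intro pf_polynomial_functions polynomial_functions.entry)

lemma pf_add [intro]: "pf n f \<Longrightarrow> pf n g \<Longrightarrow> pf n (\<lambda>A. f A + g A)"
  unfolding pf_def
proof (elim bexE)
  fix f' g' assume "f' \<in> polynomial_functions n" "g' \<in> polynomial_functions n"
    "\<forall>A\<in>carrier_mat n n. f A = f' A" "\<forall>A\<in>carrier_mat n n. g A = g' A"
  then show "\<exists>h\<in>polynomial_functions n. \<forall>A\<in>carrier_mat n n. f A + g A = h A"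
    by (intro bexI[of _ "\<lambda>A. f' A + g' A"] polynomial_functions.add) simp_all
qed

lemma pf_mult [intro]: "pf n f \<Longrightarrow> pf n g \<Longrightarrow> pf n (\<lambda>A. f A * g A)"
  unfolding pf_def
proof (elim bexE)
  fix f' g' assume "f' \<in> polynomial_functions n" "g' \<in> polynomial_functions n"
    "\<forall>A\<in>carrier_mat n n. f A = f' A" "\<forall>A\<in>carrier_mat n n. g A = g' A"
  then show "\<exists>h\<in>polynomial_functions n. \<forall>A\<in>carrier_mat n n. f A * g A = h A"
    by (intro bexI[of _ "\<lambda>A. f' A * g' A"] polynomial_functions.mult) simp_all
qed

lemma pf_diff [intro]: "pf n f \<Longrightarrow> pf n g \<Longrightarrow> pf n (\<lambda>A. f A - g A)"
  using pf_add[of n f "\<lambda>A. (-1) * g A"] pf_mult[of n "\<lambda>A. -1" g] pf_const[of n "-1"] by simp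

lemma pf_sum [intro]: "(\<And>x. x \<in> X \<Longrightarrow> pf n (f x)) \<Longrightarrow> pf n (\<lambda>A. \<Sum>x\<in>X. f x A)"
  by (induction X rule: infinite_finite_induct) auto

lemma pf_prod [intro]: "(\<And>x. x \<in> X \<Longrightarrow> pf n (f x)) \<Longrightarrow> pf n (\<lambda>A. \<Prod>x\<in>X. f x A)"
  by (induction X rule: infinite_finite_induct) auto

lemma pf_power [intro]: "pf n f \<Longrightarrow> pf n (\<lambda>A. f A ^ k)"
  by (induction k) auto

lemma pf_cong: "pf n f \<Longrightarrow> (\<And>A. A \<in> carrier_mat n n \<Longrightarrow> f A = g A) \<Longrightarrow> pf n g"
  unfolding pf_def by metis

text \<open>Polynomial maps between matrix spaces. The sizes may differ, as for the submatrices
  whose determinants are the cofactors.\<close>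

definition pmf :: "nat \<Rightarrow> nat \<Rightarrow> (complex mat \<Rightarrow> complex mat) \<Rightarrow> bool" where
  "pmf n m M \<longleftrightarrow> (\<forall>A\<in>carrier_mat n n. M A \<in> carrier_mat m m) \<and>
     (\<forall>i<m. \<forall>j<m. pf n (\<lambda>A. M A $$ (i, j)))"

lemma pmf_id: "pmf n n (\<lambda>A. A)"
  unfolding pmf_def by auto

lemma pmf_const: "C \<in> carrier_mat m m \<Longrightarrow> pmf n m (\<lambda>A. C)"
  unfolding pmf_def by auto

lemma pmf_mult:
  assumes "pmf n m M" "pmf n m N"
  shows "pmf n m (\<lambda>A. M A * N A)"
  unfolding pmf_def
proof (intro conjI ballI allI impI)
  fix A :: "complex mat" assume "A \<in> carrier_mat n n"
  then show "M A * N A \<in> carrier_mat m m" using assms unfolding pmf_def by (meson mult_carrier_mat)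
next
  fix i j assume ij: "i < m" "j < m"
  have "pf n (\<lambda>A. \<Sum>l<m. M A $$ (i, l) * N A $$ (l, j))"
    using assms ij by (intro pf_sum pf_mult) (simp_all add: pmf_def)
  then show "pf n (\<lambda>A. (M A * N A) $$ (i, j))"
    by (rule pf_cong) (use assms ij in \<open>auto simp: pmf_def mat_mult_entry[of _ m m _ m]\<close>)
qed

lemma pf_det:
  assumes "pmf n m M"
  shows "pf n (\<lambda>A. det (M A))"
proof -
  have "pf n (\<lambda>A. \<Sum>p | p permutes {0..<m}. signof p * (\<Prod>i = 0..<m. M A $$ (i, p i)))"
    using assms unfolding pmf_def
    by (intro pf_sum pf_mult pf_prod pf_const) (auto simp: permutes_in_image)
  then show ?thesis
    by (rule pf_cong) (use assms in \<open>auto simp: pmf_def det_def'\<close>)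
qed

lemma pf_comp:
  assumes "pf n f" "pmf m n M"
  shows "pf m (\<lambda>A. f (M A))"
proof -
  obtain g where g: "g \<in> polynomial_functions n" "\<And>A. A \<in> carrier_mat n n \<Longrightarrow> f A = g A"
    using assms(1) unfolding pf_def by blast
  from g(1) have "pf m (\<lambda>A. g (M A))"
    by induction (use assms(2) in \<open>auto simp: pmf_def\<close>)
  then show ?thesis
    by (rule pf_cong) (use g(2) assms(2) in \<open>auto simp: pmf_def\<close>)
qed

section \<open>Polynomial functions of one complex parameter and polynomial curves of
  matrices\<close>

definition poly_fun :: "(complex \<Rightarrow> complex) \<Rightarrow> bool" where
  "poly_fun f \<longleftrightarrow> (\<exists>p. \<forall>t. f t = poly p t)"

lemma poly_fun_const [intro]: "poly_fun (\<lambda>t. c)"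
  unfolding poly_fun_def by (rule exI[of _ "[:c:]"]) simp

lemma poly_fun_id [intro]: "poly_fun (\<lambda>t. t)"
  unfolding poly_fun_def by (rule exI[of _ "[:0, 1:]"]) simp

lemma poly_fun_add [intro]: "poly_fun f \<Longrightarrow> poly_fun g \<Longrightarrow> poly_fun (\<lambda>t. f t + g t)"
  unfolding poly_fun_def by (metis poly_add)

lemma poly_fun_mult [intro]: "poly_fun f \<Longrightarrow> poly_fun g \<Longrightarrow> poly_fun (\<lambda>t. f t * g t)"
  unfolding poly_fun_def by (metis poly_mult)

lemma poly_fun_sum [intro]: "(\<And>x. x \<in> X \<Longrightarrow> poly_fun (f x)) \<Longrightarrow> poly_fun (\<lambda>t. \<Sum>x\<in>X. f x t)"
  by (induction X rule: infinite_finite_induct) auto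

text \<open>A nonzero polynomial has finitely many roots, while the complement of \<open>T\<close>
  is infinite. This transports an equation from generic parameters to an exceptional one.\<close>

lemma poly_fun_zero:
  assumes "poly_fun f" "finite T" "\<And>t. t \<notin> T \<Longrightarrow> f t = 0"
  shows "f s = 0"
proof -
  obtain p where p: "\<And>t. f t = poly p t" using assms(1) unfolding poly_fun_def by blast
  have "infinite {t. poly p t = 0}"
  proof
    assume "finite {t. poly p t = 0}"
    moreover have "- T \<subseteq> {t. poly p t = 0}" using assms(3) p by auto
    ultimately have "finite (- T)" using finite_subset by blast
    with assms(2) show False using infinite_UNIV_char_0 by (metis finite_compl)
  qed
  then have "p = 0" using poly_roots_finite by blast
  with p show ?thesis by simp
qed

lemma poly_fun_nonzero:
  assumes "poly_fun f" "f s \<noteq> 0"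
  shows "finite {t. f t = 0}"
proof -
  obtain p where p: "\<And>t. f t = poly p t" using assms(1) unfolding poly_fun_def by blast
  with assms(2) have "p \<noteq> 0" by auto
  with p show ?thesis using poly_roots_finite by simp
qed

definition poly_curve :: "nat \<Rightarrow> (complex \<Rightarrow> complex mat) \<Rightarrow> bool" where
  "poly_curve n M \<longleftrightarrow> (\<forall>t. M t \<in> carrier_mat n n) \<and> (\<forall>i<n. \<forall>j<n. poly_fun (\<lambda>t. M t $$ (i, j)))"

lemma poly_curve_const: "C \<in> carrier_mat n n \<Longrightarrow> poly_curve n (\<lambda>t. C)"
  unfolding poly_curve_def by auto

lemma poly_curve_mat: "(\<And>i j. i < n \<Longrightarrow> j < n \<Longrightarrow> poly_fun (\<lambda>t. f t i j)) \<Longrightarrow>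
    poly_curve n (\<lambda>t. mat n n (\<lambda>(i, j). f t i j))"
  unfolding poly_curve_def by auto

lemma poly_curve_mult:
  assumes "poly_curve n M" "poly_curve n N"
  shows "poly_curve n (\<lambda>t. M t * N t)"
  unfolding poly_curve_def
proof (intro conjI allI impI)
  fix t show "M t * N t \<in> carrier_mat n n" using assms unfolding poly_curve_def by (meson mult_carrier_mat)
next
  fix i j assume ij: "i < n" "j < n"
  have "poly_fun (\<lambda>t. \<Sum>l<n. M t $$ (i, l) * N t $$ (l, j))"
    using assms ij by (intro poly_fun_sum poly_fun_mult) (simp_all add: poly_curve_def)
  moreover have "(M t * N t) $$ (i, j) = (\<Sum>l<n. M t $$ (i, l) * N t $$ (l, j))" for t
    using assms ij by (auto simp: poly_curve_def mat_mult_entry[of _ n n _ n])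
  ultimately show "poly_fun (\<lambda>t. (M t * N t) $$ (i, j))" by simp
qed

lemma pf_poly_curve:
  assumes "pf n f" "poly_curve n M"
  shows "poly_fun (\<lambda>t. f (M t))"
proof -
  obtain g where g: "g \<in> polynomial_functions n" "\<And>A. A \<in> carrier_mat n n \<Longrightarrow> f A = g A"
    using assms(1) unfolding pf_def by blast
  from g(1) have "poly_fun (\<lambda>t. g (M t))"
    by induction (use assms(2) in \<open>auto simp: poly_curve_def\<close>)
  moreover have "f (M t) = g (M t)" for t using g(2) assms(2) by (auto simp: poly_curve_def)
  ultimately show ?thesis by simp
qed

lemma finite_det_poly_curve:
  assumes "poly_curve n M" "det (M s) \<noteq> 0"
  shows "finite {t. det (M t) = 0}"
  using poly_fun_nonzero[OF pf_poly_curve[OF pf_det[OF pmf_id] assms(1)] assms(2)] .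

subsection \<open>Zariski closure\<close>

lemma closedin_GL_topology:
  "closedin (GL_topology n) C \<longleftrightarrow>
     (\<exists>F. (\<forall>f\<in>F. pf n f) \<and> C = {A \<in> carrier (GL n). \<forall>f\<in>F. f A = 0})"
proof -
  have "closedin (GL_topology n) C \<longleftrightarrow>
      (\<exists>F \<subseteq> polynomial_functions n. C = zero_locus n F \<inter> carrier (GL n))"
    unfolding GL_topology_def closedin_subtopology closedin_zariski by blast
  also have "\<dots> \<longleftrightarrow> (\<exists>F. (\<forall>f\<in>F. pf n f) \<and> C = {A \<in> carrier (GL n). \<forall>f\<in>F. f A = 0})"
  proof
    assume "\<exists>F \<subseteq> polynomial_functions n. C = zero_locus n F \<inter> carrier (GL n)"
    then obtain F where F: "F \<subseteq> polynomial_functions n" "C = zero_locus n F \<inter> carrier (GL n)" by blast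
    then show "\<exists>F. (\<forall>f\<in>F. pf n f) \<and> C = {A \<in> carrier (GL n). \<forall>f\<in>F. f A = 0}"
      by (intro exI[of _ F]) (auto intro: pf_polynomial_functions simp: zero_locus_def carrier_GL)
  next
    assume "\<exists>F. (\<forall>f\<in>F. pf n f) \<and> C = {A \<in> carrier (GL n). \<forall>f\<in>F. f A = 0}"
    then obtain F where F: "\<forall>f\<in>F. pf n f" "C = {A \<in> carrier (GL n). \<forall>f\<in>F. f A = 0}" by blast
    have "\<forall>f\<in>F. \<exists>g. g \<in> polynomial_functions n \<and> (\<forall>A\<in>carrier_mat n n. f A = g A)"
      using F(1) unfolding pf_def by blast
    then have "\<exists>r. \<forall>f\<in>F. r f \<in> polynomial_functions n \<and> (\<forall>A\<in>carrier_mat n n. f A = r f A)"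
      by (rule bchoice)
    then obtain r where r': "\<forall>f\<in>F. r f \<in> polynomial_functions n \<and>
        (\<forall>A\<in>carrier_mat n n. f A = r f A)" ..
    then have r: "\<And>f. f \<in> F \<Longrightarrow> r f \<in> polynomial_functions n"
      "\<And>f A. f \<in> F \<Longrightarrow> A \<in> carrier_mat n n \<Longrightarrow> f A = r f A"
      by simp_all
    have "(\<forall>f\<in>F. f A = 0) = (\<forall>f\<in>F. r f A = 0)" if "A \<in> carrier (GL n)" for A
      by (rule ball_cong[OF refl]) (simp only: r(2)[OF _ GL_carrier_mat[OF that], symmetric])
    then have "C = zero_locus n (r ` F) \<inter> carrier (GL n)"
      unfolding F(2) zero_locus_def using GL_carrier_mat[of _ n] by auto
    moreover have "r ` F \<subseteq> polynomial_functions n" using r(1) by blast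
    ultimately show "\<exists>F \<subseteq> polynomial_functions n. C = zero_locus n F \<inter> carrier (GL n)"
      by blast
  qed
  finally show ?thesis .
qed

text \<open>The Zariski closure in \<open>GL n\<close>, phrased through vanishing polynomials so
  that membership is tested one polynomial at a time; \<open>closedin_vcl\<close> and
  \<open>vcl_minimal\<close> identify it as the smallest closed superset.\<close>

definition vcl :: "nat \<Rightarrow> complex mat set \<Rightarrow> complex mat set" where
  "vcl n S = {A \<in> carrier (GL n). \<forall>f. pf n f \<longrightarrow> (\<forall>s\<in>S. f s = 0) \<longrightarrow> f A = 0}"

lemma vclI: "A \<in> carrier (GL n) \<Longrightarrow> (\<And>f. pf n f \<Longrightarrow> (\<And>s. s \<in> S \<Longrightarrow> f s = 0) \<Longrightarrow> f A = 0) \<Longrightarrow> A \<in> vcl n S"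
  by (simp add: vcl_def)

lemma vclD: "A \<in> vcl n S \<Longrightarrow> pf n f \<Longrightarrow> (\<And>s. s \<in> S \<Longrightarrow> f s = 0) \<Longrightarrow> f A = 0"
  by (simp add: vcl_def)

lemma vcl_GL: "A \<in> vcl n S \<Longrightarrow> A \<in> carrier (GL n)"
  by (simp add: vcl_def)

lemma vcl_subset: "S \<subseteq> carrier (GL n) \<Longrightarrow> S \<subseteq> vcl n S"
  by (auto simp: vcl_def)

lemma vcl_trans: "S \<subseteq> vcl n T \<Longrightarrow> vcl n S \<subseteq> vcl n T"
  by (intro subsetI vclI) (blast intro: vcl_GL vclD)+

lemma vcl_mono: "S \<subseteq> T \<Longrightarrow> vcl n S \<subseteq> vcl n T"
  by (intro subsetI vclI) (blast intro: vcl_GL vclD)+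

lemma closedin_vcl: "closedin (GL_topology n) (vcl n S)"
  unfolding closedin_GL_topology
  by (rule exI[of _ "{f. pf n f \<and> (\<forall>s\<in>S. f s = 0)}"]) (auto simp: vcl_def)

lemma vcl_minimal:
  assumes "closedin (GL_topology n) C" "S \<subseteq> C"
  shows "vcl n S \<subseteq> C"
proof -
  obtain F where "\<forall>f\<in>F. pf n f" "C = {A \<in> carrier (GL n). \<forall>f\<in>F. f A = 0}"
    using assms(1) unfolding closedin_GL_topology by blast
  with assms(2) show ?thesis by (auto simp: vcl_def subset_iff)
qed

lemma vcl_image:
  assumes "pmf n n M" "A \<in> vcl n S" "M A \<in> carrier (GL n)"
  shows "M A \<in> vcl n (M ` S)"
proof (rule vclI)
  fix f assume f: "pf n f" "\<And>s. s \<in> M ` S \<Longrightarrow> f s = 0"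
  show "f (M A) = 0"
    using vclD[OF assms(2) pf_comp[OF f(1) assms(1)]] f(2) by blast
qed (fact assms(3))

lemma vcl_mult_left:
  assumes "g \<in> carrier (GL n)" "A \<in> vcl n S"
  shows "g * A \<in> vcl n ((*) g ` S)"
  using vcl_image[OF pmf_mult[OF pmf_const pmf_id] assms(2)] assms
  by (meson GL_carrier_mat GL_mult_closed vcl_GL)

lemma vcl_mult_right:
  assumes "g \<in> carrier (GL n)" "A \<in> vcl n S"
  shows "A * g \<in> vcl n ((\<lambda>x. x * g) ` S)"
  using vcl_image[OF pmf_mult[OF pmf_id pmf_const] assms(2)] assms
  by (meson GL_carrier_mat GL_mult_closed vcl_GL)

text \<open>The algebraic form of taking a limit: a polynomial vanishing on \<open>S\<close>
  vanishes along the curve at almost all parameters, hence at all of them.\<close>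

lemma vcl_poly_curve:
  assumes "poly_curve n M" "finite T" "\<And>t. t \<notin> T \<Longrightarrow> M t \<in> vcl n S" "M s \<in> carrier (GL n)"
  shows "M s \<in> vcl n S"
proof (rule vclI)
  fix f assume f: "pf n f" "\<And>s. s \<in> S \<Longrightarrow> f s = 0"
  show "f (M s) = 0"
    by (rule poly_fun_zero[OF pf_poly_curve[OF f(1) assms(1)] assms(2)]) (use assms(3) vclD f in blast)
qed (fact assms(4))

subsection \<open>Triangular matrices\<close>

lemma upper_triangular_mult:
  assumes A: "A \<in> carrier_mat n n" "upper_triangular A" and B: "B \<in> carrier_mat n n" "upper_triangular B"
  shows "upper_triangular (A * B)"
proof (rule upper_triangularI)
  fix i j assume ij: "j < i" "i < dim_row (A * B)"
  have "A $$ (i, l) * B $$ (l, j) = 0" if "l < n" for l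
    using that A B ij upper_triangularD[of A l i] upper_triangularD[of B j l] by (cases "l < i") auto
  then show "(A * B) $$ (i, j) = 0"
    using A B ij by (subst mat_mult_entry[OF A(1) B(1)]) auto
qed

lemma upper_triangular_diag_nonzero:
  fixes A :: "complex mat"
  assumes "A \<in> carrier (GL n)" "upper_triangular A" "i < n"
  shows "A $$ (i, i) \<noteq> 0"
  using assms upper_triangular_imp_det_eq_0_iff[of A n] by (auto simp: carrier_GL diag_mat_def)

text \<open>The rows of the inverse are treated from the last one upwards. In an entry of
  \<open>A * GL_inv n A\<close> below the diagonal, the terms with l < i vanish because
  \<open>A\<close> is triangular, those with l > i by induction, and the remaining diagonal factor
  of \<open>A\<close> is nonzero.\<close>

lemma upper_triangular_inv:
  assumes "A \<in> carrier (GL n)" "upper_triangular A"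
  shows "upper_triangular (GL_inv n A)"
proof -
  let ?B = "GL_inv n A"
  have A: "A \<in> carrier_mat n n" and B: "?B \<in> carrier_mat n n"
    using assms GL_inv_closed GL_carrier_mat by auto
  have "?B $$ (i, j) = 0" if "j < i" "i < n" for i j
    using that
  proof (induction "n - i" arbitrary: i rule: less_induct)
    case less
    have "0 = (A * ?B) $$ (i, j)" using less.prems GL_inv_right[OF assms(1)] by simp
    also have "\<dots> = (\<Sum>l<n. A $$ (i, l) * ?B $$ (l, j))"
      using less.prems by (intro mat_mult_entry[OF A B]) auto
    also have "\<dots> = (\<Sum>l\<in>{i}. A $$ (i, l) * ?B $$ (l, j))"
    proof (rule sum.mono_neutral_right)
      show "\<forall>l\<in>{..<n} - {i}. A $$ (i, l) * ?B $$ (l, j) = 0"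
      proof
        fix l assume l: "l \<in> {..<n} - {i}"
        show "A $$ (i, l) * ?B $$ (l, j) = 0"
        proof (cases "l < i")
          case True then show ?thesis using upper_triangularD[OF assms(2)] A less.prems by auto
        next
          case False
          then have "?B $$ (l, j) = 0" using l less.prems by (intro less.hyps) auto
          then show ?thesis by simp
        qed
      qed
    qed (use less.prems in auto)
    finally show ?case using upper_triangular_diag_nonzero[OF assms] less.prems by simp
  qed
  then show ?thesis using B by (intro upper_triangularI) auto
qed

lemma upper_borel_iff: "A \<in> upper_borel n \<longleftrightarrow> A \<in> carrier (GL n) \<and> upper_triangular A"
  by (simp add: upper_borel_def)

lemma subgroup_upper_borel: "subgroup (upper_borel n) (GL n)"
  by (rule subgroup.intro)
    (auto simp: upper_borel_iff GL_mult_closed one_GL intro: upper_triangular_mult GL_carrier_mat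
       upper_triangular_inv GL_inv_closed)

lemma upper_borel_mult: "A \<in> upper_borel n \<Longrightarrow> B \<in> upper_borel n \<Longrightarrow> A * B \<in> upper_borel n"
  using subgroup.m_closed[OF subgroup_upper_borel] by simp

lemma upper_borel_one: "1\<^sub>m n \<in> upper_borel n"
  using subgroup.one_closed[OF subgroup_upper_borel] by simp

lemma upper_borel_inv: "A \<in> upper_borel n \<Longrightarrow> GL_inv n A \<in> upper_borel n"
  using subgroup.m_inv_closed[OF subgroup_upper_borel] by simp

lemma upper_borel_GL: "A \<in> upper_borel n \<Longrightarrow> A \<in> carrier (GL n)"
  by (simp add: upper_borel_iff)

subsection \<open>The flag variety\<close>

abbreviation flag :: "nat \<Rightarrow> complex mat \<Rightarrow> complex mat set" where
  "flag n A \<equiv> A <#\<^bsub>GL n\<^esub> upper_borel n"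

lemma flag_def': "flag n A = (\<lambda>b. A * b) ` upper_borel n"
  by (auto simp: l_coset_def)

lemma flag_mult_right:
  assumes "A \<in> carrier (GL n)" "b \<in> upper_borel n"
  shows "flag n (A * b) = flag n A"
proof -
  have *: "flag n (A * b) \<subseteq> flag n A" if "A \<in> carrier (GL n)" "b \<in> upper_borel n" for A b
  proof
    fix x assume "x \<in> flag n (A * b)"
    then obtain c where c: "c \<in> upper_borel n" "x = A * b * c" unfolding flag_def' by blast
    then have "x = A * (b * c)"
      using that by (simp add: GL_carrier_mat upper_borel_GL assoc_mult_mat[of _ n n _ n _ n])
    then show "x \<in> flag n A" using upper_borel_mult[OF that(2) c(1)] unfolding flag_def' by blast
  qed
  have "A * b * GL_inv n b = A"
    using assms by (simp add: GL_carrier_mat upper_borel_GL GL_inv_closed assoc_mult_mat[of _ n n _ n _ n]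
        GL_inv_right right_mult_one_mat[of _ n n])
  with *[OF assms] *[of "A * b" "GL_inv n b"] assms show ?thesis
    by (simp add: GL_mult_closed upper_borel_GL upper_borel_inv)
qed

lemma flag_eqE:
  assumes "A \<in> carrier (GL n)" "flag n A = flag n A'"
  obtains b where "b \<in> upper_borel n" "A = A' * b"
proof -
  have "A * 1\<^sub>m n \<in> flag n A'" using upper_borel_one assms(2) unfolding flag_def' by blast
  then show ?thesis
    using that right_mult_one_mat[OF GL_carrier_mat[OF assms(1)]] unfolding flag_def' by auto
qed

lemma flag_in_flag_variety: "A \<in> carrier (GL n) \<Longrightarrow> flag n A \<in> flag_variety n"
  by (auto simp: flag_variety_def LCOSETS_def)

lemma flag_varietyE:
  assumes "x \<in> flag_variety n" obtains A where "A \<in> carrier (GL n)" "x = flag n A"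
  using assms by (auto simp: flag_variety_def LCOSETS_def)

lemma vcl_borel_right:
  assumes "S \<subseteq> carrier (GL n)" "\<And>A b. A \<in> S \<Longrightarrow> b \<in> upper_borel n \<Longrightarrow> A * b \<in> S"
    "A \<in> vcl n S" "b \<in> upper_borel n"
  shows "A * b \<in> vcl n S"
proof -
  have "A * b \<in> vcl n ((\<lambda>x. x * b) ` S)"
    using assms by (intro vcl_mult_right) (auto simp: upper_borel_GL)
  moreover have "(\<lambda>x. x * b) ` S \<subseteq> S" using assms by blast
  ultimately show ?thesis using vcl_mono by blast
qed

lemma closedin_flag_topology:
  "closedin (flag_topology n) C \<longleftrightarrow>
     C \<subseteq> flag_variety n \<and> closedin (GL_topology n) {A \<in> carrier (GL n). flag n A \<in> C}"
proof -
  have "{A \<in> carrier (GL n). flag n A \<in> flag_variety n - C} =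
      carrier (GL n) - {A \<in> carrier (GL n). flag n A \<in> C}"
    using flag_in_flag_variety by blast
  then show ?thesis
    unfolding closedin_def openin_flag topspace_flag_topology topspace_GL_topology by auto
qed

text \<open>The projection to the flag variety is open, so that preimages commute with closures.\<close>

lemma flag_closure:
  assumes "S \<subseteq> flag_variety n" "A \<in> carrier (GL n)"
  shows "flag n A \<in> flag_topology n closure_of S \<longleftrightarrow> A \<in> vcl n {A \<in> carrier (GL n). flag n A \<in> S}"
    (is "?l \<longleftrightarrow> A \<in> vcl n ?Q")
proof
  assume "A \<in> vcl n ?Q"
  moreover have "?Q \<subseteq> {A \<in> carrier (GL n). flag n A \<in> flag_topology n closure_of S}"
    using closure_of_subset[of S "flag_topology n"] assms(1) by auto
  moreover have "closedin (GL_topology n) {A \<in> carrier (GL n). flag n A \<in> flag_topology n closure_of S}"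
    using closedin_closure_of[of "flag_topology n" S] unfolding closedin_flag_topology by simp
  ultimately show ?l using vcl_minimal by blast
next
  assume l: ?l
  define C where "C = flag n ` vcl n ?Q"
  have Q: "?Q \<subseteq> carrier (GL n)" by blast
  have Qb: "A * b \<in> ?Q" if "A \<in> ?Q" "b \<in> upper_borel n" for A b
    using that by (simp add: flag_mult_right GL_mult_closed upper_borel_GL)
  \<comment> \<open>The closure upstairs is stable under right multiplication by the Borel subgroup,
    hence a union of fibres. Its image \<open>C\<close> is therefore closed for the quotient
    topology.\<close>
  have CQ: "{A \<in> carrier (GL n). flag n A \<in> C} = vcl n ?Q"
  proof (intro subset_antisym subsetI)
    fix x assume "x \<in> {A \<in> carrier (GL n). flag n A \<in> C}"
    then obtain y where y: "x \<in> carrier (GL n)" "y \<in> vcl n ?Q" "flag n x = flag n y"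
      unfolding C_def by auto
    then obtain b where "b \<in> upper_borel n" "x = y * b" using flag_eqE by blast
    then show "x \<in> vcl n ?Q" using vcl_borel_right[OF Q Qb y(2)] by blast
  qed (auto simp: C_def vcl_GL)
  have "closedin (flag_topology n) C"
    unfolding closedin_flag_topology CQ
    using closedin_vcl flag_in_flag_variety vcl_GL by (auto simp: C_def)
  moreover have "S \<subseteq> C"
  proof
    fix x assume x: "x \<in> S"
    then obtain A where A: "A \<in> carrier (GL n)" "x = flag n A" using assms(1) flag_varietyE by blast
    then have "A \<in> ?Q" using x by simp
    then show "x \<in> C" using A vcl_subset[OF Q] unfolding C_def by blast
  qed
  ultimately have "flag_topology n closure_of S \<subseteq> C" by (simp add: closure_of_minimal)
  then show "A \<in> vcl n ?Q" using l assms(2) CQ by blast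
qed


subsection \<open>Subspaces and eigenvectors\<close>

text \<open>A vector of \<open>\<complex>\<^sup>m\<close> is a function vanishing outside \<open>{..<m}\<close>.\<close>

definition lin_subspace :: "nat \<Rightarrow> (nat \<Rightarrow> complex) set \<Rightarrow> bool" where
  "lin_subspace m V \<longleftrightarrow> (\<forall>x\<in>V. \<forall>i\<ge>m. x i = 0) \<and> (\<lambda>i. 0) \<in> V \<and>
     (\<forall>x\<in>V. \<forall>y\<in>V. (\<lambda>i. x i + y i) \<in> V) \<and> (\<forall>c. \<forall>x\<in>V. (\<lambda>i. c * x i) \<in> V)"

definition mat_app :: "nat \<Rightarrow> complex mat \<Rightarrow> (nat \<Rightarrow> complex) \<Rightarrow> nat \<Rightarrow> complex" where
  "mat_app m A x = (\<lambda>i. if i < m then \<Sum>j<m. A $$ (i, j) * x j else 0)"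

definition eigenvec :: "nat \<Rightarrow> complex mat \<Rightarrow> (nat \<Rightarrow> complex) \<Rightarrow> complex \<Rightarrow> bool" where
  "eigenvec m A x c \<longleftrightarrow> mat_app m A x = (\<lambda>i. c * x i)"

text \<open>The pivot positions of the echelon form of the subspace. Their number plays the role of
  the dimension.\<close>

definition lead_positions :: "(nat \<Rightarrow> complex) set \<Rightarrow> nat set" where
  "lead_positions V = {i. \<exists>x\<in>V. x i \<noteq> 0 \<and> (\<forall>j<i. x j = 0)}"

lemma lin_subspaceI:
  assumes "\<And>x i. x \<in> V \<Longrightarrow> m \<le> i \<Longrightarrow> x i = 0" "(\<lambda>i. 0) \<in> V"
    "\<And>x y. x \<in> V \<Longrightarrow> y \<in> V \<Longrightarrow> (\<lambda>i. x i + y i) \<in> V" "\<And>c x. x \<in> V \<Longrightarrow> (\<lambda>i. c * x i) \<in> V"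
  shows "lin_subspace m V"
  unfolding lin_subspace_def using assms by simp

lemma lin_subspace_supp: "lin_subspace m V \<Longrightarrow> x \<in> V \<Longrightarrow> m \<le> i \<Longrightarrow> x i = 0"
  unfolding lin_subspace_def by simp

lemma lin_subspace_zero: "lin_subspace m V \<Longrightarrow> (\<lambda>i. 0) \<in> V"
  unfolding lin_subspace_def by simp

lemma lin_subspace_add: "lin_subspace m V \<Longrightarrow> x \<in> V \<Longrightarrow> y \<in> V \<Longrightarrow> (\<lambda>i. x i + y i) \<in> V"
  unfolding lin_subspace_def by simp

lemma lin_subspace_smult: "lin_subspace m V \<Longrightarrow> x \<in> V \<Longrightarrow> (\<lambda>i. c * x i) \<in> V"
  unfolding lin_subspace_def by simp

lemma mat_app_add: "mat_app m A (\<lambda>i. x i + y i) = (\<lambda>i. mat_app m A x i + mat_app m A y i)"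
  by (rule ext) (simp add: mat_app_def distrib_left sum.distrib)

lemma mat_app_smult: "mat_app m A (\<lambda>i. c * x i) = (\<lambda>i. c * mat_app m A x i)"
  by (rule ext) (simp add: mat_app_def sum_distrib_left mult.left_commute)

lemma mat_app_zero: "mat_app m A (\<lambda>i. 0) = (\<lambda>i. 0)"
  by (rule ext) (simp add: mat_app_def)

lemma mat_app_mult:
  assumes "A \<in> carrier_mat m m" "B \<in> carrier_mat m m"
  shows "mat_app m (A * B) x = mat_app m A (mat_app m B x)"
proof
  fix i
  show "mat_app m (A * B) x i = mat_app m A (mat_app m B x) i"
  proof (cases "i < m")
    case True
    have "(\<Sum>j<m. (A * B) $$ (i, j) * x j) = (\<Sum>j<m. \<Sum>l<m. A $$ (i, l) * B $$ (l, j) * x j)"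
      using True by (intro sum.cong) (auto simp: mat_mult_entry[OF assms] sum_distrib_right simp del: index_mult_mat)
    also have "\<dots> = (\<Sum>l<m. \<Sum>j<m. A $$ (i, l) * B $$ (l, j) * x j)"
      by (rule sum.swap)
    also have "\<dots> = (\<Sum>l<m. A $$ (i, l) * (\<Sum>j<m. B $$ (l, j) * x j))"
      by (simp add: sum_distrib_left mult.assoc)
    finally show ?thesis using True by (simp add: mat_app_def)
  qed (simp add: mat_app_def)
qed

lemma mat_app_one:
  assumes "\<And>i. i \<ge> m \<Longrightarrow> x i = 0"
  shows "mat_app m (1\<^sub>m m) x = x"
proof
  fix i
  have "(\<Sum>j<m. 1\<^sub>m m $$ (i, j) * x j) = (\<Sum>j<m. if i = j then x j else 0)" if "i < m"
    using that by (intro sum.cong) auto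
  then show "mat_app m (1\<^sub>m m) x i = x i" using assms by (auto simp: mat_app_def)
qed

lemma finite_lead_positions: "lin_subspace m V \<Longrightarrow> finite (lead_positions V)"
  by (rule finite_subset[of _ "{..<m}"])
    (auto simp: lead_positions_def not_less dest: lin_subspace_supp intro: leI)

text \<open>Gaussian elimination: a subspace is determined inside a larger one by its leading positions.\<close>

lemma lin_subspace_eqI:
  assumes V: "lin_subspace m V" and W: "lin_subspace m W" and "W \<subseteq> V"
    and lead: "lead_positions V \<subseteq> lead_positions W"
  shows "W = V"
proof -
  have "x \<in> W" if "x \<in> V" "\<forall>j<k. x j = 0" for x k
    using that
  proof (induction "m - k" arbitrary: k x rule: less_induct)
    case less
    show ?case
    proof (cases "k < m")
      case False
      then have "x = (\<lambda>i. 0)" using lin_subspace_supp[OF V less.prems(1)] less.prems(2)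
        by (intro ext) (metis not_less order_trans)
      then show ?thesis using lin_subspace_zero[OF W] by simp
    next
      case True
      show ?thesis
      proof (cases "x k = 0")
        case True
        then have "\<forall>j<Suc k. x j = 0" using less.prems by (auto simp: less_Suc_eq)
        then show ?thesis using less.hyps[of "Suc k" x] less.prems \<open>k < m\<close> by auto
      next
        case False
        then have "k \<in> lead_positions W" using less.prems lead unfolding lead_positions_def by blast
        then obtain y where y: "y \<in> W" "y k \<noteq> 0" "\<forall>j<k. y j = 0" unfolding lead_positions_def by blast
        define z where "z = (\<lambda>i. x i + (- (x k / y k)) * y i)"
        have "(\<lambda>i. (- (x k / y k)) * y i) \<in> V"
          using y(1) assms(3) by (intro lin_subspace_smult[OF V]) blast
        then have "z \<in> V" unfolding z_def by (rule lin_subspace_add[OF V less.prems(1)])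
        moreover have "\<forall>j<Suc k. z j = 0" using y less.prems by (auto simp: z_def less_Suc_eq)
        ultimately have "z \<in> W" using less.hyps[of "Suc k" z] \<open>k < m\<close> by auto
        moreover have "(\<lambda>i. (x k / y k) * y i) \<in> W"
          by (rule lin_subspace_smult[OF W y(1)])
        ultimately have "(\<lambda>i. z i + (x k / y k) * y i) \<in> W"
          by (rule lin_subspace_add[OF W])
        then show ?thesis by (simp add: z_def)
      qed
    qed
  qed
  then have "V \<subseteq> W" by (metis less_nat_zero_code subsetI)
  with assms(3) show ?thesis by blast
qed

text \<open>A member with the fewest pivots works: a member inside it has a subset of its pivots,
  hence the same ones, and equal pivots force equality.\<close>

lemma minimal_lin_subspace:
  assumes "\<F> \<noteq> {}" "\<And>V. V \<in> \<F> \<Longrightarrow> lin_subspace m V"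
  obtains V where "V \<in> \<F>" "\<And>W. W \<in> \<F> \<Longrightarrow> W \<subseteq> V \<Longrightarrow> W = V"
proof -
  obtain V0 where "V0 \<in> \<F>" using assms(1) by blast
  from ex_has_least_nat[of "\<lambda>V. V \<in> \<F>", OF this, of "\<lambda>V. card (lead_positions V)"]
  obtain V where V: "V \<in> \<F>" "\<And>W. W \<in> \<F> \<Longrightarrow> card (lead_positions V) \<le> card (lead_positions W)"
    by blast
  have "W = V" if "W \<in> \<F>" "W \<subseteq> V" for W
  proof -
    have "lead_positions W \<subseteq> lead_positions V" using that(2) unfolding lead_positions_def by blast
    then have "lead_positions W = lead_positions V"
      using V(2)[OF that(1)] finite_lead_positions[OF assms(2)[OF V(1)]] by (simp add: card_seteq)
    then show ?thesis using lin_subspace_eqI[OF assms(2)[OF V(1)] assms(2)[OF that(1)] that(2)] by simp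
  qed
  then show ?thesis using that V(1) by blast
qed

text \<open>The vector p(A) x, evaluated by Horner's scheme along the coefficients of p.\<close>

definition poly_app :: "nat \<Rightarrow> complex mat \<Rightarrow> (nat \<Rightarrow> complex) \<Rightarrow> complex poly \<Rightarrow> nat \<Rightarrow> complex" where
  "poly_app m A x p = fold_coeffs (\<lambda>c y i. c * x i + mat_app m A y i) p (\<lambda>i. 0)"

lemma poly_app_0: "poly_app m A x 0 = (\<lambda>i. 0)"
  by (simp add: poly_app_def)

lemma poly_app_pCons: "poly_app m A x (pCons c p) = (\<lambda>i. c * x i + mat_app m A (poly_app m A x p) i)"
  by (cases "c = 0 \<and> p = 0") (auto simp: poly_app_def mat_app_zero)

lemma poly_app_add: "poly_app m A x (p + q) = (\<lambda>i. poly_app m A x p i + poly_app m A x q i)"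
  by (induction p q rule: poly_induct2)
    (auto simp: poly_app_0 poly_app_pCons mat_app_add algebra_simps)

lemma poly_app_smult: "poly_app m A x (smult c p) = (\<lambda>i. c * poly_app m A x p i)"
  by (induction p) (auto simp: poly_app_0 poly_app_pCons mat_app_smult algebra_simps)

lemma poly_app_in:
  assumes "lin_subspace m V" "\<And>y. y \<in> V \<Longrightarrow> mat_app m A y \<in> V" "x \<in> V"
  shows "poly_app m A x p \<in> V"
proof (induction p)
  case 0 then show ?case using lin_subspace_zero[OF assms(1)] by (simp add: poly_app_0)
next
  case (pCons c p)
  then have "(\<lambda>i. c * x i) \<in> V" "mat_app m A (poly_app m A x p) \<in> V"
    using assms by (auto intro: lin_subspace_smult)
  then show ?case unfolding poly_app_pCons by (rule lin_subspace_add[OF assms(1)])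
qed

text \<open>The spaces \<open>W k\<close>, consisting of the vectors A^k p(A) x, decrease and
  contain a minimal one. Hence A^k x = A^(k+1) p(A) x for some k and p, and X^k - X^(k+1) p
  annihilates x; it is nonzero, its coefficient at k being 1.\<close>

lemma annihilating_poly:
  assumes "lin_subspace m V" "\<And>y. y \<in> V \<Longrightarrow> mat_app m A y \<in> V" "x \<in> V"
  shows "\<exists>p. p \<noteq> 0 \<and> poly_app m A x p = (\<lambda>i. 0)"
proof -
  define W where "W k = range (\<lambda>p. poly_app m A x (monom 1 k * p))" for k
  have W: "lin_subspace m (W k)" for k
  proof (rule lin_subspaceI)
    fix y i assume "y \<in> W k" "m \<le> i"
    then show "y i = 0" using lin_subspace_supp[OF assms(1) poly_app_in[OF assms]] unfolding W_def by auto
  next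
    show "(\<lambda>i. 0) \<in> W k" unfolding W_def by (rule range_eqI[of _ _ 0]) (simp add: poly_app_0)
  next
    fix y z assume "y \<in> W k" "z \<in> W k"
    then obtain p q where "y = poly_app m A x (monom 1 k * p)" "z = poly_app m A x (monom 1 k * q)"
      unfolding W_def by blast
    then show "(\<lambda>i. y i + z i) \<in> W k"
      unfolding W_def by (intro range_eqI[of _ _ "p + q"]) (simp add: poly_app_add distrib_left)
  next
    fix c y assume "y \<in> W k"
    then obtain p where "y = poly_app m A x (monom 1 k * p)" unfolding W_def by blast
    then show "(\<lambda>i. c * y i) \<in> W k"
      unfolding W_def by (intro range_eqI[of _ _ "smult c p"]) (simp add: poly_app_smult)
  qed
  obtain U where U: "U \<in> range W" "\<And>W'. W' \<in> range W \<Longrightarrow> W' \<subseteq> U \<Longrightarrow> W' = U"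
    by (rule minimal_lin_subspace[of "range W" m]) (use W in auto)
  then obtain k where k: "U = W k" by blast
  have "W (Suc k) \<subseteq> W k"
  proof
    fix y assume "y \<in> W (Suc k)"
    then obtain p where "y = poly_app m A x (monom 1 (Suc k) * p)" unfolding W_def by blast
    then show "y \<in> W k"
      unfolding W_def by (intro range_eqI[of _ _ "monom 1 1 * p"]) (simp add: mult_monom flip: mult.assoc)
  qed
  then have "W (Suc k) = W k" using U(2)[of "W (Suc k)"] k by blast
  moreover have "poly_app m A x (monom 1 k) \<in> W k"
    unfolding W_def by (rule range_eqI[of _ _ 1]) simp
  ultimately obtain p where p: "poly_app m A x (monom 1 k) = poly_app m A x (monom 1 (Suc k) * p)"
    unfolding W_def by auto
  define q where "q = monom 1 k + smult (-1) (monom 1 (Suc k) * p)"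
  have "coeff q k = 1"
    by (simp add: q_def coeff_monom_mult)
  then have "q \<noteq> 0" by auto
  moreover have "poly_app m A x q = (\<lambda>i. 0)"
    unfolding q_def poly_app_add poly_app_smult using p by simp
  ultimately show ?thesis by blast
qed

text \<open>Split a linear factor X - c off an annihilating polynomial, leaving the quotient q.
  Either q(A) x is nonzero, and then it is an eigenvector for c, or q annihilates x and has smaller
  degree. The constant case is excluded as x is nonzero.\<close>

lemma eigenvec_in_subspace:
  assumes V: "lin_subspace m V" "\<And>y. y \<in> V \<Longrightarrow> mat_app m A y \<in> V" "x \<in> V" "x \<noteq> (\<lambda>i. 0)"
  obtains y c where "y \<in> V" "y \<noteq> (\<lambda>i. 0)" "eigenvec m A y c"
proof -
  obtain p where "p \<noteq> 0" "poly_app m A x p = (\<lambda>i. 0)" using annihilating_poly[OF V(1-3)] by blast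
  then have "\<exists>y\<in>V. y \<noteq> (\<lambda>i. 0) \<and> (\<exists>c. eigenvec m A y c)"
  proof (induction "degree p" arbitrary: p rule: less_induct)
    case less
    show ?case
    proof (cases "degree p = 0")
      case True
      then obtain a where a: "p = [:a:]" by (metis degree_eq_zeroE)
      then have "(\<lambda>i. a * x i) = (\<lambda>i. 0)" using less.prems(2) by (simp add: poly_app_pCons poly_app_0 mat_app_zero)
      then have "\<And>i. a * x i = 0" by metis
      then have "x = (\<lambda>i. 0)" using a less.prems(1) by auto
      then show ?thesis using V(4) by blast
    next
      case False
      then have "\<not> constant (poly p)" by (simp add: constant_degree)
      then obtain c where c: "poly p c = 0" using fundamental_theorem_of_algebra by blast
      define q where "q = synthetic_div p c"
      have pq: "p + smult c q = pCons 0 q" using synthetic_div_correct[of p c] c by (simp add: q_def)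
      have "q \<noteq> 0" using pq less.prems(1) by auto
      define y where "y = poly_app m A x q"
      have "y \<in> V" unfolding y_def by (rule poly_app_in[OF V(1-3)])
      have "(\<lambda>i. 0 + c * y i) = (\<lambda>i. 0 * x i + mat_app m A y i)"
        using arg_cong[OF pq, of "poly_app m A x"] less.prems(2)
        unfolding poly_app_add poly_app_smult poly_app_pCons y_def[symmetric] by simp
      then have ev: "eigenvec m A y c" by (simp add: eigenvec_def)
      show ?thesis
      proof (cases "y = (\<lambda>i. 0)")
        case True
        have "degree q < degree p" using False by (simp add: q_def degree_synthetic_div)
        then show ?thesis using less.hyps[of q] True \<open>q \<noteq> 0\<close> unfolding y_def by blast
      next
        case False
        then show ?thesis using \<open>y \<in> V\<close> ev by blast
      qed
    qed
  qed
  then show ?thesis using that by blast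
qed

lemma finite_eigenvalues:
  assumes "A \<in> carrier_mat m m"
  shows "finite {c. \<exists>x. x \<noteq> (\<lambda>i. 0) \<and> (\<forall>i\<ge>m. x i = 0) \<and> eigenvec m A x c}"
proof (rule finite_subset)
  show "finite (spectrum A)" by (rule card_finite_spectrum[OF assms])
  show "{c. \<exists>x. x \<noteq> (\<lambda>i. 0) \<and> (\<forall>i\<ge>m. x i = 0) \<and> eigenvec m A x c} \<subseteq> spectrum A"
  proof clarify
    fix c x i0 assume x: "\<forall>i\<ge>m. x i = 0" "eigenvec m A x c" "x \<noteq> (\<lambda>i. 0)"
    obtain i where i: "x i \<noteq> 0" using x(3) by auto
    then have "i < m" using x(1) by (metis not_less)
    have "vec m x \<noteq> 0\<^sub>v m" using i \<open>i < m\<close> by (metis index_vec index_zero_vec(1))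
    moreover have "A *\<^sub>v vec m x = c \<cdot>\<^sub>v vec m x"
    proof (rule eq_vecI)
      fix j assume "j < dim_vec (c \<cdot>\<^sub>v vec m x)"
      then have j: "j < m" by simp
      have "mat_app m A x j = c * x j" using x(2) unfolding eigenvec_def by metis
      then show "(A *\<^sub>v vec m x) $ j = (c \<cdot>\<^sub>v vec m x) $ j"
        using j assms by (simp add: mat_app_def scalar_prod_def atLeast0LessThan)
    qed (use assms in simp)
    ultimately have "eigenvector A (vec m x) c" using assms by (simp add: eigenvector_def)
    then show "c \<in> spectrum A" unfolding spectrum_def eigenvalue_def by blast
  qed
qed


subsection \<open>Connected solvable groups have common eigenvectors\<close>

text \<open>Agreement with a polynomial is demanded on \<open>G\<close> only, because a map
  involving inverses, for example, is controlled on the group alone.\<close>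

definition pf_on :: "nat \<Rightarrow> complex mat set \<Rightarrow> (complex mat \<Rightarrow> complex) \<Rightarrow> bool" where
  "pf_on n G f \<longleftrightarrow> (\<exists>f'. pf n f' \<and> (\<forall>g\<in>G. f g = f' g))"

lemma pf_onI: "pf n f' \<Longrightarrow> (\<And>g. g \<in> G \<Longrightarrow> f g = f' g) \<Longrightarrow> pf_on n G f"
  unfolding pf_on_def by (intro exI[of _ f'] conjI ballI)

lemma pf_onE:
  assumes "pf_on n G f"
  obtains f' where "pf n f'" "\<And>g. g \<in> G \<Longrightarrow> f g = f' g"
proof -
  obtain f' where "pf n f' \<and> (\<forall>g\<in>G. f g = f' g)" using assms unfolding pf_on_def ..
  then have "pf n f'" "\<And>g. g \<in> G \<Longrightarrow> f g = f' g" by simp_all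
  then show ?thesis by (rule that)
qed

lemma pf_on_pf: "pf n f \<Longrightarrow> pf_on n G f"
  by (rule pf_onI) simp_all

lemma pf_on_subset: "pf_on n G f \<Longrightarrow> H \<subseteq> G \<Longrightarrow> pf_on n H f"
  by (erule pf_onE, rule pf_onI) (assumption, simp add: subset_iff)

lemma pf_on_cong: "pf_on n G f \<Longrightarrow> (\<And>g. g \<in> G \<Longrightarrow> f g = f' g) \<Longrightarrow> pf_on n G f'"
  unfolding pf_on_def by simp

lemma pf_on_add: assumes "pf_on n G f" "pf_on n G g" shows "pf_on n G (\<lambda>A. f A + g A)"
proof -
  obtain f' g' where *: "pf n f'" "\<And>A. A \<in> G \<Longrightarrow> f A = f' A" "pf n g'" "\<And>A. A \<in> G \<Longrightarrow> g A = g' A"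
    using pf_onE[OF assms(1)] pf_onE[OF assms(2)] by metis
  show ?thesis
    by (rule pf_onI[OF pf_add[OF *(1,3)]]) (simp only: *(2,4))
qed

lemma pf_on_mult: assumes "pf_on n G f" "pf_on n G g" shows "pf_on n G (\<lambda>A. f A * g A)"
proof -
  obtain f' g' where *: "pf n f'" "\<And>A. A \<in> G \<Longrightarrow> f A = f' A" "pf n g'" "\<And>A. A \<in> G \<Longrightarrow> g A = g' A"
    using pf_onE[OF assms(1)] pf_onE[OF assms(2)] by metis
  show ?thesis
    by (rule pf_onI[OF pf_mult[OF *(1,3)]]) (simp only: *(2,4))
qed

lemma pf_on_const: "pf_on n G (\<lambda>A. c)"
  by (rule pf_on_pf[OF pf_const])

lemma pf_on_diff: "pf_on n G f \<Longrightarrow> pf_on n G g \<Longrightarrow> pf_on n G (\<lambda>A. f A - g A)"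
  using pf_on_add[of n G f "\<lambda>A. (-1) * g A"] pf_on_mult[OF pf_on_const[of n G "-1"], of g] by simp

lemma pf_on_sum: "(\<And>x. x \<in> X \<Longrightarrow> pf_on n G (f x)) \<Longrightarrow> pf_on n G (\<lambda>A. \<Sum>x\<in>X. f x A)"
  by (induction X rule: infinite_finite_induct) (simp_all add: pf_on_const pf_on_add)

definition poly_rep :: "nat \<Rightarrow> nat \<Rightarrow> complex mat set \<Rightarrow> (complex mat \<Rightarrow> complex mat) \<Rightarrow> bool" where
  "poly_rep n m G \<rho> \<longleftrightarrow> (\<forall>g\<in>G. \<rho> g \<in> carrier_mat m m) \<and> (\<forall>g\<in>G. \<forall>h\<in>G. \<rho> (g * h) = \<rho> g * \<rho> h) \<and>
     \<rho> (1\<^sub>m n) = 1\<^sub>m m \<and> (\<forall>i<m. \<forall>j<m. pf_on n G (\<lambda>g. \<rho> g $$ (i, j)))"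

lemma poly_rep_subset: "poly_rep n m G \<rho> \<Longrightarrow> H \<subseteq> G \<Longrightarrow> poly_rep n m H \<rho>"
  unfolding poly_rep_def
  by (intro conjI ballI allI impI; (elim conjE)?) (blast intro: pf_on_subset subsetD)+

lemma subgroup_GL_mult: "subgroup G (GL n) \<Longrightarrow> g \<in> G \<Longrightarrow> h \<in> G \<Longrightarrow> g * h \<in> G"
  using subgroup.m_closed[of G "GL n" g h] by simp

lemma subgroup_GL_one: "subgroup G (GL n) \<Longrightarrow> 1\<^sub>m n \<in> G"
  using subgroup.one_closed[of G "GL n"] by simp

lemma subgroup_GL_carrier: "subgroup G (GL n) \<Longrightarrow> g \<in> G \<Longrightarrow> g \<in> carrier (GL n)"
  by (rule subgroup.mem_carrier)

lemma poly_rep_app_mult: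
  assumes "poly_rep n m G \<rho>" "g \<in> G" "h \<in> G"
  shows "mat_app m (\<rho> (g * h)) x = mat_app m (\<rho> g) (mat_app m (\<rho> h) x)"
  using assms by (simp add: poly_rep_def mat_app_mult)

lemma poly_rep_app_nonzero:
  assumes "subgroup G (GL n)" "poly_rep n m G \<rho>" "g \<in> G" "\<And>i. i \<ge> m \<Longrightarrow> x i = 0" "x \<noteq> (\<lambda>i. 0)"
  shows "mat_app m (\<rho> g) x \<noteq> (\<lambda>i. 0)"
proof
  assume "mat_app m (\<rho> g) x = (\<lambda>i. 0)"
  then have "mat_app m (\<rho> (GL_inv n g * g)) x = (\<lambda>i. 0)"
    using poly_rep_app_mult[OF assms(2) subgroup.m_inv_closed[OF assms(1,3)] assms(3)]
    by (simp add: mat_app_zero)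
  moreover have "mat_app m (\<rho> (GL_inv n g * g)) x = x"
    using assms by (simp add: GL_inv_left subgroup_GL_carrier poly_rep_def mat_app_one)
  ultimately show False using assms(5) by simp
qed

lemma pf_on_mat_app:
  assumes "\<And>j. j < m \<Longrightarrow> pf_on n G (\<lambda>g. y g j)"
  shows "pf_on n G (\<lambda>g. mat_app m A (y g) i)"
proof (cases "i < m")
  case True
  have "pf_on n G (\<lambda>g. \<Sum>j<m. A $$ (i, j) * y g j)"
    by (intro pf_on_sum pf_on_mult pf_on_const) (simp add: assms)
  then show ?thesis using True by (simp add: mat_app_def)
qed (simp add: mat_app_def pf_on_const)

lemma pf_on_rep_app:
  assumes "poly_rep n m G \<rho>"
  shows "pf_on n G (\<lambda>g. mat_app m (\<rho> g) x i)"
proof (cases "i < m")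
  case True
  have "pf_on n G (\<lambda>g. \<Sum>j<m. \<rho> g $$ (i, j) * x j)"
    using assms True by (intro pf_on_sum pf_on_mult pf_on_const) (simp add: poly_rep_def)
  then show ?thesis using True by (simp add: mat_app_def)
qed (simp add: mat_app_def pf_on_const)

text \<open>The group is covered by the closed sets on which the eigenvalue of \<open>H\<close> at
  the moved vector is a given c. There are finitely many such c, and the sets are disjoint on
  \<open>G\<close> because the moved vector is nonzero. A connected group lies in a single one of
  them, the one containing the identity.\<close>

lemma connected_group_eigenvalue:
  assumes G: "subgroup G (GL n)" "connectedin (GL_topology n) G" and rep: "poly_rep n m G \<rho>"
    and H: "H \<in> carrier_mat m m" and x: "\<And>i. i \<ge> m \<Longrightarrow> x i = 0" "x \<noteq> (\<lambda>i. 0)"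
    and ev: "\<And>g. g \<in> G \<Longrightarrow> \<exists>c. eigenvec m H (mat_app m (\<rho> g) x) c"
    and ev1: "eigenvec m H x c0" and g: "g \<in> G"
  shows "eigenvec m H (mat_app m (\<rho> g) x) c0"
proof -
  let ?y = "\<lambda>g. mat_app m (\<rho> g) x"
  define E where "E = {c. \<exists>x. x \<noteq> (\<lambda>i. 0) \<and> (\<forall>i\<ge>m. x i = 0) \<and> eigenvec m H x c}"
  have finE: "finite E" unfolding E_def by (rule finite_eigenvalues[OF H])
  have evE: "\<exists>c\<in>E. eigenvec m H (?y g) c" if g: "g \<in> G" for g
  proof -
    obtain c where c: "eigenvec m H (?y g) c" using ev[OF g] by blast
    have "?y g \<noteq> (\<lambda>i. 0)" "\<forall>i\<ge>m. ?y g i = 0"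
      using poly_rep_app_nonzero[OF G(1) rep g x] by (simp_all add: mat_app_def)
    with c show ?thesis unfolding E_def by blast
  qed
  have "\<exists>C. closedin (GL_topology n) C \<and> (\<forall>g\<in>G. g \<in> C \<longleftrightarrow> eigenvec m H (?y g) c)" for c
  proof -
    have "pf_on n G (\<lambda>g. mat_app m H (?y g) i - c * ?y g i)" for i
      by (intro pf_on_diff pf_on_mult pf_on_const pf_on_mat_app pf_on_rep_app[OF rep])
    then have "\<forall>i. \<exists>f. pf n f \<and> (\<forall>g\<in>G. mat_app m H (?y g) i - c * ?y g i = f g)"
      unfolding pf_on_def ..
    from choice[OF this] obtain F where F': "\<forall>i. pf n (F i) \<and> (\<forall>g\<in>G. mat_app m H (?y g) i - c * ?y g i = F i g)" ..
    then have F: "\<And>i. pf n (F i)" "\<And>i g. g \<in> G \<Longrightarrow> F i g = mat_app m H (?y g) i - c * ?y g i"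
      by simp_all
    have "closedin (GL_topology n) {g \<in> carrier (GL n). \<forall>f\<in>range F. f g = 0}"
      unfolding closedin_GL_topology by (rule exI[of _ "range F"]) (use F(1) in auto)
    moreover have "g \<in> {g \<in> carrier (GL n). \<forall>f\<in>range F. f g = 0} \<longleftrightarrow> eigenvec m H (?y g) c" if "g \<in> G" for g
      using that subgroup_GL_carrier[OF G(1) that] 
      by (simp add: F(2)[OF that] eigenvec_def fun_eq_iff)
    ultimately show ?thesis by blast
  qed
  then have "\<forall>c. \<exists>C. closedin (GL_topology n) C \<and> (\<forall>g\<in>G. g \<in> C \<longleftrightarrow> eigenvec m H (?y g) c)" by blast
  from choice[OF this] obtain C where C: "\<And>c. closedin (GL_topology n) (C c)"
    "\<And>c g. g \<in> G \<Longrightarrow> g \<in> C c \<longleftrightarrow> eigenvec m H (?y g) c" by auto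
  define C' where "C' = \<Union>(C ` (E - {c0}))"
  have "closedin (GL_topology n) C'"
    unfolding C'_def by (rule closedin_Union) (use finE C(1) in auto)
  moreover have "G \<subseteq> C c0 \<union> C'"
  proof
    fix g assume g: "g \<in> G"
    then obtain c where "c \<in> E" "eigenvec m H (?y g) c" using evE by blast
    then show "g \<in> C c0 \<union> C'" using C(2)[OF g] unfolding C'_def by blast
  qed
  moreover have "C c0 \<inter> C' \<inter> G = {}"
  proof (rule ccontr)
    assume "C c0 \<inter> C' \<inter> G \<noteq> {}"
    then obtain g c where g: "g \<in> G" "g \<in> C c0" "g \<in> C c" "c \<noteq> c0" unfolding C'_def by blast
    then have "eigenvec m H (?y g) c0" "eigenvec m H (?y g) c" using C(2) by auto
    then have "(\<lambda>i. c0 * ?y g i) = (\<lambda>i. c * ?y g i)" unfolding eigenvec_def by simp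
    then have "?y g i = 0" for i using g(4) by (metis mult_cancel_right)
    then show False using poly_rep_app_nonzero[OF G(1) rep g(1) x] by blast
  qed
  moreover have "1\<^sub>m n \<in> C c0 \<inter> G"
    using C(2)[OF subgroup_GL_one[OF G(1)], of c0] subgroup_GL_one[OF G(1)] ev1 rep x(1)
    by (simp add: poly_rep_def mat_app_one)
  ultimately have "C' \<inter> G = {}"
    using G(2) C(1)[of c0] unfolding connectedin_closedin by blast
  then show ?thesis using g \<open>G \<subseteq> C c0 \<union> C'\<close> C(2) by blast
qed

text \<open>The vectors of \<open>V\<close> whose whole \<open>G\<close>-orbit lies in the
  eigenspace of \<open>H\<close> for c form a \<open>G\<close>-stable subspace. It contains
  \<open>u\<close> because the eigenvalue is constant along the orbit of \<open>u\<close>, so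
  minimality makes it all of \<open>V\<close>.\<close>

lemma scalar_on_minimal_subspace:
  assumes G: "subgroup G (GL n)" "connectedin (GL_topology n) G" and rep: "poly_rep n m G \<rho>"
    and V: "lin_subspace m V" "\<And>g x. g \<in> G \<Longrightarrow> x \<in> V \<Longrightarrow> mat_app m (\<rho> g) x \<in> V"
    and min: "\<And>W. lin_subspace m W \<Longrightarrow> (\<And>g x. g \<in> G \<Longrightarrow> x \<in> W \<Longrightarrow> mat_app m (\<rho> g) x \<in> W) \<Longrightarrow>
        W \<noteq> {\<lambda>i. 0} \<Longrightarrow> W \<subseteq> V \<Longrightarrow> W = V"
    and H: "H \<in> carrier_mat m m" and u: "u \<in> V" "u \<noteq> (\<lambda>i. 0)"
    and ev: "\<And>g. g \<in> G \<Longrightarrow> \<exists>c. eigenvec m H (mat_app m (\<rho> g) u) c"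
    and x: "x \<in> V" and ev1: "eigenvec m H u c"
  shows "eigenvec m H x c"
proof -
  define W where "W = {y \<in> V. \<forall>g\<in>G. eigenvec m H (mat_app m (\<rho> g) y) c}"
  have "lin_subspace m W"
  proof (rule lin_subspaceI)
    show "x i = 0" if "x \<in> W" "m \<le> i" for x i
      using that lin_subspace_supp[OF V(1)] unfolding W_def by blast
    show "(\<lambda>i. 0) \<in> W"
      using lin_subspace_zero[OF V(1)] by (simp add: W_def mat_app_zero eigenvec_def)
    show "(\<lambda>i. x i + y i) \<in> W" if "x \<in> W" "y \<in> W" for x y
      using that lin_subspace_add[OF V(1)] by (simp add: W_def mat_app_add eigenvec_def distrib_left)
    show "(\<lambda>i. c * x i) \<in> W" if "x \<in> W" for c x
      using that lin_subspace_smult[OF V(1)] by (simp add: W_def mat_app_smult eigenvec_def mult.left_commute)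
  qed
  moreover have "mat_app m (\<rho> g) y \<in> W" if "g \<in> G" "y \<in> W" for g y
    using that V(2) subgroup_GL_mult[OF G(1) _ that(1)]
    by (auto simp: W_def simp flip: poly_rep_app_mult[OF rep _ that(1)])
  moreover have uW: "u \<in> W"
    using connected_group_eigenvalue[OF G rep H lin_subspace_supp[OF V(1) u(1)] u(2) ev ev1] u(1)
    by (simp add: W_def)
  moreover have "W \<noteq> {\<lambda>i. 0}" using uW u(2) by blast
  moreover have "W \<subseteq> V" by (auto simp: W_def)
  ultimately have "W = V" using min by metis
  then have "eigenvec m H (mat_app m (\<rho> (1\<^sub>m n)) x) c"
    using x subgroup_GL_one[OF G(1)] by (auto simp: W_def)
  then show ?thesis
    using rep lin_subspace_supp[OF V(1) x] by (simp add: poly_rep_def mat_app_one)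
qed

lemma commutator_in_derived:
  assumes "g \<in> G" "h \<in> G"
  shows "g * h * GL_inv n g * GL_inv n h \<in> derived (GL n) G"
  unfolding derived_def by (rule generate.incl) (use assms in auto)

text \<open>Lie--Kolchin, by induction on the derived length. On a minimal stable subspace the
  derived group is seen to act by scalars, then the whole group, so that any nonzero vector in it is
  a common eigenvector. The induction hypothesis is applied to the derived group, which must again
  be connected; this enters as \<open>conn\<close> and is supplied later by
  \<open>connectedin_derived\<close>.\<close>

lemma common_eigenvec:
  assumes "subgroup G (GL n)" "connectedin (GL_topology n) G" "poly_rep n m G \<rho>"
    "(derived (GL n) ^^ d) G = {1\<^sub>m n}"
    "lin_subspace m V" "\<And>g x. g \<in> G \<Longrightarrow> x \<in> V \<Longrightarrow> mat_app m (\<rho> g) x \<in> V" "V \<noteq> {\<lambda>i. 0}"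
    and conn: "\<And>H. subgroup H (GL n) \<Longrightarrow> connectedin (GL_topology n) H \<Longrightarrow>
       connectedin (GL_topology n) (derived (GL n) H)"
  shows "\<exists>u\<in>V. u \<noteq> (\<lambda>i. 0) \<and> (\<forall>g\<in>G. \<exists>c. eigenvec m (\<rho> g) u c)"
  using assms(1-7)
proof (induction d arbitrary: G V)
  case 0
  obtain x where x: "x \<in> V" "x \<noteq> (\<lambda>i. 0)" using 0 lin_subspace_zero[of m V] by blast
  have "eigenvec m (\<rho> g) x 1" if "g \<in> G" for g
    using that 0 x lin_subspace_supp[OF 0(5) x(1)] by (simp add: poly_rep_def eigenvec_def mat_app_one)
  then show ?case using x by blast
next
  case (Suc d)
  note G = Suc.prems(1,2) and rep = Suc.prems(3)
  interpret group "GL n" by (rule group_GL)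
  define \<F> where "\<F> = {W. lin_subspace m W \<and> (\<forall>g\<in>G. \<forall>x\<in>W. mat_app m (\<rho> g) x \<in> W) \<and> W \<noteq> {\<lambda>i. 0} \<and> W \<subseteq> V}"
  have "V \<in> \<F>" using Suc.prems unfolding \<F>_def by simp
  then obtain V0 where V0: "V0 \<in> \<F>" "\<And>W. W \<in> \<F> \<Longrightarrow> W \<subseteq> V0 \<Longrightarrow> W = V0"
    by (rule_tac minimal_lin_subspace[of \<F> m]) (auto simp: \<F>_def)
  have lin: "lin_subspace m V0" and inv: "\<And>g x. g \<in> G \<Longrightarrow> x \<in> V0 \<Longrightarrow> mat_app m (\<rho> g) x \<in> V0"
    and sub: "V0 \<subseteq> V" and nz: "V0 \<noteq> {\<lambda>i. 0}"
    using V0(1) unfolding \<F>_def by auto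
  have min: "W = V0" if "lin_subspace m W" "\<And>g x. g \<in> G \<Longrightarrow> x \<in> W \<Longrightarrow> mat_app m (\<rho> g) x \<in> W"
        "W \<noteq> {\<lambda>i. 0}" "W \<subseteq> V0" for W
    using that sub by (intro V0(2)) (auto simp: \<F>_def)
  have scalar: "eigenvec m H x c" if "H \<in> carrier_mat m m" "u \<in> V0" "u \<noteq> (\<lambda>i. 0)"
    "\<And>g. g \<in> G \<Longrightarrow> \<exists>c. eigenvec m H (mat_app m (\<rho> g) u) c" "eigenvec m H u c" "x \<in> V0" for H u x c
  proof (rule scalar_on_minimal_subspace[OF G rep lin, where u = u])
    show "mat_app m (\<rho> g) x \<in> V0" if "g \<in> G" "x \<in> V0" for g x by (rule inv[OF that])
    show "W = V0" if "lin_subspace m W" "\<And>g x. g \<in> G \<Longrightarrow> x \<in> W \<Longrightarrow> mat_app m (\<rho> g) x \<in> W"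
        "W \<noteq> {\<lambda>i. 0}" "W \<subseteq> V0" for W by (rule min[OF that])
  qed (use that in auto)
  let ?G' = "derived (GL n) G"
  have G': "subgroup ?G' (GL n)" "?G' \<subseteq> G" "connectedin (GL_topology n) ?G'"
    using derived_is_subgroup[OF subgroup.subset[OF G(1)]] derived_incl[OF order_refl G(1)] conn[OF G] by auto
  have "(derived (GL n) ^^ d) ?G' = {1\<^sub>m n}"
    using Suc.prems(4) by (simp add: funpow_swap1)
  then obtain u where u: "u \<in> V0" "u \<noteq> (\<lambda>i. 0)" "\<And>g. g \<in> ?G' \<Longrightarrow> \<exists>c. eigenvec m (\<rho> g) u c"
    using Suc.IH[OF G'(1,3) poly_rep_subset[OF rep G'(2)] _ lin _ nz] inv G'(2) by blast
  have mat: "\<rho> g \<in> carrier_mat m m" if "g \<in> G" for g using that rep by (simp add: poly_rep_def)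
  have car: "g \<in> carrier_mat n n" "g \<in> carrier (GL n)" "GL_inv n g \<in> carrier_mat n n" "GL_inv n g \<in> G" if "g \<in> G" for g
    using subgroup_GL_carrier[OF G(1) that] GL_carrier_mat subgroup.m_inv_closed[OF G(1) that]
      subgroup_GL_carrier[OF G(1)] by blast+
  have scal': "\<exists>c. \<forall>x\<in>V0. eigenvec m (\<rho> h) x c" if h: "h \<in> ?G'" for h
  proof -
    have hG: "h \<in> G" using h G'(2) by blast
    obtain c where c: "eigenvec m (\<rho> h) u c" using u(3)[OF h] by blast
    have "\<exists>c. eigenvec m (\<rho> h) (mat_app m (\<rho> g) u) c" if g: "g \<in> G" for g
    proof -
      \<comment> \<open>This is the conjugate of h by g, that is, g^-1 h g, written as h times a
        commutator to show that it lies in the derived group. As h g = g k and u is an eigenvector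
        of k, the vector moved by g is an eigenvector of h.\<close>
      define k where "k = h * (GL_inv n h * GL_inv n g * h * g)"
      have "GL_inv n h * GL_inv n g * h * g \<in> ?G'"
        using commutator_in_derived[of "GL_inv n h" G "GL_inv n g" n] car[OF hG] car[OF g] by simp
      then have kG': "k \<in> ?G'" unfolding k_def using subgroup_GL_mult[OF G'(1) h] by blast
      have "g * k = g * (h * GL_inv n h) * GL_inv n g * h * g"
        using car[OF hG] car[OF g] unfolding k_def
        by (smt (verit) assoc_mult_mat mult_carrier_mat)
      also have "\<dots> = h * g"
        using car[OF hG] car[OF g] by (simp add: GL_inv_right)
      finally have gk: "g * k = h * g" .
      obtain c' where "eigenvec m (\<rho> k) u c'" using u(3)[OF kG'] by blast
      then have "mat_app m (\<rho> h) (mat_app m (\<rho> g) u) = (\<lambda>i. c' * mat_app m (\<rho> g) u i)"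
        using poly_rep_app_mult[OF rep hG g, of u] poly_rep_app_mult[OF rep g, of k u] kG' G'(2) gk
        by (auto simp: eigenvec_def mat_app_smult)
      then show ?thesis unfolding eigenvec_def by blast
    qed
    then show ?thesis using scalar[OF mat[OF hG] u(1,2) _ c] by blast
  qed
  have scal: "\<exists>c. \<forall>x\<in>V0. eigenvec m (\<rho> h) x c" if h: "h \<in> G" for h
  proof -
    obtain y c where y: "y \<in> V0" "y \<noteq> (\<lambda>i. 0)" "eigenvec m (\<rho> h) y c"
      using eigenvec_in_subspace[OF lin inv[OF h] u(1,2)] by blast
    have "\<exists>c. eigenvec m (\<rho> h) (mat_app m (\<rho> g) y) c" if g: "g \<in> G" for g
    proof -
      \<comment> \<open>The commutator already acts by a scalar on \<open>V0\<close>. From h g = k g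
        h, the eigenvector y of h is thus moved by g to another eigenvector of h.\<close>
      define k where "k = h * g * GL_inv n h * GL_inv n g"
      have kG': "k \<in> ?G'" unfolding k_def using commutator_in_derived h g by blast
      have "k * (g * h) = h * g * GL_inv n h * (GL_inv n g * g) * h"
        using car[OF h] car[OF g] unfolding k_def
        by (smt (verit) assoc_mult_mat mult_carrier_mat)
      also have "\<dots> = h * g * (GL_inv n h * h)"
        using car[OF h] car[OF g] by (simp add: GL_inv_left assoc_mult_mat[of _ n n _ n _ n])
      also have "\<dots> = h * g"
        using car[OF h] car[OF g] by (simp add: GL_inv_left)
      finally have kgh: "k * (g * h) = h * g" .
      obtain c' where c': "\<And>x. x \<in> V0 \<Longrightarrow> eigenvec m (\<rho> k) x c'" using scal'[OF kG'] by blast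
      have "mat_app m (\<rho> h) (mat_app m (\<rho> g) y) = mat_app m (\<rho> k) (mat_app m (\<rho> g) (mat_app m (\<rho> h) y))"
        using poly_rep_app_mult[OF rep h g, of y] poly_rep_app_mult[OF rep g h, of y]
          poly_rep_app_mult[OF rep, of k "g * h" y] kgh kG' G'(2) subgroup_GL_mult[OF G(1) g h] by auto
      also have "\<dots> = (\<lambda>i. c' * (c * mat_app m (\<rho> g) y i))"
        using c'[OF inv[OF g y(1)]] y(3) by (simp add: eigenvec_def mat_app_smult mult.left_commute)
      finally have "eigenvec m (\<rho> h) (mat_app m (\<rho> g) y) (c' * c)" by (simp add: eigenvec_def mult.assoc)
      then show ?thesis by blast
    qed
    then show ?thesis using scalar[OF mat[OF h] y(1,2) _ y(3)] by blast
  qed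
  show ?case using scal u sub by blast
qed


subsection \<open>Connectedness of the derived group\<close>

lemma pmf_adj: "pmf n n adj_mat"
proof -
  have del: "pmf n (n - 1) (\<lambda>A. mat_delete A j i)" if "i < n" "j < n" for i j
    unfolding pmf_def
  proof (intro conjI ballI allI impI)
    fix k l assume kl: "k < n - 1" "l < n - 1"
    have "pf n (\<lambda>A. A $$ (if k < j then k else Suc k, if l < i then l else Suc l))"
      using kl by (intro pf_entry) auto
    then show "pf n (\<lambda>A. mat_delete A j i $$ (k, l))"
      by (rule pf_cong) (use kl in \<open>auto simp: mat_delete_def\<close>)
  qed (auto simp: mat_delete_def)
  show ?thesis
    unfolding pmf_def
  proof (intro conjI ballI allI impI)
    fix i j assume ij: "i < n" "j < n"
    have "pf n (\<lambda>A. (-1) ^ (j + i) * det (mat_delete A j i))"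
      by (intro pf_mult pf_const pf_det[OF del] ij)
    then show "pf n (\<lambda>A. adj_mat A $$ (i, j))"
      by (rule pf_cong) (use ij in \<open>auto simp: adj_mat_def cofactor_def\<close>)
  qed (rule adj_mat)
qed

lemma GL_inv_adj:
  assumes "h \<in> carrier (GL n)"
  shows "adj_mat h = det h \<cdot>\<^sub>m GL_inv n h"
proof -
  have h: "h \<in> carrier_mat n n" "GL_inv n h \<in> carrier_mat n n"
    using assms GL_inv_closed GL_carrier_mat by auto
  have "adj_mat h = GL_inv n h * h * adj_mat h"
    using h adj_mat(1)[OF h(1)] by (simp add: GL_inv_left[OF assms])
  also have "\<dots> = GL_inv n h * (det h \<cdot>\<^sub>m 1\<^sub>m n)"
    using h adj_mat[OF h(1)] by (simp add: assoc_mult_mat[of _ n n _ n _ n])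
  also have "\<dots> = det h \<cdot>\<^sub>m GL_inv n h"
    using h by (simp add: mult_smult_distrib[of _ n n _ n])
  finally show ?thesis .
qed

text \<open>Inversion introduces the determinant as a denominator, which a sufficiently high power
  of \<open>det\<close> clears. Since the determinant has no zeros on the group, the zero locus does
  not change.\<close>

lemma pf_on_clear_det:
  assumes "pf n f" "\<And>h. h \<in> carrier (GL n) \<Longrightarrow> M h \<in> carrier_mat n n"
    and M: "\<And>i j. i < n \<Longrightarrow> j < n \<Longrightarrow> pf_on n (carrier (GL n)) (\<lambda>h. M h $$ (i, j) * det h)"
  shows "\<exists>N. pf_on n (carrier (GL n)) (\<lambda>h. f (M h) * det h ^ N)"
proof -
  obtain g where g: "g \<in> polynomial_functions n" "\<forall>A\<in>carrier_mat n n. f A = g A"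
    using assms(1) unfolding pf_def by (elim bexE)
  have d: "pf_on n (carrier (GL n)) (\<lambda>h. det h ^ N)" for N
    by (intro pf_on_pf pf_power pf_det[OF pmf_id])
  from g(1) have "\<exists>N. pf_on n (carrier (GL n)) (\<lambda>h. g (M h) * det h ^ N)"
  proof induction
    case (const c)
    show ?case by (intro exI[of _ 0] pf_on_mult pf_on_const d)
  next
    case (entry i j)
    show ?case using M[OF entry] by (intro exI[of _ 1]) simp
  next
    case (add f g)
    then obtain N K where "pf_on n (carrier (GL n)) (\<lambda>h. f (M h) * det h ^ N)"
      "pf_on n (carrier (GL n)) (\<lambda>h. g (M h) * det h ^ K)" by (elim exE)
    then have "pf_on n (carrier (GL n)) (\<lambda>h. f (M h) * det h ^ N * det h ^ K + g (M h) * det h ^ K * det h ^ N)"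
      by (rule pf_on_add[OF pf_on_mult[OF _ d] pf_on_mult[OF _ d]])
    then show ?case by (intro exI[of _ "N + K"]) (simp add: power_add algebra_simps)
  next
    case (mult f g)
    then obtain N K where "pf_on n (carrier (GL n)) (\<lambda>h. f (M h) * det h ^ N)"
      "pf_on n (carrier (GL n)) (\<lambda>h. g (M h) * det h ^ K)" by (elim exE)
    then have "pf_on n (carrier (GL n)) (\<lambda>h. f (M h) * det h ^ N * (g (M h) * det h ^ K))"
      by (rule pf_on_mult)
    then show ?case by (intro exI[of _ "N + K"]) (simp add: power_add algebra_simps)
  qed
  then obtain N where "pf_on n (carrier (GL n)) (\<lambda>h. g (M h) * det h ^ N)" ..
  then have "pf_on n (carrier (GL n)) (\<lambda>h. f (M h) * det h ^ N)"
    by (rule pf_on_cong) (use g(2) assms(2) in simp)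
  then show ?thesis ..
qed

lemma continuous_map_GL:
  assumes \<phi>: "\<And>h. h \<in> carrier (GL n) \<Longrightarrow> \<phi> h \<in> carrier (GL n)"
    and ent: "\<And>i j. i < n \<Longrightarrow> j < n \<Longrightarrow> pf_on n (carrier (GL n)) (\<lambda>h. \<phi> h $$ (i, j) * det h)"
  shows "continuous_map (GL_topology n) (GL_topology n) \<phi>"
  unfolding continuous_map_closedin topspace_GL_topology
proof (intro conjI ballI allI impI)
  fix C assume "closedin (GL_topology n) C"
  then obtain F where F: "\<forall>f\<in>F. pf n f" "C = {A \<in> carrier (GL n). \<forall>f\<in>F. f A = 0}"
    unfolding closedin_GL_topology by (elim exE conjE)
  have "\<exists>f'. pf n f' \<and> (\<forall>h\<in>carrier (GL n). f (\<phi> h) = 0 \<longleftrightarrow> f' h = 0)" if f: "f \<in> F" for f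
  proof -
    obtain N where "pf_on n (carrier (GL n)) (\<lambda>h. f (\<phi> h) * det h ^ N)"
      using pf_on_clear_det[of n f \<phi>, OF _ GL_carrier_mat[OF \<phi>] ent] F(1) f by blast
    then obtain f' where "pf n f' \<and> (\<forall>h\<in>carrier (GL n). f (\<phi> h) * det h ^ N = f' h)"
      unfolding pf_on_def ..
    then have f': "pf n f'" "\<And>h. h \<in> carrier (GL n) \<Longrightarrow> f (\<phi> h) * det h ^ N = f' h" by simp_all
    have "f (\<phi> h) = 0 \<longleftrightarrow> f' h = 0" if "h \<in> carrier (GL n)" for h
      using that f'(2)[OF that, symmetric] by (simp add: carrier_GL)
    with f'(1) show ?thesis by (intro exI[of _ f'] conjI ballI)
  qed
  then have "\<forall>f\<in>F. \<exists>f'. pf n f' \<and> (\<forall>h\<in>carrier (GL n). f (\<phi> h) = 0 \<longleftrightarrow> f' h = 0)" by simp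
  from bchoice[OF this] obtain r where
    "\<forall>f\<in>F. pf n (r f) \<and> (\<forall>h\<in>carrier (GL n). f (\<phi> h) = 0 \<longleftrightarrow> r f h = 0)" ..
  then have r: "\<And>f. f \<in> F \<Longrightarrow> pf n (r f)"
    "\<And>f h. f \<in> F \<Longrightarrow> h \<in> carrier (GL n) \<Longrightarrow> r f h = 0 \<longleftrightarrow> f (\<phi> h) = 0" by simp_all
  have "{x \<in> carrier (GL n). \<phi> x \<in> C} = {A \<in> carrier (GL n). \<forall>f\<in>r ` F. f A = 0}"
    using \<phi> by (auto simp: F(2) r(2))
  then show "closedin (GL_topology n) {x \<in> carrier (GL n). \<phi> x \<in> C}"
    unfolding closedin_GL_topology using r(1) by (intro exI[of _ "r ` F"]) simp
qed (use \<phi> in auto)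

text \<open>For fixed g the commutators of g with all h in \<open>G\<close> form a connected set
  containing 1, and the inverse of a commutator is the commutator in the other order. If
  \<open>C\<close> joins 1 to x and \<open>C'\<close> joins 1 to y, then \<open>C\<close> and the
  translate of \<open>C'\<close> by x meet in x, so their union joins 1 to x y.\<close>

lemma connectedin_derived:
  assumes G: "subgroup G (GL n)" "connectedin (GL_topology n) G"
  shows "connectedin (GL_topology n) (derived (GL n) G)"
proof -
  interpret group "GL n" by (rule group_GL)
  let ?D = "derived (GL n) G" and ?X = "GL_topology n"
  have sub: "subgroup ?D (GL n)" using derived_is_subgroup[OF subgroup.subset[OF G(1)]] .
  have car: "g \<in> carrier_mat n n" "GL_inv n g \<in> carrier_mat n n" "GL_inv n g \<in> carrier (GL n)"
    "g \<in> carrier (GL n)" if "g \<in> G" for g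
    using subgroup_GL_carrier[OF G(1) that] GL_inv_closed GL_carrier_mat by blast+
  have comm: "connectedin ?X ((\<lambda>h. g * h * GL_inv n g * GL_inv n h) ` G)" if g: "g \<in> G" for g
  proof (rule connectedin_continuous_map_image[OF _ G(2)], rule continuous_map_GL)
    fix h assume h: "h \<in> carrier (GL n)"
    show "g * h * GL_inv n g * GL_inv n h \<in> carrier (GL n)"
      using h car[OF g] by (simp add: GL_mult_closed GL_inv_closed)
  next
    fix i j assume ij: "i < n" "j < n"
    have P: "pmf n n (\<lambda>h. g * h * GL_inv n g * adj_mat h)"
      by (intro pmf_mult pmf_const pmf_id pmf_adj car g)
    show "pf_on n (carrier (GL n)) (\<lambda>h. (g * h * GL_inv n g * GL_inv n h) $$ (i, j) * det h)"
    proof (rule pf_onI)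
      show "pf n (\<lambda>h. (g * h * GL_inv n g * adj_mat h) $$ (i, j))"
        using P ij unfolding pmf_def by simp
      fix h assume h: "h \<in> carrier (GL n)"
      have "g * h * GL_inv n g * adj_mat h = det h \<cdot>\<^sub>m (g * h * GL_inv n g * GL_inv n h)"
        using car[OF g] GL_carrier_mat[OF h] GL_carrier_mat[OF GL_inv_closed[OF h]]
        unfolding GL_inv_adj[OF h] by (intro mult_smult_distrib[of _ n n _ n]) auto
      then show "(g * h * GL_inv n g * GL_inv n h) $$ (i, j) * det h = (g * h * GL_inv n g * adj_mat h) $$ (i, j)"
        using ij car[OF g] GL_carrier_mat[OF h] GL_carrier_mat[OF GL_inv_closed[OF h]] by simp
    qed
  qed
  have left: "connectedin ?X ((*) g ` C)" if "g \<in> carrier (GL n)" "connectedin ?X C" for g C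
  proof (rule connectedin_continuous_map_image[OF _ that(2)], rule continuous_map_GL)
    show "g * h \<in> carrier (GL n)" if "h \<in> carrier (GL n)" for h
      using that \<open>g \<in> carrier (GL n)\<close> by (rule GL_mult_closed[rotated])
    have "pmf n n (\<lambda>h. g * h)" using that(1) by (intro pmf_mult pmf_const pmf_id GL_carrier_mat)
    then show "pf_on n (carrier (GL n)) (\<lambda>h. (g * h) $$ (i, j) * det h)" if "i < n" "j < n" for i j
      using that by (intro pf_on_mult pf_on_pf pf_det[OF pmf_id]) (simp add: pmf_def)
  qed
  have one: "1\<^sub>m n \<in> (\<lambda>h. g * h * GL_inv n g * GL_inv n h) ` G" if g: "g \<in> G" for g
    by (rule image_eqI[of _ _ "1\<^sub>m n"])
      (use car[OF g] subgroup_GL_one[OF G(1)] inv_one in \<open>auto simp: GL_inv_right\<close>)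
  have commD: "(\<lambda>h. g * h * GL_inv n g * GL_inv n h) ` G \<subseteq> ?D" if g: "g \<in> G" for g
    using commutator_in_derived[OF g] by blast
  have "\<exists>C. connectedin ?X C \<and> 1\<^sub>m n \<in> C \<and> x \<in> C \<and> C \<subseteq> ?D"
    if "x \<in> generate (GL n) (derived_set (GL n) G)" for x
    using that
  proof (induction rule: generate.induct)
    case one
    show ?case
      by (rule exI[of _ "{1\<^sub>m n}"]) (auto simp: one_GL subgroup_GL_one[OF sub])
  next
    case (incl h)
    then obtain a b where ab: "a \<in> G" "b \<in> G" "h = a * b * GL_inv n a * GL_inv n b" by auto
    show ?case
      by (rule exI[of _ "(\<lambda>h. a * h * GL_inv n a * GL_inv n h) ` G"])
        (use comm[OF ab(1)] one[OF ab(1)] commD[OF ab(1)] ab(2,3) in auto)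
  next
    case (inv h)
    then obtain a b where ab: "a \<in> G" "b \<in> G" "h = a * b * GL_inv n a * GL_inv n b" by auto
    have "inv\<^bsub>GL n\<^esub> (a \<otimes>\<^bsub>GL n\<^esub> b \<otimes>\<^bsub>GL n\<^esub> inv\<^bsub>GL n\<^esub> a \<otimes>\<^bsub>GL n\<^esub> inv\<^bsub>GL n\<^esub> b) =
        b \<otimes>\<^bsub>GL n\<^esub> a \<otimes>\<^bsub>GL n\<^esub> inv\<^bsub>GL n\<^esub> b \<otimes>\<^bsub>GL n\<^esub> inv\<^bsub>GL n\<^esub> a"
      using car[OF ab(1)] car[OF ab(2)] by (simp add: inv_mult_group m_assoc del: GL_mult)
    then have "GL_inv n h = b * a * GL_inv n b * GL_inv n a" by (simp add: ab(3))
    then show ?case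
      by (intro exI[of _ "(\<lambda>h. b * h * GL_inv n b * GL_inv n h) ` G"])
        (use comm[OF ab(2)] one[OF ab(2)] commD[OF ab(2)] ab(1) in auto)
  next
    case (eng x y)
    then obtain C C' where C: "connectedin ?X C" "1\<^sub>m n \<in> C" "x \<in> C" "C \<subseteq> ?D"
      and C': "connectedin ?X C'" "1\<^sub>m n \<in> C'" "y \<in> C'" "C' \<subseteq> ?D" by blast
    have xD: "x \<in> ?D" and xc: "x \<in> carrier (GL n)"
      using C(3,4) subgroup_GL_carrier[OF sub] by blast+
    have "connectedin ?X (C \<union> (*) x ` C')"
    proof (rule connectedin_Un[OF C(1) left[OF xc C'(1)]])
      have "x * 1\<^sub>m n = x" using GL_carrier_mat[OF xc] by simp
      then show "C \<inter> (*) x ` C' \<noteq> {}" using C(3) C'(2) by (metis IntI empty_iff imageI)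
    qed
    moreover have "(*) x ` C' \<subseteq> ?D" using subgroup_GL_mult[OF sub xD] C'(4) by blast
    ultimately show ?case
      using C C' by (intro exI[of _ "C \<union> (*) x ` C'"]) auto
  qed
  then have "\<exists>C. connectedin ?X C \<and> 1\<^sub>m n \<in> C \<and> x \<in> C \<and> C \<subseteq> ?D" if "x \<in> ?D" for x
    using that by (simp add: derived_def)
  then have "?D = \<Union>{C. connectedin ?X C \<and> 1\<^sub>m n \<in> C \<and> C \<subseteq> ?D}" by blast
  moreover have "connectedin ?X (\<Union>{C. connectedin ?X C \<and> 1\<^sub>m n \<in> C \<and> C \<subseteq> ?D})"
    by (rule connectedin_Union) auto
  ultimately show ?thesis by simp
qed

lemma solvable_subgroup_iff:
  assumes "subgroup K (GL n)"
  shows "solvable ((GL n)\<lparr>carrier := K\<rparr>) \<longleftrightarrow> (\<exists>d. (derived (GL n) ^^ d) K = {1\<^sub>m n})"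
proof -
  interpret group "GL n" by (rule group_GL)
  have "(derived ((GL n)\<lparr>carrier := K\<rparr>) ^^ d) K = (derived (GL n) ^^ d) K \<and> (derived (GL n) ^^ d) K \<subseteq> K" for d
    by (induction d) (use derived_consistent[OF _ assms] derived_incl[OF _ assms] in auto)
  moreover have "group ((GL n)\<lparr>carrier := K\<rparr>)" by (rule subgroup_imp_group[OF assms])
  ultimately show ?thesis by (simp add: group.solvable_iff_trivial_derived_seq)
qed

subsection \<open>The Levi subgroup\<close>

text \<open>The number of the diagonal block containing the index i. Indices start at 0, so a cut d
  separates d - 1 from d, and the condition is d \<le> i.\<close>

definition block :: "nat \<Rightarrow> nat set \<Rightarrow> nat \<Rightarrow> nat" where
  "block n I i = card {d \<in> {1..<n} - I. d \<le> i}"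

lemma block_mono: "i \<le> j \<Longrightarrow> block n I i \<le> block n I j"
  unfolding block_def by (intro card_mono) auto

text \<open>The block sizes as a recursion on the list of cuts, with an arbitrary starting point
  \<open>a\<close>, which makes induction on the list possible.\<close>

fun bsizes :: "nat \<Rightarrow> nat list \<Rightarrow> nat \<Rightarrow> nat list" where
  "bsizes a [] n = [n - a]"
| "bsizes a (d # ds) n = (d - a) # bsizes d ds n"

lemma map2_bsizes: "map2 (\<lambda>d d'. d' - d) (a # ds) (ds @ [n]) = bsizes a ds n"
  by (induction ds arbitrary: a) auto

text \<open>Induction on the cuts: the first block is split off with \<open>four_block_mat\<close>,
  and the remaining corner starts at the cut d, so its indices are shifted by d - a. The filtered
  lists count the cuts up to an index, hence their lengths number the blocks.\<close>

lemma diag_block_mat_iff: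
  assumes "sorted ds" "\<forall>d\<in>set ds. a \<le> d \<and> d \<le> n" "a \<le> n"
  shows "(\<exists>As. A = diag_block_mat As \<and> map dim_row As = bsizes a ds n \<and> map dim_col As = bsizes a ds n) \<longleftrightarrow>
    A \<in> carrier_mat (n - a) (n - a) \<and>
    (\<forall>i<n - a. \<forall>j<n - a. length (filter (\<lambda>d. d \<le> a + i) ds) \<noteq> length (filter (\<lambda>d. d \<le> a + j) ds) \<longrightarrow>
       A $$ (i, j) = 0)"
  using assms
proof (induction ds arbitrary: a A)
  case Nil
  show ?case
  proof
    assume "\<exists>As. A = diag_block_mat As \<and> map dim_row As = bsizes a [] n \<and> map dim_col As = bsizes a [] n"
    then obtain As where h: "A = diag_block_mat As" "map dim_row As = [n - a]" "map dim_col As = [n - a]"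
      by (elim exE conjE) simp
    obtain B where "As = [B]" "dim_row B = n - a" "dim_col B = n - a" using h(2,3) by (cases As) auto
    then have "A \<in> carrier_mat (n - a) (n - a)"
      using h(1) by (auto simp: diag_block_mat_singleton simp del: diag_block_mat.simps)
    then show "A \<in> carrier_mat (n - a) (n - a) \<and> (\<forall>i<n - a. \<forall>j<n - a.
        length (filter (\<lambda>d. d \<le> a + i) []) \<noteq> length (filter (\<lambda>d. d \<le> a + j) []) \<longrightarrow> A $$ (i, j) = 0)"
      by simp
  next
    assume "A \<in> carrier_mat (n - a) (n - a) \<and> (\<forall>i<n - a. \<forall>j<n - a.
        length (filter (\<lambda>d. d \<le> a + i) []) \<noteq> length (filter (\<lambda>d. d \<le> a + j) []) \<longrightarrow> A $$ (i, j) = 0)"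
    then show "\<exists>As. A = diag_block_mat As \<and> map dim_row As = bsizes a [] n \<and> map dim_col As = bsizes a [] n"
      by (intro exI[of _ "[A]"]) (simp add: diag_block_mat_singleton del: diag_block_mat.simps)
  qed
next
  case (Cons d ds)
  define m where "m = d - a"
  have d: "a \<le> d" "d \<le> n" "sorted ds" "\<forall>x\<in>set ds. d \<le> x \<and> x \<le> n" using Cons.prems by auto
  have dm: "d = a + m" "n - a = m + (n - d)" using d by (auto simp: m_def)
  let ?cnt = "\<lambda>i. length (filter (\<lambda>d. d \<le> i) ds)"
  have cnt1: "length (filter (\<lambda>d. d \<le> a + i) (d # ds)) = 0" if "i < m" for i
  proof -
    have "\<not> x \<le> a + i" if "x \<in> set (d # ds)" for x
      using d(1,4) that \<open>i < m\<close> by (auto simp: m_def)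
    then show ?thesis by (simp add: filter_empty_conv)
  qed
  have cnt2: "length (filter (\<lambda>d. d \<le> a + i) (d # ds)) = Suc (?cnt (d + (i - m)))" if "\<not> i < m" for i
  proof -
    have "d + (i - m) = a + i" "d \<le> a + i" using that d(1) by (auto simp: m_def)
    then show ?thesis by simp
  qed
  note IH = Cons.IH[OF d(3,4,2)]
  show ?case
  proof
    assume "\<exists>As. A = diag_block_mat As \<and> map dim_row As = bsizes a (d # ds) n \<and> map dim_col As = bsizes a (d # ds) n"
    then obtain B As where A: "A = diag_block_mat (B # As)" "dim_row B = m" "dim_col B = m"
      "map dim_row As = bsizes d ds n" "map dim_col As = bsizes d ds n"
      by (auto simp: map_eq_Cons_conv m_def simp del: diag_block_mat.simps)
    let ?D = "diag_block_mat As"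
    have D: "?D \<in> carrier_mat (n - d) (n - d)"
      "\<And>i j. i < n - d \<Longrightarrow> j < n - d \<Longrightarrow> ?cnt (d + i) \<noteq> ?cnt (d + j) \<Longrightarrow> ?D $$ (i, j) = 0"
      using IH[of ?D, THEN iffD1, OF exI[of _ As]] A(4,5) by simp_all
    have A': "A = four_block_mat B (0\<^sub>m m (n - d)) (0\<^sub>m (n - d) m) ?D"
      using A D(1) by (simp add: Let_def)
    have "A \<in> carrier_mat (n - a) (n - a)"
      using A(2,3) D(1) unfolding A' dm(2) by (intro four_block_carrier_mat) auto
    moreover have "A $$ (i, j) = 0" if ij: "i < n - a" "j < n - a"
      "length (filter (\<lambda>d. d \<le> a + i) (d # ds)) \<noteq> length (filter (\<lambda>d. d \<le> a + j) (d # ds))" for i j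
    proof (cases "i < m \<or> j < m")
      case True
      with ij have "\<not> (i < m \<and> j < m)" using cnt1 by metis
      with True show ?thesis using ij(1,2) A(2,3) D(1) unfolding A' dm(2) by auto
    next
      case False
      then have "?cnt (d + (i - m)) \<noteq> ?cnt (d + (j - m))" using ij(3) cnt2 by simp
      then have "?D $$ (i - m, j - m) = 0" using False ij(1,2) dm(2) by (intro D(2)) auto
      then show ?thesis using False ij(1,2) A(2,3) D(1) unfolding A' dm(2) by auto
    qed
    ultimately show "A \<in> carrier_mat (n - a) (n - a) \<and>
      (\<forall>i<n - a. \<forall>j<n - a. length (filter (\<lambda>d. d \<le> a + i) (d # ds)) \<noteq>
         length (filter (\<lambda>d. d \<le> a + j) (d # ds)) \<longrightarrow> A $$ (i, j) = 0)" by blast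
  next
    assume r: "A \<in> carrier_mat (n - a) (n - a) \<and>
      (\<forall>i<n - a. \<forall>j<n - a. length (filter (\<lambda>d. d \<le> a + i) (d # ds)) \<noteq>
         length (filter (\<lambda>d. d \<le> a + j) (d # ds)) \<longrightarrow> A $$ (i, j) = 0)"
    define B where "B = mat m m (\<lambda>(i, j). A $$ (i, j))"
    define D where "D = mat (n - d) (n - d) (\<lambda>(i, j). A $$ (m + i, m + j))"
    have "D $$ (i, j) = 0" if "i < n - d" "j < n - d" "?cnt (d + i) \<noteq> ?cnt (d + j)" for i j
    proof -
      have "A $$ (m + i, m + j) = 0" using r that dm(2) cnt2[of "m + i"] cnt2[of "m + j"] by simp
      then show ?thesis using that by (simp add: D_def)
    qed
    then obtain As where As: "D = diag_block_mat As" "map dim_row As = bsizes d ds n" "map dim_col As = bsizes d ds n"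
      using IH[of D, THEN iffD2] by (auto simp: D_def)
    have "A = four_block_mat B (0\<^sub>m m (n - d)) (0\<^sub>m (n - d) m) D"
    proof (rule eq_matI)
      fix i j assume "i < dim_row (four_block_mat B (0\<^sub>m m (n - d)) (0\<^sub>m (n - d) m) D)"
        "j < dim_col (four_block_mat B (0\<^sub>m m (n - d)) (0\<^sub>m (n - d) m) D)"
      then have ij: "i < m + (n - d)" "j < m + (n - d)" by (simp_all add: B_def D_def)
      have "A $$ (i, j) = 0" if "(i < m) \<noteq> (j < m)"
        using r ij that cnt1 cnt2 unfolding dm(2) by (metis nat.distinct(1))
      then show "A $$ (i, j) = four_block_mat B (0\<^sub>m m (n - d)) (0\<^sub>m (n - d) m) D $$ (i, j)"
        using ij by (auto simp: B_def D_def)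
    qed (use r dm(2) in \<open>auto simp: B_def D_def\<close>)
    then have "A = diag_block_mat (B # As)"
      using As(1) by (simp add: Let_def B_def) (simp add: D_def flip: As(1))
    moreover have "map dim_row (B # As) = bsizes a (d # ds) n" "map dim_col (B # As) = bsizes a (d # ds) n"
      using As by (simp_all add: B_def m_def)
    ultimately show "\<exists>As. A = diag_block_mat As \<and> map dim_row As = bsizes a (d # ds) n \<and>
        map dim_col As = bsizes a (d # ds) n" by blast
  qed
qed

lemma levi_iff:
  "A \<in> levi n I \<longleftrightarrow> A \<in> carrier (GL n) \<and> (\<forall>i<n. \<forall>j<n. block n I i \<noteq> block n I j \<longrightarrow> A $$ (i, j) = 0)"
proof -
  define ds where "ds = sorted_list_of_set ({1..<n} - I)"
  have sz: "levi_block_sizes n I = bsizes 0 ds n"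
    by (simp only: levi_block_sizes_def Let_def ds_def map2_bsizes)
  have ds: "sorted ds" "\<forall>d\<in>set ds. 0 \<le> d \<and> d \<le> n" "distinct ds" by (auto simp: ds_def)
  have cnt: "length (filter (\<lambda>d. d \<le> 0 + i) ds) = block n I i" for i
    using distinct_length_filter[OF ds(3), of "\<lambda>d. d \<le> i"]
    by (simp add: block_def ds_def Int_def conj_commute)
  have "A \<in> levi n I \<longleftrightarrow> A \<in> carrier (GL n) \<and>
      (\<exists>As. A = diag_block_mat As \<and> map dim_row As = bsizes 0 ds n \<and> map dim_col As = bsizes 0 ds n)"
    unfolding levi_def sz by blast
  also have "\<dots> \<longleftrightarrow> A \<in> carrier (GL n) \<and> (\<forall>i<n. \<forall>j<n. block n I i \<noteq> block n I j \<longrightarrow> A $$ (i, j) = 0)"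
    unfolding diag_block_mat_iff[OF ds(1,2) le0] cnt using GL_carrier_mat by auto
  finally show ?thesis .
qed


section \<open>Cancellation of inverses and the group structure of the Levi subgroup\<close>

lemma GL_cancel:
  assumes "A \<in> carrier (GL n)" "X \<in> carrier_mat n n"
  shows "GL_inv n A * (A * X) = X" "A * (GL_inv n A * X) = X"
  using assms GL_carrier_mat[OF assms(1)] GL_carrier_mat[OF GL_inv_closed[OF assms(1)]]
  by (simp_all add: GL_inv_left GL_inv_right flip: assoc_mult_mat[of _ n n _ n _ n])

lemma GL_inv_carrier_mat: "A \<in> carrier (GL n) \<Longrightarrow> GL_inv n A \<in> carrier_mat n n"
  by (simp add: GL_inv_closed GL_carrier_mat)

lemma mat_assoc:
  assumes "A \<in> carrier_mat n n" "B \<in> carrier_mat n n" "C \<in> carrier_mat n n"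
  shows "A * B * C = A * (B * C)"
  using assms by (rule assoc_mult_mat)

lemmas GL_simps = mat_assoc GL_cancel GL_inv_left GL_inv_right

lemma levi_GL: "A \<in> levi n I \<Longrightarrow> A \<in> carrier (GL n)"
  by (simp add: levi_iff)

lemma levi_zero: "A \<in> levi n I \<Longrightarrow> i < n \<Longrightarrow> j < n \<Longrightarrow> block n I i \<noteq> block n I j \<Longrightarrow> A $$ (i, j) = 0"
  by (simp add: levi_iff)

text \<open>The Levi subgroup is the centralizer of a diagonal matrix whose entries are constant on
  blocks and different on different blocks; the block number is such an entry. Closure under
  products and inverses is then a calculation with one commutation relation.\<close>

lemma levi_iff_commute:
  "A \<in> levi n I \<longleftrightarrow> A \<in> carrier (GL n) \<and>
     (let D = mat n n (\<lambda>(i, j). if i = j then of_nat (block n I i) else 0) in A * D = D * A)"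
proof -
  define D :: "complex mat" where "D = mat n n (\<lambda>(i, j). if i = j then of_nat (block n I i) else 0)"
  have D: "D \<in> carrier_mat n n" by (simp add: D_def)
  have "(\<forall>i<n. \<forall>j<n. block n I i \<noteq> block n I j \<longrightarrow> A $$ (i, j) = 0) \<longleftrightarrow> A * D = D * A"
    if A: "A \<in> carrier_mat n n"
  proof -
    have e: "(A * D) $$ (i, j) = A $$ (i, j) * of_nat (block n I j)"
      "(D * A) $$ (i, j) = of_nat (block n I i) * A $$ (i, j)" if ij: "i < n" "j < n" for i j
    proof -
      have "(A * D) $$ (i, j) = (\<Sum>l<n. if l = j then A $$ (i, l) * of_nat (block n I l) else 0)"
        unfolding mat_mult_entry[OF A D ij] using ij by (intro sum.cong) (auto simp: D_def)
      then show "(A * D) $$ (i, j) = A $$ (i, j) * of_nat (block n I j)" using ij by simp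
      have "(D * A) $$ (i, j) = (\<Sum>l<n. if i = l then of_nat (block n I l) * A $$ (l, j) else 0)"
        unfolding mat_mult_entry[OF D A ij] using ij by (intro sum.cong) (auto simp: D_def)
      then show "(D * A) $$ (i, j) = of_nat (block n I i) * A $$ (i, j)" using ij by simp
    qed
    have "A * D = D * A \<longleftrightarrow> (\<forall>i<n. \<forall>j<n. (A * D) $$ (i, j) = (D * A) $$ (i, j))"
      using A D by (auto intro!: eq_matI simp del: index_mult_mat(1))
    also have "\<dots> \<longleftrightarrow> (\<forall>i<n. \<forall>j<n. block n I i \<noteq> block n I j \<longrightarrow> A $$ (i, j) = 0)"
      using e by (simp del: index_mult_mat(1)) metis
    finally show ?thesis by blast
  qed
  then show ?thesis unfolding levi_iff Let_def D_def[symmetric] using GL_carrier_mat by blast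
qed

lemma subgroup_levi: "subgroup (levi n I) (GL n)"
proof -
  define D :: "complex mat" where "D = mat n n (\<lambda>(i, j). if i = j then of_nat (block n I i) else 0)"
  have D: "D \<in> carrier_mat n n" by (simp add: D_def)
  have L: "A \<in> levi n I \<longleftrightarrow> A \<in> carrier (GL n) \<and> A * D = D * A" for A
    unfolding levi_iff_commute Let_def D_def ..
  show ?thesis
  proof (rule subgroup.intro)
    fix A B assume AB: "A \<in> levi n I" "B \<in> levi n I"
    then have c: "A \<in> carrier_mat n n" "B \<in> carrier_mat n n" by (auto simp: L carrier_GL)
    have comm: "A * D = D * A" "B * D = D * B" using AB L by blast+
    have "A * B * D = A * (B * D)" by (rule mat_assoc[OF c D])
    also have "\<dots> = A * D * B" unfolding comm(2) by (rule mat_assoc[OF c(1) D c(2), symmetric])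
    also have "\<dots> = D * (A * B)" unfolding comm(1) by (rule mat_assoc[OF D c])
    finally show "A \<otimes>\<^bsub>GL n\<^esub> B \<in> levi n I" using AB by (simp add: L GL_mult_closed)
  next
    fix A assume A: "A \<in> levi n I"
    let ?B = "GL_inv n A"
    have AG: "A \<in> carrier (GL n)" using A L by blast
    have c: "A \<in> carrier_mat n n" "?B \<in> carrier_mat n n"
      using AG GL_inv_closed GL_carrier_mat by blast+
    have comm: "A * D = D * A" using A L by blast
    have "?B * D = ?B * (D * A) * ?B" using c D AG by (simp add: GL_simps[where n = n])
    also have "\<dots> = D * ?B" unfolding comm[symmetric] using c D AG by (simp add: GL_simps[where n = n])
    finally show "inv\<^bsub>GL n\<^esub> A \<in> levi n I" using AG by (simp add: L GL_inv_closed)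
  qed (use D in \<open>auto simp: L one_GL\<close>)
qed

lemma levi_mult: "A \<in> levi n I \<Longrightarrow> B \<in> levi n I \<Longrightarrow> A * B \<in> levi n I"
  using subgroup.m_closed[OF subgroup_levi] by simp

lemma levi_inv: "A \<in> levi n I \<Longrightarrow> GL_inv n A \<in> levi n I"
  using subgroup.m_inv_closed[OF subgroup_levi] by simp

lemma levi_one: "1\<^sub>m n \<in> levi n I"
  using subgroup.one_closed[OF subgroup_levi] by simp

subsection \<open>Triangularization inside the Levi subgroup\<close>

lemma det_nonzero_if_kernel_zero:
  fixes A :: "complex mat"
  assumes A: "A \<in> carrier_mat n n"
    and ker: "\<And>v. (\<And>i. i < n \<Longrightarrow> (\<Sum>j<n. A $$ (i, j) * v j) = 0) \<Longrightarrow> (\<And>i. i < n \<Longrightarrow> v i = 0)"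
  shows "det A \<noteq> 0"
proof
  assume "det A = 0"
  then obtain v where v: "v \<in> carrier_vec n" "v \<noteq> 0\<^sub>v n" "A *\<^sub>v v = 0\<^sub>v n"
    using det_0_iff_vec_prod_zero[OF A] by blast
  have "(\<Sum>j<n. A $$ (i, j) * v $ j) = 0" if "i < n" for i
  proof -
    have "(A *\<^sub>v v) $ i = 0" using v(3) that by simp
    then show ?thesis using A v(1) that by (simp add: scalar_prod_def atLeast0LessThan)
  qed
  then have "v $ i = 0" if "i < n" for i using ker[of "\<lambda>i. v $ i"] that by blast
  then show False using v by (metis carrier_vecD eq_vecI index_zero_vec)
qed

text \<open>The columns are made triangular one at a time. After c columns, the part of the
  conjugated group in the rows and columns from c to the end of the block of c is a representation;
  a common eigenvector of it, moved to column c by an element of the Levi subgroup, clears the next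
  column.\<close>

lemma levi_triangularize:
  assumes K: "subgroup K (GL n)" "connectedin (GL_topology n) K" "K \<subseteq> levi n I"
    and sol: "(derived (GL n) ^^ d) K = {1\<^sub>m n}"
  obtains g where "g \<in> levi n I" "\<And>k. k \<in> K \<Longrightarrow> upper_triangular (GL_inv n g * k * g)"
proof -
  have "\<exists>g\<in>levi n I. \<forall>k\<in>K. \<forall>j<c. \<forall>i<n. j < i \<longrightarrow> (GL_inv n g * k * g) $$ (i, j) = 0" if "c \<le> n" for c
    using that
  proof (induction c)
    case 0
    show ?case using levi_one by blast
  next
    case (Suc c)
    then obtain g where g: "g \<in> levi n I"
      and g0: "\<And>k i j. k \<in> K \<Longrightarrow> j < c \<Longrightarrow> i < n \<Longrightarrow> j < i \<Longrightarrow> (GL_inv n g * k * g) $$ (i, j) = 0"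
      by auto
    have cn: "c < n" using Suc.prems by simp
    define N where "N k = GL_inv n g * k * g" for k
    have gG: "g \<in> carrier (GL n)" "GL_inv n g \<in> carrier (GL n)" using g levi_GL GL_inv_closed by blast+
    have gc: "g \<in> carrier_mat n n" "GL_inv n g \<in> carrier_mat n n" using gG GL_carrier_mat by blast+
    have Kc: "k \<in> carrier_mat n n" "k \<in> levi n I" if "k \<in> K" for k
      using that K(3) levi_GL GL_carrier_mat by blast+
    have NL: "N k \<in> levi n I" if "k \<in> K" for k
      unfolding N_def using Kc[OF that] g by (intro levi_mult levi_inv)
    then have Nc: "N k \<in> carrier_mat n n" if "k \<in> K" for k using that levi_GL GL_carrier_mat by blast
    have Nmult: "N (k * l) = N k * N l" if "k \<in> K" "l \<in> K" for k l
    proof -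
      show ?thesis
        using Kc[OF that(1)] Kc[OF that(2)] gc gG by (simp add: N_def GL_simps[where n = n])
    qed
    have N1: "N (1\<^sub>m n) = 1\<^sub>m n" using gc GL_inv_left[OF gG(1)] by (simp add: N_def)
    have Npf: "pf n (\<lambda>k. N k $$ (i, j))" if "i < n" "j < n" for i j
    proof -
      have "pmf n n (\<lambda>k. GL_inv n g * k * g)" by (intro pmf_mult pmf_const pmf_id gc)
      then show ?thesis using that by (simp add: pmf_def N_def)
    qed
    \<comment> \<open>The number of indices from c to the end of its block; it is positive because c
      itself counts.\<close>
    define m where "m = (LEAST m. n \<le> c + m \<or> block n I (c + m) \<noteq> block n I c)"
    have ex: "n \<le> c + (n - c) \<or> block n I (c + (n - c)) \<noteq> block n I c" using cn by simp
    have m1: "n \<le> c + m \<or> block n I (c + m) \<noteq> block n I c"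
      unfolding m_def by (rule LeastI[of _ "n - c"], rule ex)
    have m2: "c + i < n \<and> block n I (c + i) = block n I c" if "i < m" for i
      using not_less_Least[OF that[unfolded m_def]] by simp
    have m0: "0 < m" using m1 cn by (cases "m = 0") auto
    have mn: "c + m \<le> n" using m2[of "m - 1"] m0 by linarith
    have m3: "block n I i \<noteq> block n I c" if "c + m \<le> i" "i < n" for i
      using m1 that block_mono[OF that(1), of n I] block_mono[of c "c + m" n I] by auto
    define \<rho> where "\<rho> k = mat m m (\<lambda>(i, j). N k $$ (c + i, c + j))" for k
    have range: "(\<Sum>l<n. f l) = (\<Sum>l<m. f (c + l))"
      if "\<And>l. l < c \<Longrightarrow> f l = 0" "\<And>l. c + m \<le> l \<Longrightarrow> l < n \<Longrightarrow> f l = 0" for f :: "nat \<Rightarrow> complex"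
    proof -
      have "(\<Sum>l<n. f l) = (\<Sum>l\<in>{c..<c + m}. f l)"
        using that mn by (intro sum.mono_neutral_right) (auto simp: not_le)
      also have "\<dots> = (\<Sum>l\<in>{0..<m}. f (l + c))"
        using sum.shift_bounds_nat_ivl[of f 0 c m] by (simp add: add.commute)
      finally show ?thesis by (simp add: add.commute atLeast0LessThan)
    qed
    \<comment> \<open>Multiplicativity of this submatrix rests on two vanishing statements: to its
      left by triangularity of the first c columns, to its right because the blocks differ
      there.\<close>
    have rep: "poly_rep n m K \<rho>"
      unfolding poly_rep_def
    proof (intro conjI ballI allI impI)
      fix k l assume kl: "k \<in> K" "l \<in> K"
      show "\<rho> (k * l) = \<rho> k * \<rho> l"
      proof (rule eq_matI)
        fix i j assume "i < dim_row (\<rho> k * \<rho> l)" "j < dim_col (\<rho> k * \<rho> l)"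
        then have ij: "i < m" "j < m" by (auto simp: \<rho>_def)
        have "\<rho> (k * l) $$ (i, j) = (\<Sum>x<n. N k $$ (c + i, x) * N l $$ (x, c + j))"
          using ij m2 by (simp add: \<rho>_def Nmult[OF kl] mat_mult_entry[OF Nc[OF kl(1)] Nc[OF kl(2)]] del: index_mult_mat(1))
        also have "\<dots> = (\<Sum>x<m. N k $$ (c + i, c + x) * N l $$ (c + x, c + j))"
        proof (rule range)
          show "N k $$ (c + i, x) * N l $$ (x, c + j) = 0" if "x < c" for x
            using g0[OF kl(1) that, of "c + i"] that m2[OF ij(1)] by (simp add: N_def)
          show "N k $$ (c + i, x) * N l $$ (x, c + j) = 0" if "c + m \<le> x" "x < n" for x
            using levi_zero[OF NL[OF kl(1)], of "c + i" x] m3[OF that] m2[OF ij(1)] that by simp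
        qed
        also have "\<dots> = (\<rho> k * \<rho> l) $$ (i, j)"
          using ij by (subst mat_mult_entry[of _ m m _ m]) (auto simp: \<rho>_def)
        finally show "\<rho> (k * l) $$ (i, j) = (\<rho> k * \<rho> l) $$ (i, j)" .
      qed (auto simp: \<rho>_def)
    next
      show "\<rho> (1\<^sub>m n) = 1\<^sub>m m"
        by (rule eq_matI) (use m2 in \<open>auto simp: \<rho>_def N1\<close>)
    next
      fix i j assume "i < m" "j < m"
      then show "pf_on n K (\<lambda>k. \<rho> k $$ (i, j))"
        using pf_on_pf[OF Npf[of "c + i" "c + j"]] m2 by (simp add: \<rho>_def)
    qed (simp add: \<rho>_def)
    have lin: "lin_subspace m {x. \<forall>i\<ge>m. x i = 0}" by (rule lin_subspaceI) auto
    have "(\<lambda>i. if i = 0 then 1 else 0) \<in> {x :: nat \<Rightarrow> complex. \<forall>i\<ge>m. x i = 0}" using m0 by auto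
    moreover have "(\<lambda>i::nat. if i = 0 then 1 else 0 :: complex) \<noteq> (\<lambda>i. 0)" by (auto simp: fun_eq_iff)
    ultimately have nz: "{x :: nat \<Rightarrow> complex. \<forall>i\<ge>m. x i = 0} \<noteq> {\<lambda>i. 0}" by blast
    obtain u where u: "\<forall>i\<ge>m. u i = 0" "u \<noteq> (\<lambda>i. 0)" "\<And>k. k \<in> K \<Longrightarrow> \<exists>a. eigenvec m (\<rho> k) u a"
      using common_eigenvec[OF K(1,2) rep sol lin _ nz connectedin_derived] by (auto simp: mat_app_def)
    obtain i0 where i0: "u i0 \<noteq> 0" using u(2) by (auto simp: fun_eq_iff)
    then have i0m: "i0 < m" using u(1) by (metis not_less)
    define u' where "u' i = (if c \<le> i \<and> i < c + m then u (i - c) else 0)" for i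
    \<comment> \<open>Column c becomes the eigenvector, and column c + i0 becomes the unit vector of
      index c. The matrix is invertible because the entry of the eigenvector at i0 is nonzero; if i0
      = 0, only column c changes.\<close>
    define p where "p = mat n n (\<lambda>(i, j). if j = c then u' i else if j = c + i0 then (if i = c then 1 else 0)
        else if i = j then 1 else 0)"
    have pc: "p \<in> carrier_mat n n" by (simp add: p_def)
    have c0: "c + i0 < n" "block n I (c + i0) = block n I c" using m2[OF i0m] by auto
    have prow: "(\<Sum>j<n. p $$ (i, j) * v j) = u' i * v c + (if i0 = 0 then 0 else if i = c then v (c + i0) else 0)
        + (if i = c \<or> i = c + i0 then 0 else v i)" if "i < n" for i v
    proof -
      have "(\<Sum>j<n. p $$ (i, j) * v j) = (\<Sum>j<n. (if j = c then u' i * v c else 0) +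
          (if j = c + i0 then (if i0 = 0 then 0 else if i = c then v (c + i0) else 0) else 0) +
          (if j = i then (if i = c \<or> i = c + i0 then 0 else v i) else 0))"
        using that by (intro sum.cong) (auto simp: p_def)
      then show ?thesis using that cn c0 by (simp add: sum.distrib)
    qed
    have "det p \<noteq> 0"
    proof (rule det_nonzero_if_kernel_zero[OF pc])
      fix v i assume v: "\<And>i. i < n \<Longrightarrow> (\<Sum>j<n. p $$ (i, j) * v j) = 0" and i: "i < n"
      have v': "u' i * v c + (if i0 = 0 then 0 else if i = c then v (c + i0) else 0)
        + (if i = c \<or> i = c + i0 then 0 else v i) = 0" if "i < n" for i
        using v[OF that] prow[OF that, of v] by simp
      have "u' (c + i0) \<noteq> 0" using i0 i0m by (simp add: u'_def)
      then have vc: "v c = 0" using v'[OF c0(1)] by (auto split: if_splits)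
      then have "v (c + i0) = 0" using v'[OF cn] by (auto split: if_splits)
      then show "v i = 0" using v'[OF i] vc by (auto split: if_splits)
    qed
    then have pG: "p \<in> carrier (GL n)" using pc by (simp add: carrier_GL)
    have u'0: "u' i = 0" if "i < n" "block n I i \<noteq> block n I c" for i
    proof (cases "c \<le> i \<and> i < c + m")
      case True
      then have "i - c < m" by linarith
      from m2[OF this] True that show ?thesis by simp
    qed (auto simp: u'_def)
    have pL: "p \<in> levi n I"
      using pG u'0 c0 by (auto simp: levi_iff p_def)
    let ?e = "\<lambda>j i. if i = j then 1 else 0 :: complex"
    have col: "mat_app n A (?e j) i = A $$ (i, j)" if "i < n" "j < n" for A i j
    proof -
      have "mat_app n A (?e j) i = (\<Sum>l<n. A $$ (i, l) * (if l = j then 1 else 0))"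
        using that(1) by (simp add: mat_app_def)
      also have "\<dots> = (\<Sum>l<n. if l = j then A $$ (i, l) else 0)"
        by (rule sum.cong) auto
      finally have "mat_app n A (?e j) i = (\<Sum>l<n. if l = j then A $$ (i, l) else 0)" .
      then show ?thesis using that by simp
    qed
    have pz: "mat_app n p z = (\<lambda>i. u' i * z c + z i)" if "z c = 0" "z (c + i0) = 0" "\<And>i. n \<le> i \<Longrightarrow> z i = 0" for z
      using that prow[of _ z] by (auto simp: fun_eq_iff mat_app_def u'_def mn)
    have u'n: "u' i = 0" if "n \<le> i" for i using that mn by (simp add: u'_def)
    have pec: "mat_app n p (?e c) = u'"
      using col[of _ c p] cn u'n by (auto simp: fun_eq_iff p_def mat_app_def)
    have "(GL_inv n p * N k * p) $$ (i, j) = 0" if k: "k \<in> K" and j: "j < Suc c" and i: "i < n" "j < i" for k i j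
    proof -
      have jn: "j < n" using j cn by simp
      \<comment> \<open>Column j of the conjugate by p is the vector z solving N(k) p e_j = p z, so
        no entry of the inverse of p has to be computed.\<close>
      have key: "(GL_inv n p * N k * p) $$ (i, j) = z i"
        if "mat_app n (N k) (mat_app n p (?e j)) = mat_app n p z" "\<And>i. n \<le> i \<Longrightarrow> z i = 0" for z
      proof -
        have "mat_app n (GL_inv n p * N k * p) (?e j) = mat_app n (GL_inv n p) (mat_app n p z)"
          using pc Nc[OF k] GL_carrier_mat[OF GL_inv_closed[OF pG]] that(1)
          by (simp add: mat_app_mult[of _ n])
        also have "\<dots> = z"
          using pc GL_carrier_mat[OF GL_inv_closed[OF pG]] that(2)
          by (simp add: mat_app_one GL_inv_left[OF pG] flip: mat_app_mult[of _ n])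
        finally show ?thesis using col[OF i(1) jn, of "GL_inv n p * N k * p"] by simp
      qed
      show ?thesis
      proof (cases "j = c")
        case False
        then have jc: "j < c" using j by simp
        define z where "z = mat_app n (N k) (?e j)"
        have z0: "z i = 0" if "j < i" for i
          using col[OF _ jn, of i "N k"] g0[OF k jc _ that] unfolding N_def[symmetric] z_def
          by (cases "i < n") (auto simp: mat_app_def)
        have "mat_app n p (?e j) = ?e j"
          using pz[of "?e j"] jc jn by (auto simp: fun_eq_iff)
        moreover have "mat_app n p z = z"
          using pz[of z] z0 jc jn by auto
        ultimately have "mat_app n (N k) (mat_app n p (?e j)) = mat_app n p z"
          by (simp add: z_def)
        then show ?thesis using key[of z] z0 i jn by auto
      next
        case True
        obtain a where a: "eigenvec m (\<rho> k) u a" using u(3)[OF k] by blast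
        \<comment> \<open>The image of the new basis vector is a times itself plus a vector
          supported above row c. Within the block this is the eigenvector equation, and beyond the
          block everything vanishes. Column c may be arbitrary above the diagonal.\<close>
        define w where "w i = (if i < c then mat_app n (N k) u' i else 0)" for i
        have Nu: "mat_app n (N k) u' i = w i + a * u' i" for i
        proof -
          consider "i < c" | "c \<le> i" "i < c + m" | "c + m \<le> i" "i < n" | "n \<le> i" by linarith
          then show ?thesis
          proof cases
            case 1 then show ?thesis by (simp add: w_def u'_def)
          next
            case 2
            then have im: "i - c < m" "i < n" using mn by auto
            have "mat_app n (N k) u' i = (\<Sum>l<n. N k $$ (i, l) * u' l)" using im by (simp add: mat_app_def)
            also have "\<dots> = (\<Sum>l<m. N k $$ (i, c + l) * u' (c + l))"
              by (rule range) (auto simp: u'_def)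
            also have "\<dots> = mat_app m (\<rho> k) u (i - c)"
              using im 2 by (auto simp: mat_app_def \<rho>_def u'_def intro!: sum.cong)
            also have "\<dots> = a * u (i - c)" using a unfolding eigenvec_def by metis
            finally show ?thesis using 2 by (simp add: w_def u'_def)
          next
            case 3
            have "mat_app n (N k) u' i = (\<Sum>l<n. N k $$ (i, l) * u' l)" using 3 by (simp add: mat_app_def)
            also have "\<dots> = 0"
            proof (rule sum.neutral, rule ballI)
              fix l assume "l \<in> {..<n}"
              then show "N k $$ (i, l) * u' l = 0"
                using u'0[of l] levi_zero[OF NL[OF k] 3(2), of l] m3[OF 3] by (cases "block n I l = block n I c") auto
            qed
            finally show ?thesis using 3 by (simp add: w_def u'_def)
          next
            case 4 then show ?thesis using mn cn by (simp add: w_def u'_def mat_app_def)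
          qed
        qed
        have "mat_app n (N k) (mat_app n p (?e j)) = (\<lambda>i. w i + a * u' i)"
          unfolding True pec by (rule ext, rule Nu)
        also have "\<dots> = mat_app n p (\<lambda>i. w i + a * ?e c i)"
        proof -
          have "mat_app n p w = w" using pz[of w] cn by (auto simp: w_def)
          then show ?thesis by (simp only: mat_app_add mat_app_smult pec)
        qed
        finally have "(GL_inv n p * N k * p) $$ (i, j) = w i + a * ?e c i"
          by (rule key) (use cn in \<open>auto simp: w_def\<close>)
        then show ?thesis using i True by (simp add: w_def)
      qed
    qed
    moreover have "GL_inv n (g * p) * k * (g * p) = GL_inv n p * N k * p" if "k \<in> K" for k
    proof -
      have "GL_inv n (g * p) = GL_inv n p * GL_inv n g"
        using group.inv_mult_group[OF group_GL[of n] gG(1) pG] by simp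
      then show ?thesis using gc pc Kc[OF that] GL_carrier_mat[OF GL_inv_closed[OF pG]]
        by (simp add: N_def assoc_mult_mat[of _ n n _ n _ n])
    qed
    ultimately show ?case
      using levi_mult[OF g pL] by (intro bexI[of _ "g * p"]) auto
  qed
  from this[OF order_refl] obtain g where g: "g \<in> levi n I"
    "\<And>k i j. k \<in> K \<Longrightarrow> j < n \<Longrightarrow> i < n \<Longrightarrow> j < i \<Longrightarrow> (GL_inv n g * k * g) $$ (i, j) = 0" by blast
  have "upper_triangular (GL_inv n g * k * g)" if "k \<in> K" for k
  proof (rule upper_triangularI)
    fix i j assume ij: "j < i" "i < dim_row (GL_inv n g * k * g)"
    then have "i < n" using GL_carrier_mat[OF GL_inv_closed[OF levi_GL[OF g(1)]]] by simp
    then show "(GL_inv n g * k * g) $$ (i, j) = 0" using g(2)[OF that] ij(1) by simp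
  qed
  then show ?thesis using that g(1) by blast
qed


subsection \<open>The standard Borel subgroup of the Levi subgroup\<close>

definition levi_borel :: "nat \<Rightarrow> nat set \<Rightarrow> complex mat set" where
  "levi_borel n I = levi n I \<inter> upper_borel n"

section \<open>Commutators of triangular matrices and solvability\<close>

definition band :: "nat \<Rightarrow> nat \<Rightarrow> complex mat \<Rightarrow> bool" where
  "band n k X \<longleftrightarrow> X \<in> carrier_mat n n \<and> (\<forall>i<n. \<forall>j<n. j < i + k \<longrightarrow> X $$ (i, j) = 0)"

lemma band_carrier: "band n k X \<Longrightarrow> X \<in> carrier_mat n n"
  by (simp add: band_def)

lemma band_zero: "band n k X \<Longrightarrow> i < n \<Longrightarrow> j < n \<Longrightarrow> j < i + k \<Longrightarrow> X $$ (i, j) = 0"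
  by (simp add: band_def)

text \<open>A nonzero term of the entry (i, j) passes through an index r with i + k \<le> r and r +
  l \<le> j, so the distances from the diagonal add up.\<close>

lemma band_mult:
  assumes "band n k X" "band n l Y"
  shows "band n (k + l) (X * Y)"
  unfolding band_def
proof (intro conjI allI impI)
  fix i j assume ij: "i < n" "j < n" "j < i + (k + l)"
  have "X $$ (i, r) * Y $$ (r, j) = 0" if "r < n" for r
  proof (cases "r < i + k")
    case True then show ?thesis using band_zero[OF assms(1) ij(1) that] by simp
  next
    case False then show ?thesis using band_zero[OF assms(2) that ij(2)] ij(3) by simp
  qed
  then show "(X * Y) $$ (i, j) = 0"
    by (subst mat_mult_entry[OF band_carrier[OF assms(1)] band_carrier[OF assms(2)] ij(1,2)]) (simp add: sum.neutral)
qed (use mult_carrier_mat[OF band_carrier[OF assms(1)] band_carrier[OF assms(2)]] in simp)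

lemma band_minus: "band n k X \<Longrightarrow> band n k Y \<Longrightarrow> band n k (X - Y)"
  by (auto simp: band_def)

lemma mat_diff_mult:
  fixes A B C :: "complex mat"
  assumes "A \<in> carrier_mat n n" "B \<in> carrier_mat n n" "C \<in> carrier_mat n n"
  shows "(A - B) * C = A * C - B * C"
  using assms by (rule minus_mult_distrib_mat)

lemma mat_mult_diff:
  fixes A B C :: "complex mat"
  assumes "A \<in> carrier_mat n n" "B \<in> carrier_mat n n" "C \<in> carrier_mat n n"
  shows "A * (B - C) = A * B - A * C"
  using assms by (rule mult_minus_distrib_mat)

lemma band_add: "band n k X \<Longrightarrow> band n k Y \<Longrightarrow> band n k (X + Y)"
  by (auto simp: band_def)

lemma band_mono: "band n k X \<Longrightarrow> l \<le> k \<Longrightarrow> band n l X"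
  by (auto simp: band_def)

lemma upper_borel_iff_band: "A \<in> upper_borel n \<longleftrightarrow> A \<in> carrier (GL n) \<and> band n 0 A"
  by (auto simp: upper_borel_iff band_def carrier_GL intro!: upper_triangularI)

text \<open>For positive k these groups filter the unipotent triangular matrices; each commutator
  step moves at least one place along the filtration. For k = 0 the group is the full upper
  triangular group.\<close>

definition unip :: "nat \<Rightarrow> nat \<Rightarrow> complex mat set" where
  "unip n k = {A \<in> carrier (GL n). band n k (A - 1\<^sub>m n)}"

lemma unip_upper:
  assumes "A \<in> unip n k" shows "A \<in> upper_borel n"
proof -
  have A: "A \<in> carrier (GL n)" "band n k (A - 1\<^sub>m n)" using assms by (auto simp: unip_def)
  have "band n 0 (A - 1\<^sub>m n)" by (rule band_mono[OF A(2)]) simp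
  then have "A $$ (i, j) = 0" if "i < n" "j < i" for i j
    using that band_zero[of n 0 "A - 1\<^sub>m n" i j] GL_carrier_mat[OF A(1)] by auto
  then show ?thesis using A(1) GL_carrier_mat[OF A(1)] by (auto simp: upper_borel_iff intro!: upper_triangularI)
qed

lemma unip_diff_mult:
  fixes A B :: "complex mat"
  assumes "A \<in> carrier_mat n n" "B \<in> carrier_mat n n"
  shows "A * B - 1\<^sub>m n = (A - 1\<^sub>m n) * B + (B - 1\<^sub>m n)"
proof (rule eq_matI)
  fix i j assume "i < dim_row ((A - 1\<^sub>m n) * B + (B - 1\<^sub>m n))" "j < dim_col ((A - 1\<^sub>m n) * B + (B - 1\<^sub>m n))"
  then have ij: "i < n" "j < n" using assms by auto
  have "(A - 1\<^sub>m n) * B = A * B - B"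
    using assms by (simp add: mat_diff_mult[of _ n])
  then show "(A * B - 1\<^sub>m n) $$ (i, j) = ((A - 1\<^sub>m n) * B + (B - 1\<^sub>m n)) $$ (i, j)"
    using ij assms by (auto simp del: index_mult_mat(1))
qed (use assms in auto)

lemma subgroup_unip: "subgroup (unip n k) (GL n)"
proof (rule subgroup.intro)
  fix A B assume AB: "A \<in> unip n k" "B \<in> unip n k"
  then have "band n 0 B" "band n k (A - 1\<^sub>m n)" "band n k (B - 1\<^sub>m n)"
    using unip_upper upper_borel_iff_band by (auto simp: unip_def)
  then have "band n k ((A - 1\<^sub>m n) * B)" "band n k (B - 1\<^sub>m n)"
    using band_mult[of n k "A - 1\<^sub>m n" 0 B] by auto
  then have "band n k (A * B - 1\<^sub>m n)"
    using AB GL_carrier_mat by (subst unip_diff_mult) (auto simp: unip_def intro: band_add)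
  then show "A \<otimes>\<^bsub>GL n\<^esub> B \<in> unip n k" using AB by (simp add: unip_def GL_mult_closed)
next
  fix A assume A: "A \<in> unip n k"
  then have AG: "A \<in> carrier (GL n)" "band n k (A - 1\<^sub>m n)" by (auto simp: unip_def)
  have "GL_inv n A \<in> upper_borel n" using upper_borel_inv[OF unip_upper[OF A]] .
  then have "band n (0 + k) (GL_inv n A * (A - 1\<^sub>m n))"
    using AG(2) by (intro band_mult) (auto simp: upper_borel_iff_band)
  also have "GL_inv n A * (A - 1\<^sub>m n) = 1\<^sub>m n - GL_inv n A"
    using GL_carrier_mat[OF AG(1)] GL_inv_carrier_mat[OF AG(1)] GL_inv_left[OF AG(1)]
    by (simp add: mat_mult_diff[of _ n])
  finally have "band n k (GL_inv n A - 1\<^sub>m n)"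
    using GL_inv_carrier_mat[OF AG(1)] by (auto simp: band_def)
  then show "inv\<^bsub>GL n\<^esub> A \<in> unip n k" using AG by (simp add: unip_def GL_inv_closed)
next
  show "\<one>\<^bsub>GL n\<^esub> \<in> unip n k" by (auto simp: unip_def band_def one_GL)
qed (auto simp: unip_def)

text \<open>Multiplying \<open>A * B - B * A\<close> on the right by the triangular matrix
  \<open>GL_inv n A * GL_inv n B\<close> gives the group commutator minus 1, and this keeps the
  band.\<close>

lemma commutator_unip:
  assumes "A \<in> upper_borel n" "B \<in> upper_borel n" "band n k (A * B - B * A)"
  shows "A * B * GL_inv n A * GL_inv n B \<in> unip n k"
proof -
  have G: "A \<in> carrier (GL n)" "B \<in> carrier (GL n)" using assms upper_borel_GL by auto
  have c: "A \<in> carrier_mat n n" "B \<in> carrier_mat n n" "GL_inv n A \<in> carrier_mat n n" "GL_inv n B \<in> carrier_mat n n"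
    using G GL_carrier_mat GL_inv_carrier_mat by auto
  have "band n (k + 0) ((A * B - B * A) * (GL_inv n A * GL_inv n B))"
    using assms upper_borel_inv[OF assms(1)] upper_borel_inv[OF assms(2)]
    by (intro band_mult[OF assms(3)] band_mult[of n 0 _ 0, simplified]) (auto simp: upper_borel_iff_band)
  also have "(A * B - B * A) * (GL_inv n A * GL_inv n B) =
      A * B * (GL_inv n A * GL_inv n B) - B * A * (GL_inv n A * GL_inv n B)"
    using c by (intro mat_diff_mult[of _ n]) auto
  also have "\<dots> = A * B * GL_inv n A * GL_inv n B - 1\<^sub>m n"
    using c G by (simp add: GL_simps[where n = n])
  finally show ?thesis using G by (simp add: unip_def GL_mult_closed GL_inv_closed)
qed

lemma derived_subset_unip:
  assumes "K \<subseteq> upper_borel n" "\<And>A B. A \<in> K \<Longrightarrow> B \<in> K \<Longrightarrow> band n k (A * B - B * A)"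
  shows "derived (GL n) K \<subseteq> unip n k"
proof -
  interpret group "GL n" by (rule group_GL)
  have "derived_set (GL n) K \<subseteq> unip n k"
  proof
    fix x assume "x \<in> derived_set (GL n) K"
    then obtain A B where "A \<in> K" "B \<in> K" "x = A * B * GL_inv n A * GL_inv n B" by auto
    then show "x \<in> unip n k" using commutator_unip[of A n B k] assms by blast
  qed
  then show ?thesis unfolding derived_def by (rule generate_subgroup_incl[OF _ subgroup_unip])
qed

text \<open>The diagonal of a product of triangular matrices is the product of the diagonals, and
  numbers commute.\<close>

lemma band_commutator_upper:
  assumes "A \<in> upper_borel n" "B \<in> upper_borel n"
  shows "band n 1 (A * B - B * A)"
proof -
  have b: "band n 0 A" "band n 0 B" using assms by (auto simp: upper_borel_iff_band)
  have c: "A \<in> carrier_mat n n" "B \<in> carrier_mat n n" using b band_carrier by auto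
  have diag: "(X * Y) $$ (i, i) = X $$ (i, i) * Y $$ (i, i)" if "band n 0 X" "band n 0 Y" "i < n" for X Y i
  proof -
    have "(X * Y) $$ (i, i) = (\<Sum>l<n. X $$ (i, l) * Y $$ (l, i))"
      by (rule mat_mult_entry[OF band_carrier[OF that(1)] band_carrier[OF that(2)] that(3,3)])
    also have "\<dots> = (\<Sum>l\<in>{i}. X $$ (i, l) * Y $$ (l, i))"
    proof (rule sum.mono_neutral_right)
      show "\<forall>l\<in>{..<n} - {i}. X $$ (i, l) * Y $$ (l, i) = 0"
      proof
        fix l assume "l \<in> {..<n} - {i}"
        then show "X $$ (i, l) * Y $$ (l, i) = 0"
          using band_zero[OF that(1) that(3), of l] band_zero[OF that(2), of l i] that(3) by (cases "l < i") auto
      qed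
    qed (use that in auto)
    finally show ?thesis by simp
  qed
  have "band n 0 (A * B - B * A)" by (intro band_minus band_mult[of n 0 _ 0, simplified] b)
  moreover have "(A * B - B * A) $$ (i, i) = 0" if "i < n" for i
    using diag[OF b that] diag[OF b(2,1) that] that c by (simp del: index_mult_mat(1))
  ultimately show ?thesis unfolding band_def by (metis add.right_neutral less_Suc_eq add_Suc_right One_nat_def)
qed

text \<open>Subtracting the identity from both factors does not change the additive commutator,
  which therefore lies in band 2k, and 2k is at least k + 1 for positive k.\<close>

lemma band_commutator_unip:
  assumes "A \<in> unip n k" "B \<in> unip n k" "0 < k"
  shows "band n (Suc k) (A * B - B * A)"
proof -
  let ?X = "A - 1\<^sub>m n" and ?Y = "B - 1\<^sub>m n"
  have c: "A \<in> carrier_mat n n" "B \<in> carrier_mat n n" using assms GL_carrier_mat by (auto simp: unip_def)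
  have b: "band n k ?X" "band n k ?Y" using assms by (auto simp: unip_def)
  have XY: "(X - 1\<^sub>m n) * (Y - 1\<^sub>m n) = X * Y - X - (Y - 1\<^sub>m n)"
    if "X \<in> carrier_mat n n" "Y \<in> carrier_mat n n" for X Y :: "complex mat"
  proof -
    have c1: "Y - 1\<^sub>m n \<in> carrier_mat n n" by (rule minus_carrier_mat[OF one_carrier_mat])
    have "(X - 1\<^sub>m n) * (Y - 1\<^sub>m n) = X * (Y - 1\<^sub>m n) - 1\<^sub>m n * (Y - 1\<^sub>m n)"
      by (rule mat_diff_mult[OF that(1) one_carrier_mat c1])
    also have "X * (Y - 1\<^sub>m n) = X * Y - X * 1\<^sub>m n" by (rule mat_mult_diff[OF that one_carrier_mat])
    finally show ?thesis using that c1 by simp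
  qed
  have "A * B - B * A = ?X * ?Y - ?Y * ?X"
    unfolding XY[OF c] XY[OF c(2,1)] by (rule eq_matI) (use c in auto)
  moreover have "band n (k + k) (?X * ?Y - ?Y * ?X)"
    by (intro band_minus band_mult b)
  ultimately show ?thesis using assms(3) band_mono[of n "k + k" _ "Suc k"] by simp
qed

text \<open>The first derived group is unipotent, and each further one moves up a band. In band n +
  1 there is no position left for a nonzero entry.\<close>

lemma upper_subgroup_derived_trivial:
  assumes K: "subgroup K (GL n)" "K \<subseteq> upper_borel n"
  shows "(derived (GL n) ^^ Suc n) K = {1\<^sub>m n}"
proof -
  interpret group "GL n" by (rule group_GL)
  have "(derived (GL n) ^^ Suc d) K \<subseteq> unip n (Suc d)" for d
  proof (induction d)
    case 0
    show ?case
      using derived_subset_unip[OF K(2), of 1] band_commutator_upper K(2) by (simp add: subset_iff)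
  next
    case (Suc d)
    have "derived (GL n) ((derived (GL n) ^^ Suc d) K) \<subseteq> unip n (Suc (Suc d))"
    proof (rule derived_subset_unip)
      show "(derived (GL n) ^^ Suc d) K \<subseteq> upper_borel n" using Suc unip_upper by blast
      show "band n (Suc (Suc d)) (A * B - B * A)"
        if "A \<in> (derived (GL n) ^^ Suc d) K" "B \<in> (derived (GL n) ^^ Suc d) K" for A B
        using band_commutator_unip[of A n "Suc d" B] that Suc by blast
    qed
    then show ?case by simp
  qed
  then have "(derived (GL n) ^^ Suc n) K \<subseteq> unip n (Suc n)" .
  moreover have "unip n (Suc n) \<subseteq> {1\<^sub>m n}"
  proof
    fix A assume A: "A \<in> unip n (Suc n)"
    then have Ac: "A \<in> carrier_mat n n" and b: "band n (Suc n) (A - 1\<^sub>m n)" by (auto simp: unip_def carrier_GL)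
    have "A = 1\<^sub>m n"
    proof (rule eq_matI)
      fix i j assume "i < dim_row (1\<^sub>m n :: complex mat)" "j < dim_col (1\<^sub>m n :: complex mat)"
      then have ij: "i < n" "j < n" by auto
      have "(A - 1\<^sub>m n) $$ (i, j) = 0" using band_zero[OF b ij] ij by simp
      then show "A $$ (i, j) = 1\<^sub>m n $$ (i, j)" using ij Ac by simp
    qed (use Ac in auto)
    then show "A \<in> {1\<^sub>m n}" by simp
  qed
  moreover have "1\<^sub>m n \<in> (derived (GL n) ^^ Suc n) K"
    using subgroup_GL_one[OF exp_of_derived_is_subgroup[OF K(1)]] .
  ultimately show ?thesis by blast
qed

lemma subgroup_levi_borel: "subgroup (levi_borel n I) (GL n)"
  unfolding levi_borel_def by (rule group.subgroups_Inter_pair[OF group_GL subgroup_levi subgroup_upper_borel])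

lemma levi_borel_iff:
  "A \<in> levi_borel n I \<longleftrightarrow> A \<in> carrier (GL n) \<and>
     (\<forall>i<n. \<forall>j<n. block n I i \<noteq> block n I j \<or> j < i \<longrightarrow> A $$ (i, j) = 0)"
proof -
  have "upper_triangular A \<longleftrightarrow> (\<forall>i<n. \<forall>j<n. j < i \<longrightarrow> A $$ (i, j) = 0)" if "A \<in> carrier_mat n n"
    using that unfolding upper_triangular_def by (metis carrier_matD(1) order.strict_trans)
  then show ?thesis unfolding levi_borel_def Int_iff levi_iff upper_borel_iff using GL_carrier_mat by blast
qed

section \<open>The triangular part of the Levi subgroup as a Borel subgroup\<close>

lemma closedin_levi_borel: "closedin (GL_topology n) (levi_borel n I)"
proof -
  define F :: "(complex mat \<Rightarrow> complex) set" where
    "F = (\<lambda>(i, j) A. A $$ (i, j)) ` {(i, j). i < n \<and> j < n \<and> (block n I i \<noteq> block n I j \<or> j < i)}"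
  have "\<forall>f\<in>F. pf n f" by (auto simp: F_def)
  moreover have "levi_borel n I = {A \<in> carrier (GL n). \<forall>f\<in>F. f A = 0}"
    by (auto simp: levi_borel_iff F_def)
  ultimately show ?thesis unfolding closedin_GL_topology by blast
qed

text \<open>The group is the nonvanishing locus of the determinant in a linear space. If two closed
  sets split it, join a point of one to a point of the other by a line: equations \<open>f1\<close>
  and \<open>f2\<close> of the two sets, each nonzero at the point of the other, and
  \<open>det\<close> have finitely many zeros on the line. Yet at each parameter one of the three
  vanishes.\<close>

lemma connectedin_levi_borel: "connectedin (GL_topology n) (levi_borel n I)"
  unfolding connectedin_closedin
proof (intro conjI notI)
  show "levi_borel n I \<subseteq> topspace (GL_topology n)" by (auto simp: levi_borel_iff)
next
  let ?B = "levi_borel n I"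
  assume "\<exists>E1 E2. closedin (GL_topology n) E1 \<and> closedin (GL_topology n) E2 \<and>
    ?B \<subseteq> E1 \<union> E2 \<and> E1 \<inter> E2 \<inter> ?B = {} \<and> E1 \<inter> ?B \<noteq> {} \<and> E2 \<inter> ?B \<noteq> {}"
  then obtain E1 E2 where E: "closedin (GL_topology n) E1" "closedin (GL_topology n) E2"
    "?B \<subseteq> E1 \<union> E2" "E1 \<inter> E2 \<inter> ?B = {}" "E1 \<inter> ?B \<noteq> {}" "E2 \<inter> ?B \<noteq> {}" by blast
  from E(5,6) obtain A C where A: "A \<in> E1" "A \<in> ?B" and C: "C \<in> E2" "C \<in> ?B" by blast
  have AC: "A \<notin> E2" "C \<notin> E1" using A C E(4) by auto
  obtain F1 F2 where F1: "\<forall>f\<in>F1. pf n f" "E1 = {A \<in> carrier (GL n). \<forall>f\<in>F1. f A = 0}"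
    and F2: "\<forall>f\<in>F2. pf n f" "E2 = {A \<in> carrier (GL n). \<forall>f\<in>F2. f A = 0}"
    using E(1,2) unfolding closedin_GL_topology by (elim exE conjE)
  have G: "A \<in> carrier (GL n)" "C \<in> carrier (GL n)" using A C by (auto simp: levi_borel_iff)
  obtain f1 where f1: "f1 \<in> F1" "f1 C \<noteq> 0" using AC(2) G F1(2) by auto
  obtain f2 where f2: "f2 \<in> F2" "f2 A \<noteq> 0" using AC(1) G F2(2) by auto
  define M where "M t = mat n n (\<lambda>(i, j). (1 + (-1) * t) * A $$ (i, j) + t * C $$ (i, j))" for t
  have M: "poly_curve n M"
    unfolding M_def by (intro poly_curve_mat poly_fun_add poly_fun_mult poly_fun_const poly_fun_id)
  have M0: "M 0 = A" "M 1 = C"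
    using G[THEN GL_carrier_mat] by (auto simp: M_def intro!: eq_matI)
  have pf: "pf n f1" "pf n f2" using F1(1) F2(1) f1 f2 by auto
  have fin: "finite {t. det (M t) = 0}"
    using finite_det_poly_curve[OF M, of 0] G by (simp add: M0 carrier_GL)
  have "f1 (M t) * f2 (M t) = 0" if "det (M t) \<noteq> 0" for t
  proof -
    have "M t \<in> ?B"
      using that A(2) C(2) unfolding levi_borel_iff carrier_GL by (auto simp: M_def)
    then consider "M t \<in> E1" | "M t \<in> E2" using E(3) by blast
    then show ?thesis using f1(1) f2(1) F1(2) F2(2) by cases auto
  qed
  then have "f1 (M t) * f2 (M t) * det (M t) = 0" for t by (cases "det (M t) = 0") auto
  have fin1: "finite {t. f1 (M t) = 0}" by (rule poly_fun_nonzero[OF pf_poly_curve[OF pf(1) M], of 1]) (use f1 M0 in simp)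
  have fin2: "finite {t. f2 (M t) = 0}" by (rule poly_fun_nonzero[OF pf_poly_curve[OF pf(2) M], of 0]) (use f2 M0 in simp)
  have "UNIV = {t. det (M t) = 0} \<union> {t. f1 (M t) = 0} \<union> {t. f2 (M t) = 0}"
    using \<open>\<And>t. f1 (M t) * f2 (M t) * det (M t) = 0\<close> by auto
  then have "finite (UNIV :: complex set)" using fin fin1 fin2 by (metis finite_Un)
  then show False using infinite_UNIV_char_0 by blast
qed

lemma ccs_levi_borel: "closed_connected_solvable_subgroup n (levi n I) (levi_borel n I)"
proof -
  have "closedin (subtopology (GL_topology n) (levi n I)) (levi_borel n I)"
    unfolding closedin_subtopology
    using closedin_levi_borel[of n I] by (intro exI[of _ "levi_borel n I"]) (auto simp: levi_borel_def)
  moreover have "solvable ((GL n)\<lparr>carrier := levi_borel n I\<rparr>)"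
    unfolding solvable_subgroup_iff[OF subgroup_levi_borel]
    using upper_subgroup_derived_trivial[OF subgroup_levi_borel] by (metis inf_le2 levi_borel_def)
  ultimately show ?thesis
    unfolding closed_connected_solvable_subgroup_def
    using subgroup_levi_borel connectedin_levi_borel by (auto simp: levi_borel_def)
qed

lemma ccs_conj_levi_borel:
  assumes "closed_connected_solvable_subgroup n (levi n I) K"
  obtains g where "g \<in> levi n I" "\<And>k. k \<in> K \<Longrightarrow> GL_inv n g * k * g \<in> levi_borel n I"
proof -
  have K: "subgroup K (GL n)" "connectedin (GL_topology n) K" "K \<subseteq> levi n I"
    "solvable ((GL n)\<lparr>carrier := K\<rparr>)"
    using assms unfolding closed_connected_solvable_subgroup_def by auto
  then obtain d where "(derived (GL n) ^^ d) K = {1\<^sub>m n}" using solvable_subgroup_iff by blast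
  then obtain g where g: "g \<in> levi n I" "\<And>k. k \<in> K \<Longrightarrow> upper_triangular (GL_inv n g * k * g)"
    using levi_triangularize[OF K(1-3)] by blast
  have "GL_inv n g * k * g \<in> levi_borel n I" if "k \<in> K" for k
  proof -
    have "GL_inv n g * k * g \<in> levi n I" using that K(3) g(1) by (intro levi_mult levi_inv) auto
    then show ?thesis using g(2)[OF that] levi_GL by (auto simp: levi_borel_def upper_borel_iff)
  qed
  then show ?thesis using that g(1) by blast
qed

text \<open>For maximality, a larger group \<open>K\<close> of the same kind is conjugated by some g
  into the triangular group. As \<open>K\<close> contains all triangular elements, g is forced to be
  triangular itself, and undoing the conjugation leaves \<open>K\<close> triangular.\<close>

lemma borel_subgroup_levi_borel: "borel_subgroup n (levi n I) (levi_borel n I)"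
  unfolding borel_subgroup_def
proof (intro conjI allI impI ccs_levi_borel)
  fix K assume K: "closed_connected_solvable_subgroup n (levi n I) K \<and> levi_borel n I \<subseteq> K"
  obtain g where g: "g \<in> levi n I" "\<And>k. k \<in> K \<Longrightarrow> GL_inv n g * k * g \<in> levi_borel n I"
    using ccs_conj_levi_borel K by blast
  have gG: "g \<in> carrier (GL n)" using g(1) by (rule levi_GL)
  have gc: "g \<in> carrier_mat n n" "GL_inv n g \<in> carrier_mat n n"
    using GL_carrier_mat[OF gG] GL_inv_carrier_mat[OF gG] by auto
  have gup: "g $$ (i, j) = 0" if "j < i" "i < n" for i j
    using that
  proof (induction j arbitrary: i rule: less_induct)
    case (less c)
    note i = less.prems
    show ?case
    proof (rule ccontr)
      assume ne: "g $$ (i, c) \<noteq> 0"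
      then have bl: "block n I i = block n I c" using levi_zero[OF g(1), of i c] i by auto
      \<comment> \<open>The elementary matrix with an extra 1 at (c, i) tests the entry of g at (i,
        c). With h the conjugate of b by g, column c of g h = b g yields h $$ (c, c) = 1 in row i,
        and then row c forces the entry to vanish; the earlier columns of g are settled by
        induction.\<close>
      define b where "b = mat n n (\<lambda>(r, s). if r = s \<or> (r = c \<and> s = i) then 1 else 0 :: complex)"
      have bc: "b \<in> carrier_mat n n" by (simp add: b_def)
      have bup: "upper_triangular b" using i by (auto simp: b_def)
      have "det b \<noteq> 0" using upper_triangular_imp_det_eq_0_iff[OF bc bup] bc by (auto simp: b_def diag_mat_def)
      then have "b \<in> levi_borel n I" using bc i bl by (auto simp: levi_borel_iff carrier_GL b_def)
      then have h: "GL_inv n g * b * g \<in> levi_borel n I" using K g(2) by blast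
      define h where "h = GL_inv n g * b * g"
      have hc: "h \<in> carrier_mat n n" using gc bc by (simp add: h_def)
      have "g * h = b * g" using gc bc gG by (simp add: h_def GL_simps[where n = n])
      then have eq: "(\<Sum>l<n. g $$ (r, l) * h $$ (l, c)) = (\<Sum>l<n. b $$ (r, l) * g $$ (l, c))" if "r < n" for r
        using mat_mult_entry[OF gc(1) hc that, of c] mat_mult_entry[OF bc gc(1) that, of c] i by simp
      have h0: "h $$ (l, c) = 0" if "c < l" "l < n" for l
        using h that i unfolding h_def[symmetric] levi_borel_iff by simp
      have "(\<Sum>l<n. g $$ (i, l) * h $$ (l, c)) = (\<Sum>l\<in>{c}. g $$ (i, l) * h $$ (l, c))"
      proof (rule sum.mono_neutral_right)
        show "\<forall>l\<in>{..<n} - {c}. g $$ (i, l) * h $$ (l, c) = 0"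
        proof
          fix l assume l: "l \<in> {..<n} - {c}"
          show "g $$ (i, l) * h $$ (l, c) = 0"
            using l less.IH[of l i] h0[of l] i by (cases "l < c") auto
        qed
      qed (use i in auto)
      moreover have brow: "(\<Sum>l<n. b $$ (r, l) * g $$ (l, c)) = g $$ (r, c) + (if r = c then g $$ (i, c) else 0)"
        if "r < n" for r
      proof -
        have "(\<Sum>l<n. b $$ (r, l) * g $$ (l, c)) =
            (\<Sum>l<n. (if l = r then g $$ (r, c) else 0) + (if l = i then if r = c then g $$ (i, c) else 0 else 0))"
          using that i by (intro sum.cong) (auto simp: b_def)
        then show ?thesis using that i by (simp add: sum.distrib)
      qed
      ultimately have "g $$ (i, c) * h $$ (c, c) = g $$ (i, c)" using eq[of i] i by simp
      then have h1: "h $$ (c, c) = 1" using ne by simp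
      have cn: "c < n" using i by simp
      have "(\<Sum>l<n. g $$ (c, l) * h $$ (l, c)) = (\<Sum>l\<in>{c}. g $$ (c, l) * h $$ (l, c))"
      proof (rule sum.mono_neutral_right)
        show "\<forall>l\<in>{..<n} - {c}. g $$ (c, l) * h $$ (l, c) = 0"
        proof
          fix l assume l: "l \<in> {..<n} - {c}"
          show "g $$ (c, l) * h $$ (l, c) = 0"
            using l less.IH[of l c] h0[of l] cn by (cases "l < c") auto
        qed
      qed (use cn in auto)
      then have "g $$ (c, c) = g $$ (c, c) + g $$ (i, c)" using eq[OF cn] brow[OF cn] h1 by simp
      then show False using ne by simp
    qed
  qed
  then have gB: "g \<in> upper_borel n" using gG gc by (auto simp: upper_borel_iff intro!: upper_triangularI)
  have "k \<in> levi_borel n I" if k: "k \<in> K" for k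
  proof -
    have kL: "k \<in> levi n I" using K k unfolding closed_connected_solvable_subgroup_def by blast
    then have kc: "k \<in> carrier_mat n n" using levi_GL GL_carrier_mat by blast
    have "g * (GL_inv n g * k * g) * GL_inv n g \<in> upper_borel n"
      using g(2)[OF k] by (intro upper_borel_mult[OF upper_borel_mult[OF gB] upper_borel_inv[OF gB]]) (simp add: levi_borel_def)
    also have "g * (GL_inv n g * k * g) * GL_inv n g = k"
      using gc kc gG by (simp add: GL_simps[where n = n])
    finally show ?thesis using kL by (simp add: levi_borel_def)
  qed
  then show "K = levi_borel n I" using K by blast
qed


subsection \<open>Permutation matrices and Bruhat double cosets\<close>

lemma mult_carrier_sq: "A \<in> carrier_mat n n \<Longrightarrow> B \<in> carrier_mat n n \<Longrightarrow> A * B \<in> carrier_mat n n"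
  by (rule mult_carrier_mat)

definition pmat :: "nat \<Rightarrow> (nat \<Rightarrow> nat) \<Rightarrow> complex mat" where
  "pmat n u = mat n n (\<lambda>(i, j). if i = u j then 1 else 0)"

text \<open>Matrix indices start at 0: \<open>shift w\<close> is the permutation of \<open>{..<n}\<close> corresponding to \<open>w\<close>.\<close>

definition shift :: "(nat \<Rightarrow> nat) \<Rightarrow> nat \<Rightarrow> nat" where
  "shift w j = w (Suc j) - 1"

text \<open>Since w fixes 0, positive arguments have positive values. This makes the truncated
  subtraction in \<open>shift\<close> harmless.\<close>

lemma permutes_pos:
  assumes "w permutes {1..n}"
  shows "0 < w (Suc j)"
proof (rule ccontr)
  assume "\<not> 0 < w (Suc j)"
  then have "w (Suc j) = w 0" using permutes_not_in[OF assms, of 0] by simp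
  then show False using permutes_inj[OF assms] by (simp add: inj_eq)
qed

lemma Suc_shift: "w permutes {1..n} \<Longrightarrow> Suc (shift w j) = w (Suc j)"
  using permutes_pos[of w n j] by (simp add: shift_def)

lemma shift_comp: "v permutes {1..n} \<Longrightarrow> shift (w \<circ> v) = shift w \<circ> shift v"
  using permutes_pos[of v n] by (auto simp: shift_def fun_eq_iff)

lemma shift_id: "shift id = id"
  by (auto simp: shift_def fun_eq_iff)

lemma shift_inv:
  assumes "w permutes {1..n}"
  shows "shift (inv' w) = inv' (shift w)"
proof -
  have "shift w \<circ> shift (inv' w) = id" "shift (inv' w) \<circ> shift w = id"
    using shift_comp[OF permutes_inv[OF assms], of w] shift_comp[OF assms, of "inv' w"] permutes_inv_o[OF assms]
    by (simp_all add: shift_id)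
  then show ?thesis by (metis inv_unique_comp)
qed

lemma shift_permutes:
  assumes "w permutes {1..n}"
  shows "shift w permutes {..<n}"
proof -
  have "shift w \<circ> shift (inv' w) = id" "shift (inv' w) \<circ> shift w = id"
    using shift_comp[OF permutes_inv[OF assms], of w] shift_comp[OF assms, of "inv' w"] permutes_inv_o[OF assms]
    by (simp_all add: shift_id)
  then have "bij (shift w)" by (rule o_bij[rotated])
  moreover have "shift w j = j" if "j \<notin> {..<n}" for j
    using permutes_not_in[OF assms, of "Suc j"] that by (simp add: shift_def)
  ultimately show ?thesis by (simp add: permutes_def bij_iff)
qed

lemma permutation_matrix_pmat:
  assumes "w permutes {1..n}"
  shows "permutation_matrix n w = pmat n (shift w)"
  unfolding permutation_matrix_def pmat_def using Suc_shift[OF assms]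
  by (intro cong_mat) (auto simp flip: Suc_shift[OF assms])

lemma pmat_carrier: "pmat n u \<in> carrier_mat n n"
  by (simp add: pmat_def)

lemma mult_pmat_entry:
  assumes "u permutes {..<n}" "A \<in> carrier_mat n n" "i < n" "j < n"
  shows "(A * pmat n u) $$ (i, j) = A $$ (i, u j)"
proof -
  have uj: "u j < n" using permutes_in_image[OF assms(1), of j] assms(4) by simp
  have "(A * pmat n u) $$ (i, j) = (\<Sum>l<n. if l = u j then A $$ (i, l) else 0)"
    unfolding mat_mult_entry[OF assms(2) pmat_carrier assms(3,4)]
    using assms by (intro sum.cong) (auto simp: pmat_def)
  then show ?thesis using uj by simp
qed

lemma pmat_mult_entry:
  assumes "u permutes {..<n}" "A \<in> carrier_mat n n" "i < n" "j < n"
  shows "(pmat n u * A) $$ (u i, j) = A $$ (i, j)"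
proof -
  have ui: "u i < n" using permutes_in_image[OF assms(1), of i] assms(3) by simp
  have "(pmat n u * A) $$ (u i, j) = (\<Sum>l<n. if l = i then A $$ (l, j) else 0)"
    unfolding mat_mult_entry[OF pmat_carrier assms(2) ui assms(4)]
    using assms ui permutes_inj[OF assms(1)] by (intro sum.cong) (auto simp: pmat_def inj_eq)
  then show ?thesis using assms(3) by simp
qed

lemma pmat_comp:
  assumes "u permutes {..<n}" "v permutes {..<n}"
  shows "pmat n u * pmat n v = pmat n (u \<circ> v)"
proof (rule eq_matI)
  fix i j assume "i < dim_row (pmat n (u \<circ> v))" "j < dim_col (pmat n (u \<circ> v))"
  then have ij: "i < n" "j < n" by (auto simp: pmat_def)
  then have "v j < n" using permutes_in_image[OF assms(2), of j] by simp
  then show "(pmat n u * pmat n v) $$ (i, j) = pmat n (u \<circ> v) $$ (i, j)"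
    unfolding mult_pmat_entry[OF assms(2) pmat_carrier ij] using ij by (simp add: pmat_def)
qed (auto simp: pmat_def)

lemma pmat_id: "pmat n id = 1\<^sub>m n"
  by (rule eq_matI) (auto simp: pmat_def)

lemma pmat_GL: "u permutes {..<n} \<Longrightarrow> pmat n u \<in> carrier (GL n)"
  using GL_inv_unique(1)[OF pmat_carrier pmat_carrier, of n u "inv' u"]
  by (simp_all add: pmat_comp permutes_inv permutes_inv_o pmat_id)

text \<open>The conjugate P^-1 A P by the permutation matrix P of u, given entrywise;
  \<open>mult_pmat\<close> states this without an inverse.\<close>

definition perm_conj :: "nat \<Rightarrow> (nat \<Rightarrow> nat) \<Rightarrow> complex mat \<Rightarrow> complex mat" where
  "perm_conj n u A = mat n n (\<lambda>(i, j). A $$ (u i, u j))"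

lemma perm_conj_carrier: "perm_conj n u A \<in> carrier_mat n n"
  by (simp add: perm_conj_def)

lemma mult_pmat:
  assumes "u permutes {..<n}" "A \<in> carrier_mat n n"
  shows "A * pmat n u = pmat n u * perm_conj n u A"
proof (rule eq_matI)
  fix i j assume "i < dim_row (pmat n u * perm_conj n u A)" "j < dim_col (pmat n u * perm_conj n u A)"
  then have ij: "i < n" "j < n" by (auto simp: pmat_def perm_conj_def)
  obtain k where k: "i = u k" "k < n"
    using ij(1) permutes_image[OF assms(1)] by (metis imageE lessThan_iff)
  have "(A * pmat n u) $$ (i, j) = A $$ (i, u j)" by (rule mult_pmat_entry[OF assms ij])
  also have "\<dots> = perm_conj n u A $$ (k, j)" using k ij by (simp add: perm_conj_def)
  also have "\<dots> = (pmat n u * perm_conj n u A) $$ (u k, j)"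
    by (rule pmat_mult_entry[OF assms(1) perm_conj_carrier k(2) ij(2), symmetric])
  finally show "(A * pmat n u) $$ (i, j) = (pmat n u * perm_conj n u A) $$ (i, j)" using k by simp
qed (use assms in \<open>auto simp: pmat_def perm_conj_def\<close>)

lemma perm_conj_GL:
  assumes "u permutes {..<n}" "A \<in> carrier (GL n)"
  shows "perm_conj n u A \<in> carrier (GL n)"
proof -
  have "det (A * pmat n u) = det (pmat n u * perm_conj n u A)"
    using mult_pmat[OF assms(1) GL_carrier_mat[OF assms(2)]] by simp
  then have "det A * det (pmat n u) = det (pmat n u) * det (perm_conj n u A)"
    using GL_carrier_mat[OF assms(2)] pmat_carrier perm_conj_carrier by (simp add: det_mult[of _ n])
  then show ?thesis using assms pmat_GL[OF assms(1)] perm_conj_carrier by (auto simp: carrier_GL)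
qed

definition dcoset :: "nat \<Rightarrow> (nat \<Rightarrow> nat) \<Rightarrow> complex mat set" where
  "dcoset n u = {b * pmat n u * b' | b b'. b \<in> upper_borel n \<and> b' \<in> upper_borel n}"

lemma dcosetI: "b \<in> upper_borel n \<Longrightarrow> b' \<in> upper_borel n \<Longrightarrow> b * pmat n u * b' \<in> dcoset n u"
  unfolding dcoset_def by blast

lemma upper_borel_carrier: "b \<in> upper_borel n \<Longrightarrow> b \<in> carrier_mat n n"
  by (simp add: upper_borel_GL GL_carrier_mat)

lemma dcoset_GL: "u permutes {..<n} \<Longrightarrow> dcoset n u \<subseteq> carrier (GL n)"
  unfolding dcoset_def using pmat_GL upper_borel_GL GL_mult_closed by blast

lemma dcoset_mult_left:
  assumes "A \<in> dcoset n u" "c \<in> upper_borel n"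
  shows "c * A \<in> dcoset n u"
proof -
  obtain b b' where b: "b \<in> upper_borel n" "b' \<in> upper_borel n" "A = b * pmat n u * b'"
    using assms(1) unfolding dcoset_def by blast
  have "c * A = c * b * pmat n u * b'"
    using upper_borel_carrier[OF b(1)] upper_borel_carrier[OF b(2)] upper_borel_carrier[OF assms(2)]
    by (simp add: b(3) mat_assoc[of _ n] mult_carrier_sq[of _ n] pmat_carrier perm_conj_carrier)
  then show ?thesis using dcosetI[OF upper_borel_mult[OF assms(2) b(1)] b(2)] by simp
qed

lemma dcoset_mult_right:
  assumes "A \<in> dcoset n u" "c \<in> upper_borel n"
  shows "A * c \<in> dcoset n u"
proof -
  obtain b b' where b: "b \<in> upper_borel n" "b' \<in> upper_borel n" "A = b * pmat n u * b'"
    using assms(1) unfolding dcoset_def by blast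
  have "A * c = b * pmat n u * (b' * c)"
    using upper_borel_carrier[OF b(1)] upper_borel_carrier[OF b(2)] upper_borel_carrier[OF assms(2)]
    by (simp add: b(3) mat_assoc[of _ n] mult_carrier_sq[of _ n] pmat_carrier perm_conj_carrier)
  then show ?thesis using dcosetI[OF b(1) upper_borel_mult[OF b(2) assms(2)]] by simp
qed

lemma vcl_dcoset_left:
  assumes "u permutes {..<n}" "A \<in> vcl n (dcoset n u)" "c \<in> upper_borel n"
  shows "c * A \<in> vcl n (dcoset n u)"
proof -
  have "c * A \<in> vcl n ((*) c ` dcoset n u)" by (rule vcl_mult_left[OF upper_borel_GL[OF assms(3)] assms(2)])
  moreover have "(*) c ` dcoset n u \<subseteq> dcoset n u" using dcoset_mult_left assms(3) by blast
  ultimately show ?thesis using vcl_mono by blast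
qed

lemma vcl_dcoset_right:
  assumes "u permutes {..<n}" "A \<in> vcl n (dcoset n u)" "c \<in> upper_borel n"
  shows "A * c \<in> vcl n (dcoset n u)"
  using vcl_borel_right[OF dcoset_GL[OF assms(1)] dcoset_mult_right assms(2,3)] .

subsection \<open>Stability under the Levi subgroup\<close>

text \<open>The elements of the standard parabolic subgroup whose Levi factor is
  \<open>levi n I\<close>.\<close>

definition block_upper :: "nat \<Rightarrow> nat set \<Rightarrow> complex mat \<Rightarrow> bool" where
  "block_upper n I A \<longleftrightarrow> A \<in> carrier (GL n) \<and> (\<forall>i<n. \<forall>j<n. block n I j < block n I i \<longrightarrow> A $$ (i, j) = 0)"

text \<open>Applied to the inverse of w, this expresses that every element of \<open>I\<close> is a
  left descent.\<close>

definition block_decreasing :: "nat \<Rightarrow> nat set \<Rightarrow> (nat \<Rightarrow> nat) \<Rightarrow> bool" where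
  "block_decreasing n I f \<longleftrightarrow> (\<forall>i j. i < j \<longrightarrow> j < n \<longrightarrow> block n I i = block n I j \<longrightarrow> f j < f i)"

lemma block_upper_zero: "block_upper n I A \<Longrightarrow> i < n \<Longrightarrow> j < n \<Longrightarrow> block n I j < block n I i \<Longrightarrow> A $$ (i, j) = 0"
  by (simp add: block_upper_def)

text \<open>
  Eliminate the entries below the diagonal by column operations, from the last row upwards; these
  operations are absorbed on the right of \<open>pmat n u\<close>. A vanishing pivot is perturbed.
\<close>

lemma block_upper_pmat_vcl:
  assumes u: "u permutes {..<n}" "block_decreasing n I (inv' u)"
    and "block_upper n I m" "c \<in> upper_borel n"
  shows "m * pmat n u * c \<in> vcl n (dcoset n u)"
proof -
  note dG = dcoset_GL[OF u(1)]
  have "m * pmat n u * c \<in> vcl n (dcoset n u)"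
    if "r \<le> n" "block_upper n I m" "c \<in> upper_borel n" "\<And>i j. r \<le> i \<Longrightarrow> i < n \<Longrightarrow> j < i \<Longrightarrow> m $$ (i, j) = 0" for r m c
    using that
  proof (induction r arbitrary: m c)
    case 0
    then have mG: "m \<in> carrier (GL n)" by (simp add: block_upper_def)
    then have "m \<in> upper_borel n" using 0(4) GL_carrier_mat[OF mG] by (auto simp: upper_borel_iff intro!: upper_triangularI)
    then show ?case using dcosetI[of m n c u] 0(3) vcl_subset[OF dG] by blast
  next
    case (Suc r)
    have rn: "r < n" using Suc.prems by simp
    have pivot: "m * pmat n u * c \<in> vcl n (dcoset n u)"
      if m: "block_upper n I m" "\<And>i j. Suc r \<le> i \<Longrightarrow> i < n \<Longrightarrow> j < i \<Longrightarrow> m $$ (i, j) = 0" and mr: "m $$ (r, r) \<noteq> 0" for m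
    proof -
      have mG: "m \<in> carrier (GL n)" using m by (simp add: block_upper_def)
      have mc: "m \<in> carrier_mat n n" using GL_carrier_mat[OF mG] .
      define l where "l = mat n n (\<lambda>(i, j). if i = j then 1 else if i = r \<and> j < r then m $$ (r, j) / m $$ (r, r) else 0)"
      define m' where "m' = mat n n (\<lambda>(i, j). if j < r then m $$ (i, j) - m $$ (i, r) * (m $$ (r, j) / m $$ (r, r)) else m $$ (i, j))"
      have lc: "l \<in> carrier_mat n n" and m'c: "m' \<in> carrier_mat n n" by (simp_all add: l_def m'_def)
      have mm': "m = m' * l"
      proof (rule eq_matI)
        fix i j assume "i < dim_row (m' * l)" "j < dim_col (m' * l)"
        then have ij: "i < n" "j < n" by (simp_all add: l_def m'_def)
        have "(m' * l) $$ (i, j) = (\<Sum>x<n. (if x = j then m' $$ (i, j) else 0) +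
            (if x = r then if j < r then m' $$ (i, r) * (m $$ (r, j) / m $$ (r, r)) else 0 else 0))"
          unfolding mat_mult_entry[OF m'c lc ij] using ij by (intro sum.cong) (auto simp: l_def)
        also have "\<dots> = m $$ (i, j)" using ij rn by (simp add: sum.distrib m'_def)
        finally show "m $$ (i, j) = (m' * l) $$ (i, j)" by simp
      qed (use mc lc m'c in auto)
      have "det m = det m' * det l" unfolding mm' by (rule det_mult[OF m'c lc])
      then have G: "m' \<in> carrier (GL n)" "l \<in> carrier (GL n)" using mG lc m'c by (auto simp: carrier_GL)
      \<comment> \<open>The entries used for elimination stay inside the block of the pivot. This
        keeps \<open>m'\<close> block upper triangular, and since \<open>inv' u\<close> decreases on
        the block, conjugation with u turns the lower triangular \<open>l\<close> into an upper
        triangular matrix.\<close>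
      have blk: "block n I j = block n I r" if "j < r" "m $$ (r, j) \<noteq> 0" for j
        using block_upper_zero[OF m(1) rn, of j] that rn block_mono[of j r n I] by (meson le_neq_implies_less less_imp_le order.strict_trans)
      have m'up: "block_upper n I m'"
        unfolding block_upper_def
      proof (intro conjI allI impI)
        fix i j assume ij: "i < n" "j < n" "block n I j < block n I i"
        have "m $$ (i, j) = 0" using block_upper_zero[OF m(1) ij] .
        moreover have "m $$ (i, r) * (m $$ (r, j) / m $$ (r, r)) = 0" if "j < r"
          using blk[OF that] block_upper_zero[OF m(1) ij(1) rn] ij(3) by (cases "m $$ (r, j) = 0") auto
        ultimately show "m' $$ (i, j) = 0" using ij by (auto simp: m'_def)
      qed (fact G(1))
      have m'0: "m' $$ (i, j) = 0" if "r \<le> i" "i < n" "j < i" for i j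
      proof (cases "i = r")
        case True then show ?thesis using that mr by (simp add: m'_def)
      next
        case False
        then have "m $$ (i, j) = 0" "j < r \<Longrightarrow> m $$ (i, r) = 0" using that m(2)[of i j] m(2)[of i r] by auto
        then show ?thesis using that by (simp add: m'_def)
      qed
      let ?l' = "perm_conj n u l"
      have "?l' \<in> upper_borel n"
        unfolding upper_borel_iff
      proof (intro conjI perm_conj_GL[OF u(1) G(2)] upper_triangularI)
        fix i j assume ij: "j < i" "i < dim_row ?l'"
        then have ijn: "i < n" "j < n" by (simp_all add: perm_conj_def)
        have un: "u i < n" "u j < n" "u i \<noteq> u j"
          using ijn ij permutes_in_image[OF u(1)] permutes_inj[OF u(1)] by (auto simp: inj_eq)
        show "?l' $$ (i, j) = 0"
        proof (rule ccontr)
          assume "?l' $$ (i, j) \<noteq> 0"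
          then have *: "u i = r" "u j < r" "m $$ (r, u j) \<noteq> 0"
            using ijn un by (auto simp: perm_conj_def l_def split: if_splits)
          then have "inv' u (u i) < inv' u (u j)"
            using u(2) blk[OF *(2,3)] un unfolding block_decreasing_def by metis
          then show False using ij permutes_inverses(2)[OF u(1)] by simp
        qed
      qed
      then have "m' * pmat n u * (?l' * c) \<in> vcl n (dcoset n u)"
        using Suc.IH[OF _ m'up upper_borel_mult[OF _ Suc.prems(3)]] m'0 rn by simp
      also have "m' * pmat n u * (?l' * c) = m' * (pmat n u * ?l') * c"
        using m'c upper_borel_carrier[OF Suc.prems(3)]
        by (simp add: mat_assoc[of _ n] mult_carrier_sq[of _ n] pmat_carrier perm_conj_carrier)
      also have "\<dots> = m' * l * pmat n u * c"
        unfolding mult_pmat[OF u(1) lc, symmetric]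
        using m'c lc upper_borel_carrier[OF Suc.prems(3)]
        by (simp add: mat_assoc[of _ n] mult_carrier_sq[of _ n] pmat_carrier perm_conj_carrier)
      finally show ?thesis by (simp add: mm')
    qed
    show ?case
    proof (cases "m $$ (r, r) = 0")
      case False
      then show ?thesis using pivot Suc.prems by blast
    next
      case True
      have mG: "m \<in> carrier (GL n)" using Suc.prems by (simp add: block_upper_def)
      have mc: "m \<in> carrier_mat n n" using GL_carrier_mat[OF mG] .
      define M where "M t = mat n n (\<lambda>(i, j). m $$ (i, j) + t * (if i = r \<and> j = r then 1 else 0))" for t
      have M: "poly_curve n M"
        unfolding M_def by (intro poly_curve_mat poly_fun_add poly_fun_mult poly_fun_const poly_fun_id)
      have M0: "M 0 = m" using mc by (auto simp: M_def intro!: eq_matI)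
      have fin: "finite ({t. det (M t) = 0} \<union> {0})"
        using finite_det_poly_curve[OF M, of 0] mG by (simp add: M0 carrier_GL)
      have "M 0 * (pmat n u * c) \<in> vcl n (dcoset n u)"
      proof (rule vcl_poly_curve[OF poly_curve_mult[OF M poly_curve_const] fin])
        show "pmat n u * c \<in> carrier_mat n n"
          by (rule mult_carrier_mat[OF pmat_carrier upper_borel_carrier[OF Suc.prems(3)]])
        show "M 0 * (pmat n u * c) \<in> carrier (GL n)"
          unfolding M0 using mG pmat_GL[OF u(1)] upper_borel_GL[OF Suc.prems(3)] by (intro GL_mult_closed)
        fix t assume t: "t \<notin> {t. det (M t) = 0} \<union> {0}"
        have "M t * pmat n u * c \<in> vcl n (dcoset n u)"
        proof (rule pivot)
          show "block_upper n I (M t)"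
            using t Suc.prems(2) by (auto simp: block_upper_def carrier_GL M_def)
          show "M t $$ (i, j) = 0" if "Suc r \<le> i" "i < n" "j < i" for i j
            using that Suc.prems(4)[OF that] by (auto simp: M_def)
          show "M t $$ (r, r) \<noteq> 0" using t True rn by (simp add: M_def)
        qed
        then show "M t * (pmat n u * c) \<in> vcl n (dcoset n u)"
          using upper_borel_carrier[OF Suc.prems(3)] M
        by (simp add: mat_assoc[of _ n] mult_carrier_sq[of _ n] pmat_carrier perm_conj_carrier poly_curve_def)
      qed
      then show ?thesis
        using upper_borel_carrier[OF Suc.prems(3)] mc
        by (simp add: mat_assoc[of _ n] mult_carrier_sq[of _ n] pmat_carrier perm_conj_carrier M0)
    qed
  qed
  from this[OF order_refl assms(3,4)] show ?thesis by simp
qed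

lemma block_upper_levi_mult:
  assumes "g \<in> levi n I" "b \<in> upper_borel n"
  shows "block_upper n I (g * b)"
  unfolding block_upper_def
proof (intro conjI allI impI)
  show "g * b \<in> carrier (GL n)" using assms levi_GL upper_borel_GL GL_mult_closed by blast
  fix i j assume ij: "i < n" "j < n" "block n I j < block n I i"
  have c: "g \<in> carrier_mat n n" "b \<in> carrier_mat n n"
    using assms levi_GL upper_borel_GL GL_carrier_mat by blast+
  have "g $$ (i, l) * b $$ (l, j) = 0" if "l < n" for l
  proof (cases "l \<le> j")
    case True
    then have "block n I i \<noteq> block n I l" using ij(3) block_mono[OF True, of n I] by auto
    then show ?thesis using levi_zero[OF assms(1) ij(1) that] by simp
  next
    case False
    then have "b $$ (l, j) = 0"
      using assms(2) c that upper_triangularD[of b j l] by (simp add: upper_borel_iff)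
    then show ?thesis by simp
  qed
  then show "(g * b) $$ (i, j) = 0" by (subst mat_mult_entry[OF c ij(1,2)]) (simp add: sum.neutral)
qed

text \<open>The Levi subgroup acts on the Schubert variety: multiplying the double coset by g
  replaces its left triangular factor by a block upper triangular one, which
  \<open>block_upper_pmat_vcl\<close> allows.\<close>

lemma vcl_dcoset_levi:
  assumes u: "u permutes {..<n}" "block_decreasing n I (inv' u)"
    and g: "g \<in> levi n I" and A: "A \<in> vcl n (dcoset n u)"
  shows "g * A \<in> vcl n (dcoset n u)"
proof -
  have "g * A \<in> vcl n ((*) g ` dcoset n u)" by (rule vcl_mult_left[OF levi_GL[OF g] A])
  moreover have "(*) g ` dcoset n u \<subseteq> vcl n (dcoset n u)"
  proof
    fix x assume "x \<in> (*) g ` dcoset n u"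
    then obtain b b' where b: "b \<in> upper_borel n" "b' \<in> upper_borel n" "x = g * (b * pmat n u * b')"
      unfolding dcoset_def by blast
    have "x = g * b * pmat n u * b'"
      using b(3) upper_borel_carrier[OF b(1)] upper_borel_carrier[OF b(2)] levi_GL[OF g, THEN GL_carrier_mat]
        by (simp add: mat_assoc[of _ n] mult_carrier_sq[of _ n] pmat_carrier perm_conj_carrier)
    then show "x \<in> vcl n (dcoset n u)"
      using block_upper_pmat_vcl[OF u block_upper_levi_mult[OF g b(1)] b(2)] by simp
  qed
  ultimately show ?thesis using vcl_trans by blast
qed

subsection \<open>Dense orbits in the general linear group\<close>

lemma flag_action_flag:
  assumes "g \<in> carrier (GL n)" "y \<in> carrier (GL n)"
  shows "flag_action n g (flag n y) = flag n (g * y)"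
  unfolding flag_action_def
  using group.lcos_m_assoc[OF group_GL[of n], of "upper_borel n" g y] assms upper_borel_GL by auto

lemma schubert_cell_flag:
  assumes "w permutes {1..n}"
  shows "schubert_cell n w \<subseteq> flag_variety n"
    "{A \<in> carrier (GL n). flag n A \<in> schubert_cell n w} = dcoset n (shift w)"
proof -
  note P = permutation_matrix_pmat[OF assms] and u = shift_permutes[OF assms]
  have cell: "schubert_cell n w = {flag n (b * pmat n (shift w)) | b. b \<in> upper_borel n}"
    by (simp add: schubert_cell_def P)
  have G: "b * pmat n (shift w) \<in> carrier (GL n)" if "b \<in> upper_borel n" for b
    using that pmat_GL[OF u] upper_borel_GL GL_mult_closed by blast
  show "schubert_cell n w \<subseteq> flag_variety n" unfolding cell using G flag_in_flag_variety by blast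
  show "{A \<in> carrier (GL n). flag n A \<in> schubert_cell n w} = dcoset n (shift w)"
  proof (intro subset_antisym subsetI)
    fix A assume "A \<in> {A \<in> carrier (GL n). flag n A \<in> schubert_cell n w}"
    then obtain b where A: "A \<in> carrier (GL n)" "b \<in> upper_borel n" "flag n A = flag n (b * pmat n (shift w))"
      unfolding cell by auto
    then obtain b' where "b' \<in> upper_borel n" "A = b * pmat n (shift w) * b'" by (auto elim: flag_eqE)
    then show "A \<in> dcoset n (shift w)" using A(2) dcosetI by blast
  next
    fix A assume A: "A \<in> dcoset n (shift w)"
    then obtain b b' where b: "b \<in> upper_borel n" "b' \<in> upper_borel n" "A = b * pmat n (shift w) * b'"
      unfolding dcoset_def by blast
    then have "flag n A = flag n (b * pmat n (shift w))" using flag_mult_right[OF G[OF b(1)] b(2)] by simp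
    then show "A \<in> {A \<in> carrier (GL n). flag n A \<in> schubert_cell n w}"
      using A dcoset_GL[OF u] b(1) unfolding cell by blast
  qed
qed

lemma schubert_variety_flag:
  assumes "w permutes {1..n}" "A \<in> carrier (GL n)"
  shows "flag n A \<in> schubert_variety n w \<longleftrightarrow> A \<in> vcl n (dcoset n (shift w))"
  unfolding schubert_variety_def flag_closure[OF schubert_cell_flag(1)[OF assms(1)] assms(2)]
    schubert_cell_flag(2)[OF assms(1)] ..

definition orbit_coset :: "nat \<Rightarrow> complex mat set \<Rightarrow> complex mat \<Rightarrow> complex mat set" where
  "orbit_coset n K y = {k * y * b | k b. k \<in> K \<and> b \<in> upper_borel n}"

lemma orbit_flag:
  assumes K: "K \<subseteq> carrier (GL n)" and y: "y \<in> carrier (GL n)"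
  shows "orbit ((GL n)\<lparr>carrier := K\<rparr>) (flag_action n) (flag n y) \<subseteq> flag_variety n"
    "{A \<in> carrier (GL n). flag n A \<in> orbit ((GL n)\<lparr>carrier := K\<rparr>) (flag_action n) (flag n y)} = orbit_coset n K y"
proof -
  have orb: "orbit ((GL n)\<lparr>carrier := K\<rparr>) (flag_action n) (flag n y) = {flag n (k * y) | k. k \<in> K}"
    unfolding orbit_def using flag_action_flag[OF _ y] K by force
  have G: "k * y \<in> carrier (GL n)" if "k \<in> K" for k using that K y GL_mult_closed by blast
  show "orbit ((GL n)\<lparr>carrier := K\<rparr>) (flag_action n) (flag n y) \<subseteq> flag_variety n"
    unfolding orb using G flag_in_flag_variety by blast
  show "{A \<in> carrier (GL n). flag n A \<in> orbit ((GL n)\<lparr>carrier := K\<rparr>) (flag_action n) (flag n y)} = orbit_coset n K y"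
  proof (intro subset_antisym subsetI)
    fix A assume "A \<in> {A \<in> carrier (GL n). flag n A \<in> orbit ((GL n)\<lparr>carrier := K\<rparr>) (flag_action n) (flag n y)}"
    then obtain k where A: "A \<in> carrier (GL n)" "k \<in> K" "flag n A = flag n (k * y)" unfolding orb by auto
    then obtain b where "b \<in> upper_borel n" "A = k * y * b" by (auto elim: flag_eqE)
    then show "A \<in> orbit_coset n K y" using A(2) unfolding orbit_coset_def by blast
  next
    fix A assume "A \<in> orbit_coset n K y"
    then obtain k b where b: "k \<in> K" "b \<in> upper_borel n" "A = k * y * b" unfolding orbit_coset_def by blast
    then have "flag n A = flag n (k * y)" "A \<in> carrier (GL n)"
      using flag_mult_right[OF G[OF b(1)] b(2)] G[OF b(1)] upper_borel_GL GL_mult_closed by auto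
    then show "A \<in> {A \<in> carrier (GL n). flag n A \<in> orbit ((GL n)\<lparr>carrier := K\<rparr>) (flag_action n) (flag n y)}"
      using b(1) unfolding orb by blast
  qed
qed

lemma dense_orbit_imp:
  assumes w: "w permutes {1..n}" and K: "K \<subseteq> carrier (GL n)"
    and d: "has_dense_orbit n K (schubert_variety n w)"
  obtains y where "y \<in> carrier (GL n)" "dcoset n (shift w) \<subseteq> vcl n (orbit_coset n K y)"
proof -
  let ?X = "schubert_variety n w"
  obtain x where x: "x \<in> ?X"
    "subtopology (flag_topology n) ?X closure_of (orbit ((GL n)\<lparr>carrier := K\<rparr>) (flag_action n) x) = ?X"
    using d unfolding has_dense_orbit_def by blast
  have "?X \<subseteq> flag_variety n"
    unfolding schubert_variety_def using closure_of_subset_topspace[of "flag_topology n"] by simp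
  then obtain y where y: "y \<in> carrier (GL n)" "x = flag n y" using x(1) flag_varietyE by blast
  let ?O = "orbit ((GL n)\<lparr>carrier := K\<rparr>) (flag_action n) (flag n y)"
  have XO: "?X \<subseteq> flag_topology n closure_of ?O"
    using x(2) closure_of_mono[of "?X \<inter> ?O" ?O "flag_topology n"] unfolding y(2) closure_of_subtopology by blast
  have "dcoset n (shift w) \<subseteq> vcl n (orbit_coset n K y)"
  proof
    fix A assume A: "A \<in> dcoset n (shift w)"
    then have AG: "A \<in> carrier (GL n)" using dcoset_GL[OF shift_permutes[OF w]] by blast
    have "flag n A \<in> ?X"
      using schubert_variety_flag[OF w AG] vcl_subset[OF dcoset_GL[OF shift_permutes[OF w]]] A by blast
    then show "A \<in> vcl n (orbit_coset n K y)"
      using XO flag_closure[OF orbit_flag(1)[OF K y(1)] AG] unfolding orbit_flag(2)[OF K y(1)] by blast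
  qed
  then show ?thesis using that y(1) by blast
qed

lemma dense_orbit_if:
  assumes w: "w permutes {1..n}" and K: "K \<subseteq> carrier (GL n)"
    and y: "y \<in> vcl n (dcoset n (shift w))" "orbit_coset n K y \<subseteq> vcl n (dcoset n (shift w))"
    and d: "dcoset n (shift w) \<subseteq> vcl n (orbit_coset n K y)"
  shows "has_dense_orbit n K (schubert_variety n w)"
proof -
  let ?X = "schubert_variety n w"
  have yG: "y \<in> carrier (GL n)" using y(1) by (rule vcl_GL)
  let ?O = "orbit ((GL n)\<lparr>carrier := K\<rparr>) (flag_action n) (flag n y)"
  note O = orbit_flag[OF K yG]
  have "?O \<subseteq> ?X"
  proof
    fix x assume x: "x \<in> ?O"
    then obtain A where A: "A \<in> carrier (GL n)" "x = flag n A" using O(1) flag_varietyE by blast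
    then have "A \<in> orbit_coset n K y" using x O(2) by blast
    then show "x \<in> ?X" using y(2) schubert_variety_flag[OF w A(1)] A(2) by blast
  qed
  moreover have "schubert_cell n w \<subseteq> flag_topology n closure_of ?O"
  proof
    fix x assume x: "x \<in> schubert_cell n w"
    then obtain A where A: "A \<in> carrier (GL n)" "x = flag n A"
      using schubert_cell_flag(1)[OF w] flag_varietyE by blast
    then have "A \<in> dcoset n (shift w)" using x schubert_cell_flag(2)[OF w] by blast
    then show "x \<in> flag_topology n closure_of ?O"
      using d flag_closure[OF O(1) A(1)] O(2) A(2) by auto
  qed
  then have "?X \<subseteq> flag_topology n closure_of ?O"
    unfolding schubert_variety_def by (intro closure_of_minimal) auto
  ultimately have "subtopology (flag_topology n) ?X closure_of ?O = ?X"
    unfolding closure_of_subtopology by (simp add: Int_absorb1 Int_absorb2)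
  moreover have "flag n y \<in> ?X" using schubert_variety_flag[OF w yG] y(1) by blast
  ultimately show ?thesis unfolding has_dense_orbit_def by blast
qed

text \<open>An arbitrary Borel subgroup of the Levi subgroup is conjugated by some g into the
  triangular one, and the base point is moved by the inverse of g. Density is kept because the
  closure of the double coset is stable under g.\<close>

lemma levi_spherical_imp:
  assumes w: "w permutes {1..n}" and bd: "block_decreasing n I (inv' (shift w))"
    and sph: "levi_spherical n I (schubert_variety n w)"
  obtains y where "y \<in> carrier (GL n)" "dcoset n (shift w) \<subseteq> vcl n (orbit_coset n (levi_borel n I) y)"
proof -
  note u = shift_permutes[OF w]
  let ?D = "dcoset n (shift w)"
  obtain K where K: "borel_subgroup n (levi n I) K" "has_dense_orbit n K (schubert_variety n w)"
    using sph unfolding levi_spherical_def by blast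
  then have ccs: "closed_connected_solvable_subgroup n (levi n I) K" unfolding borel_subgroup_def by blast
  then have KG: "K \<subseteq> carrier (GL n)" unfolding closed_connected_solvable_subgroup_def using levi_GL by blast
  obtain y where y: "y \<in> carrier (GL n)" "?D \<subseteq> vcl n (orbit_coset n K y)"
    using dense_orbit_imp[OF w KG K(2)] by blast
  obtain g where g: "g \<in> levi n I" "\<And>k. k \<in> K \<Longrightarrow> GL_inv n g * k * g \<in> levi_borel n I"
    using ccs_conj_levi_borel[OF ccs] by blast
  have gG: "g \<in> carrier (GL n)" using g(1) by (rule levi_GL)
  have giG: "GL_inv n g \<in> carrier (GL n)" using gG by (rule GL_inv_closed)
  have gc: "g \<in> carrier_mat n n" "GL_inv n g \<in> carrier_mat n n" "y \<in> carrier_mat n n"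
    using gG giG y(1) GL_carrier_mat by blast+
  have "?D \<subseteq> vcl n (orbit_coset n (levi_borel n I) (GL_inv n g * y))"
  proof
    fix A assume A: "A \<in> ?D"
    then have Ac: "A \<in> carrier_mat n n" using dcoset_GL[OF u] GL_carrier_mat by blast
    have "g * A \<in> vcl n ?D"
      using vcl_dcoset_levi[OF u bd g(1)] A vcl_subset[OF dcoset_GL[OF u]] by blast
    then have "g * A \<in> vcl n (orbit_coset n K y)" using vcl_trans[OF y(2)] by blast
    then have in1: "GL_inv n g * (g * A) \<in> vcl n ((*) (GL_inv n g) ` orbit_coset n K y)"
      by (rule vcl_mult_left[OF giG])
    have eq: "GL_inv n g * (g * A) = A" using GL_cancel(1)[OF gG Ac] .
    have sub: "(*) (GL_inv n g) ` orbit_coset n K y \<subseteq> orbit_coset n (levi_borel n I) (GL_inv n g * y)"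
    proof
      fix x assume "x \<in> (*) (GL_inv n g) ` orbit_coset n K y"
      then obtain k b where kb: "k \<in> K" "b \<in> upper_borel n" "x = GL_inv n g * (k * y * b)"
        unfolding orbit_coset_def by blast
      have "k \<in> carrier_mat n n" using kb(1) KG GL_carrier_mat by blast
      then have "x = GL_inv n g * k * g * (GL_inv n g * y) * b"
        using kb(3) gc gG upper_borel_carrier[OF kb(2)] by (simp add: GL_simps[where n = n])
      then show "x \<in> orbit_coset n (levi_borel n I) (GL_inv n g * y)"
        unfolding orbit_coset_def using g(2)[OF kb(1)] kb(2) by blast
    qed
    show "A \<in> vcl n (orbit_coset n (levi_borel n I) (GL_inv n g * y))"
      using vcl_mono[OF sub, of n] in1 unfolding eq by blast
  qed
  moreover have "GL_inv n g * y \<in> carrier (GL n)" using giG y(1) by (rule GL_mult_closed)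
  ultimately show ?thesis using that by blast
qed

lemma levi_spherical_if:
  assumes w: "w permutes {1..n}"
    and y: "y \<in> vcl n (dcoset n (shift w))"
    and d: "dcoset n (shift w) \<subseteq> vcl n (orbit_coset n (levi_borel n I) y)"
  shows "levi_spherical n I (schubert_variety n w)"
proof -
  note u = shift_permutes[OF w]
  have "orbit_coset n (levi_borel n I) y \<subseteq> vcl n (dcoset n (shift w))"
  proof
    fix x assume "x \<in> orbit_coset n (levi_borel n I) y"
    then obtain k b where "k \<in> upper_borel n" "b \<in> upper_borel n" "x = k * y * b"
      unfolding orbit_coset_def levi_borel_def by blast
    then show "x \<in> vcl n (dcoset n (shift w))"
      using vcl_dcoset_left[OF u y] vcl_dcoset_right[OF u] by blast
  qed
  moreover have "levi_borel n I \<subseteq> carrier (GL n)" by (auto simp: levi_borel_iff)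
  ultimately have "has_dense_orbit n (levi_borel n I) (schubert_variety n w)"
    using dense_orbit_if[OF w _ y _ d] by blast
  then show ?thesis unfolding levi_spherical_def using borel_subgroup_levi_borel by blast
qed


subsection \<open>Words and inversions in the symmetric group\<close>

lemma word_product_Nil: "word_product n [] = id"
  by (simp add: word_product_def sym_group_one)

lemma word_product_Cons: "word_product n (i # is) = simple_transposition i \<circ> word_product n is"
  by (simp add: word_product_def sym_group_mult)

lemma word_product_append: "word_product n (xs @ ys) = word_product n xs \<circ> word_product n ys"
  by (induction xs) (simp_all add: word_product_Nil word_product_Cons comp_assoc)

lemma word_product_indep: "word_product n is = word_product m is"
  by (induction "is") (simp_all add: word_product_Nil word_product_Cons)

lemma simple_transposition_permutes: "i \<in> {1..<n} \<Longrightarrow> simple_transposition i permutes {1..n}"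
  unfolding simple_transposition_def by (rule permutes_swap_id) auto

lemma simple_transposition_involutory: "simple_transposition i \<circ> simple_transposition i = id"
  by (simp add: simple_transposition_def)

lemma simple_transposition_idem [simp]: "simple_transposition i (simple_transposition i a) = a"
  by (simp add: simple_transposition_def)

lemma simple_transposition_apply:
  "simple_transposition i a = (if a = i then Suc i else if a = Suc i then i else a)"
  by (simp add: simple_transposition_def transpose_def)

lemma word_product_permutes: "set is \<subseteq> {1..<n} \<Longrightarrow> word_product n is permutes {1..n}"
proof (induction "is")
  case (Cons i "is")
  have "simple_transposition i permutes {1..n}" using Cons.prems by (intro simple_transposition_permutes) auto
  moreover have "word_product n is permutes {1..n}" using Cons by simp
  ultimately show ?case unfolding word_product_Cons by (rule permutes_compose[rotated])
qed (simp add: word_product_Nil permutes_id)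

lemma inv_simple_transposition_comp:
  assumes "u permutes {1..n}"
  shows "inv' (simple_transposition i \<circ> u) = inv' u \<circ> simple_transposition i"
proof (rule inv_unique_comp)
  show "simple_transposition i \<circ> u \<circ> (inv' u \<circ> simple_transposition i) = id"
    using permutes_inverses[OF assms] by (auto simp: fun_eq_iff)
  show "inv' u \<circ> simple_transposition i \<circ> (simple_transposition i \<circ> u) = id"
    using permutes_inverses[OF assms] by (auto simp: fun_eq_iff)
qed

text \<open>Recorded as pairs of values standing in the wrong order, so that left multiplication by
  a simple transposition, which exchanges adjacent values, changes the set by a relabelling and a
  single pair.\<close>

definition inversions :: "nat \<Rightarrow> (nat \<Rightarrow> nat) \<Rightarrow> (nat \<times> nat) set" where
  "inversions n u = {(a, b). 1 \<le> a \<and> a < b \<and> b \<le> n \<and> inv' u b < inv' u a}"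

lemma finite_inversions: "finite (inversions n u)"
  and card_inversions_le: "card (inversions n u) \<le> n * n"
proof -
  have sub: "inversions n u \<subseteq> {1..n} \<times> {1..n}" unfolding inversions_def by auto
  then show "finite (inversions n u)" by (rule finite_subset) simp
  show "card (inversions n u) \<le> n * n" using card_mono[OF _ sub] by simp
qed

text \<open>The transposition preserves the order of every pair of values except (i, i + 1). It thus
  carries the old inversions to inversions, and this one pair is new.\<close>

lemma card_inversions_ascent:
  assumes u: "u permutes {1..n}" and i: "i \<in> {1..<n}" and asc: "inv' u i < inv' u (Suc i)"
  shows "card (inversions n (simple_transposition i \<circ> u)) = Suc (card (inversions n u))"
proof -
  let ?s = "simple_transposition i"
  have inv: "inv' (?s \<circ> u) a = inv' u (?s a)" for a
    using inv_simple_transposition_comp[OF u] by simp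
  have mono: "?s a < ?s b" if "a < b" "(a, b) \<noteq> (i, Suc i)" for a b
    using that by (auto simp: simple_transposition_apply)
  have range: "1 \<le> ?s a \<and> ?s a \<le> n \<longleftrightarrow> 1 \<le> a \<and> a \<le> n" for a
    using i by (auto simp: simple_transposition_apply)
  have "inversions n (?s \<circ> u) = insert (i, Suc i) (map_prod ?s ?s ` inversions n u)"
  proof (intro subset_antisym subsetI)
    fix x assume "x \<in> inversions n (?s \<circ> u)"
    then obtain a b where x: "x = (a, b)" "1 \<le> a" "a < b" "b \<le> n" "inv' u (?s b) < inv' u (?s a)"
      unfolding inversions_def inv by auto
    show "x \<in> insert (i, Suc i) (map_prod ?s ?s ` inversions n u)"
    proof (cases "(a, b) = (i, Suc i)")
      case False
      then have "(?s a, ?s b) \<in> inversions n u"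
        using x mono[OF x(3) False] range[of a] range[of b] by (simp add: inversions_def)
      then have "map_prod ?s ?s (?s a, ?s b) \<in> map_prod ?s ?s ` inversions n u" by (rule imageI)
      then show ?thesis by (simp add: x(1))
    qed (simp add: x(1))
  next
    fix x assume "x \<in> insert (i, Suc i) (map_prod ?s ?s ` inversions n u)"
    then consider "x = (i, Suc i)" | a b where "(a, b) \<in> inversions n u" "x = (?s a, ?s b)" by auto
    then show "x \<in> inversions n (?s \<circ> u)"
    proof cases
      case 1
      then show ?thesis using i asc by (simp add: inversions_def inv simple_transposition_apply)
    next
      case 2
      then have ab: "1 \<le> a" "a < b" "b \<le> n" "inv' u b < inv' u a" by (auto simp: inversions_def)
      then have "(a, b) \<noteq> (i, Suc i)" using asc by auto
      then show ?thesis using ab mono[OF ab(2)] range[of a] range[of b] by (simp add: 2(2) inversions_def inv)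
    qed
  qed
  moreover have "(i, Suc i) \<notin> map_prod ?s ?s ` inversions n u"
  proof
    assume "(i, Suc i) \<in> map_prod ?s ?s ` inversions n u"
    then obtain a b where "i = ?s a" "Suc i = ?s b" "a < b" by (auto simp: inversions_def)
    then have "a = ?s i" "b = ?s (Suc i)" by (metis simple_transposition_idem)+
    then show False using \<open>a < b\<close> by (simp add: simple_transposition_apply)
  qed
  moreover have "inj_on (map_prod ?s ?s) (inversions n u)"
    by (rule inj_onI) (auto simp: map_prod_def dest: arg_cong[of _ _ ?s])
  ultimately show ?thesis using finite_inversions by (simp add: card_image)
qed

lemma card_inversions_descent:
  assumes u: "u permutes {1..n}" and i: "i \<in> {1..<n}" and desc: "inv' u (Suc i) < inv' u i"
  shows "card (inversions n u) = Suc (card (inversions n (simple_transposition i \<circ> u)))"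
proof -
  let ?s = "simple_transposition i"
  have su: "?s \<circ> u permutes {1..n}" by (rule permutes_compose[OF u simple_transposition_permutes[OF i]])
  have "inv' (?s \<circ> u) i < inv' (?s \<circ> u) (Suc i)"
    using desc by (simp add: inv_simple_transposition_comp[OF u] simple_transposition_apply)
  then have "card (inversions n (?s \<circ> (?s \<circ> u))) = Suc (card (inversions n (?s \<circ> u)))"
    by (rule card_inversions_ascent[OF su i])
  moreover have "?s \<circ> (?s \<circ> u) = u" by (auto simp: fun_eq_iff)
  ultimately show ?thesis by simp
qed

lemma card_inversions_word: "set is \<subseteq> {1..<n} \<Longrightarrow> card (inversions n (word_product n is)) \<le> length is"
proof (induction "is")
  case Nil
  have "inversions n id = {}" by (auto simp: inversions_def)
  then have "card (inversions n id) = 0" by (simp only: card.empty)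
  then show ?case unfolding word_product_Nil by linarith
next
  case (Cons i "is")
  let ?u = "word_product n is"
  have u: "?u permutes {1..n}" using Cons.prems by (intro word_product_permutes) simp
  have i: "i \<in> {1..<n}" using Cons.prems by simp
  have "inv' ?u i \<noteq> inv' ?u (Suc i)" using permutes_inj[OF permutes_inv[OF u]] by (auto simp: inj_eq)
  then consider "inv' ?u i < inv' ?u (Suc i)" | "inv' ?u (Suc i) < inv' ?u i" by linarith
  then show ?case
  proof cases
    case 1 then show ?thesis
      using card_inversions_ascent[OF u i] Cons unfolding word_product_Cons by (simp del: o_apply)
  next
    case 2 then show ?thesis
      using card_inversions_descent[OF u i] Cons unfolding word_product_Cons by (simp del: o_apply)
  qed
qed

lemma ascending_permutation_id:
  assumes "f permutes {1..n}" "\<And>i. i \<in> {1..<n} \<Longrightarrow> f i < f (Suc i)"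
  shows "f = id"
proof (rule permutes_natset_ge[OF assms(1)], rule ballI)
  fix a assume "a \<in> {1..n}"
  then have "1 \<le> a" "a \<le> n" by auto
  then show "a \<le> f a"
  proof (induction a rule: dec_induct)
    case base then show ?case using permutes_in_image[OF assms(1), of 1] by auto
  next
    case (step k) then show ?case using assms(2)[of k] by auto
  qed
qed

text \<open>Sorting by adjacent exchanges: each left descent is removed by one letter, at the cost
  of one inversion. A permutation without left descents is the identity.\<close>

lemma word_of_length_inversions:
  assumes "u permutes {1..n}"
  shows "\<exists>is. set is \<subseteq> {1..<n} \<and> word_product n is = u \<and> length is = card (inversions n u)"
  using assms
proof (induction "card (inversions n u)" arbitrary: u rule: less_induct)
  case less
  show ?case
  proof (cases "\<exists>i\<in>{1..<n}. inv' u (Suc i) < inv' u i")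
    case False
    have "inv' u i < inv' u (Suc i)" if "i \<in> {1..<n}" for i
      using False that permutes_inj[OF permutes_inv[OF less.prems]] by (metis inj_eq linorder_neqE_nat n_not_Suc_n)
    then have "inv' u = id" by (rule ascending_permutation_id[OF permutes_inv[OF less.prems]])
    then have "u = id" using permutes_inv_o(1)[OF less.prems] by simp
    moreover have "inversions n id = {}" by (auto simp: inversions_def)
    ultimately have "word_product n [] = u" "card (inversions n u) = 0"
      by (simp_all only: word_product_Nil card.empty)
    then show ?thesis by (intro exI[of _ "[]"]) simp
  next
    case True
    then obtain i where i: "i \<in> {1..<n}" "inv' u (Suc i) < inv' u i" by blast
    let ?s = "simple_transposition i"
    have card: "card (inversions n u) = Suc (card (inversions n (?s \<circ> u)))"
      by (rule card_inversions_descent[OF less.prems i])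
    have "?s \<circ> u permutes {1..n}" by (rule permutes_compose[OF less.prems simple_transposition_permutes[OF i(1)]])
    then obtain ws where ws: "set ws \<subseteq> {1..<n}" "word_product n ws = ?s \<circ> u" "length ws = card (inversions n (?s \<circ> u))"
      using less.hyps[of "?s \<circ> u"] card by auto
    have "?s \<circ> (?s \<circ> u) = u" by (auto simp: fun_eq_iff)
    then have "word_product n (i # ws) = u" unfolding word_product_Cons ws(2) .
    then show ?thesis using ws(1,3) i(1) card by (intro exI[of _ "i # ws"]) simp
  qed
qed

lemma coxeter_length_inversions:
  assumes "u permutes {1..n}"
  shows "coxeter_length n u = card (inversions n u)"
  unfolding coxeter_length_def
proof (rule Least_equality)
  show "\<exists>is. set is \<subseteq> {1..<n} \<and> word_product n is = u \<and> length is = card (inversions n u)"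
    by (rule word_of_length_inversions[OF assms])
  fix l assume "\<exists>is. set is \<subseteq> {1..<n} \<and> word_product n is = u \<and> length is = l"
  then show "card (inversions n u) \<le> l" using card_inversions_word by blast
qed

subsection \<open>The longest element of a parabolic subgroup\<close>

lemma inv_sym_group_simple_transposition:
  assumes "i \<in> {1..<n}"
  shows "inv\<^bsub>sym_group n\<^esub> (simple_transposition i) = simple_transposition i"
proof (rule group.inv_equality[OF sym_group_is_group])
  show "simple_transposition i \<otimes>\<^bsub>sym_group n\<^esub> simple_transposition i = \<one>\<^bsub>sym_group n\<^esub>"
    by (simp add: sym_group_mult sym_group_one simple_transposition_involutory)
qed (use simple_transposition_permutes[OF assms] in \<open>auto simp: sym_group_carrier\<close>)

text \<open>The generators are involutions, so inverses of generators need no case of their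
  own.\<close>

lemma parabolic_subgroup_induct [consumes 2, case_names one simple comp]:
  assumes "x \<in> parabolic_subgroup n I" "I \<subseteq> {1..<n}"
    and "P id" "\<And>i. i \<in> I \<Longrightarrow> P (simple_transposition i)" "\<And>x y. P x \<Longrightarrow> P y \<Longrightarrow> P (x \<circ> y)"
  shows "P x"
  using assms(1) unfolding parabolic_subgroup_def
proof (induction rule: generate.induct)
  case (inv h)
  then obtain i where i: "i \<in> I" "h = simple_transposition i" by blast
  then show ?case using assms(2,4) inv_sym_group_simple_transposition[of i n] by auto
next
  case one
  show ?case unfolding sym_group_one by (rule assms(3))
next
  case (incl h)
  then show ?case using assms(4) by blast
next
  case (eng x y)
  show ?case unfolding sym_group_mult by (rule assms(5)[OF eng.IH])
qed

lemma parabolic_subgroup_permutes: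
  assumes "x \<in> parabolic_subgroup n I" "I \<subseteq> {1..<n}"
  shows "x permutes {1..n}"
  using assms
proof (induction rule: parabolic_subgroup_induct)
  case (simple i)
  then show ?case using assms(2) by (intro simple_transposition_permutes) blast
next
  case one
  show ?case by (rule permutes_id)
next
  case (comp x y)
  then show ?case by (rule permutes_compose[rotated])
qed

text \<open>A generator with index i in \<open>I\<close> exchanges the indices i - 1 and i, counted
  from 0, and no cut lies between them.\<close>

lemma parabolic_subgroup_block:
  assumes "x \<in> parabolic_subgroup n I" "I \<subseteq> {1..<n}"
  shows "block n I (x a - 1) = block n I (a - 1)"
proof -
  have "\<forall>a. block n I (x a - 1) = block n I (a - 1)"
    using assms
  proof (induction rule: parabolic_subgroup_induct)
    case (simple i)
    have "block n I (i - 1) = block n I i"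
    proof -
      have "{d \<in> {1..<n} - I. d \<le> i - 1} = {d \<in> {1..<n} - I. d \<le> i}"
        using simple by (auto simp: le_eq_less_or_eq)
      then show ?thesis by (simp add: block_def)
    qed
    then show ?case by (simp add: simple_transposition_apply)
  qed auto
  then show ?thesis by blast
qed

text \<open>Lengths are bounded by n * n, so a maximum is attained. An ascent at some i in
  \<open>I\<close> would let the i-th simple transposition make the element longer without leaving
  the subgroup.\<close>

lemma longest_element_props:
  assumes I: "I \<subseteq> {1..<n}"
  shows "longest_element n I \<in> parabolic_subgroup n I"
    "\<And>i. i \<in> I \<Longrightarrow> inv' (longest_element n I) (Suc i) < inv' (longest_element n I) i"
proof -
  let ?P = "\<lambda>x. x \<in> parabolic_subgroup n I" and ?z = "longest_element n I"
  have one: "id \<in> parabolic_subgroup n I"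
    unfolding parabolic_subgroup_def using generate.one[of "sym_group n"] by (simp add: sym_group_one)
  have bound: "coxeter_length n x < Suc (n * n)" if "x \<in> parabolic_subgroup n I" for x
    using coxeter_length_inversions[OF parabolic_subgroup_permutes[OF that I]] card_inversions_le[of n x] by simp
  have "?P ?z \<and> (\<forall>y. ?P y \<longrightarrow> coxeter_length n y \<le> coxeter_length n ?z)"
    unfolding longest_element_def arg_max_on_def
    by (rule arg_max_nat_lemma[of ?P id "coxeter_length n" "Suc (n * n)"]) (use one bound in auto)
  then have z: "?P ?z" "\<And>y. ?P y \<Longrightarrow> coxeter_length n y \<le> coxeter_length n ?z" by auto
  show "?P ?z" by (rule z(1))
  have zp: "?z permutes {1..n}" by (rule parabolic_subgroup_permutes[OF z(1) I])
  fix i assume i: "i \<in> I"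
  show "inv' ?z (Suc i) < inv' ?z i"
  proof (rule ccontr)
    assume "\<not> inv' ?z (Suc i) < inv' ?z i"
    moreover have "inv' ?z i \<noteq> inv' ?z (Suc i)" using permutes_inj[OF permutes_inv[OF zp]] by (auto simp: inj_eq)
    ultimately have "inv' ?z i < inv' ?z (Suc i)" by linarith
    then have "card (inversions n (simple_transposition i \<circ> ?z)) = Suc (card (inversions n ?z))"
      using card_inversions_ascent[OF zp] i I by blast
    moreover have "?P (simple_transposition i \<circ> ?z)"
      using generate.eng[OF generate.incl[of "simple_transposition i"] z(1)[unfolded parabolic_subgroup_def]] i
      unfolding parabolic_subgroup_def sym_group_mult by blast
    ultimately show False
      using z(2)[of "simple_transposition i \<circ> ?z"] parabolic_subgroup_permutes[OF _ I] zp
      by (simp add: coxeter_length_inversions)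
  qed
qed

subsection \<open>Pattern avoidance\<close>

definition pattern321 :: "nat \<Rightarrow> (nat \<Rightarrow> nat) \<Rightarrow> bool" where
  "pattern321 n v \<longleftrightarrow> (\<exists>i j k. 1 \<le> i \<and> i < j \<and> j < k \<and> k \<le> n \<and> v k < v j \<and> v j < v i)"

definition pattern3412 :: "nat \<Rightarrow> (nat \<Rightarrow> nat) \<Rightarrow> bool" where
  "pattern3412 n v \<longleftrightarrow> (\<exists>i j k l. 1 \<le> i \<and> i < j \<and> j < k \<and> k < l \<and> l \<le> n \<and> v k < v l \<and> v l < v i \<and> v i < v j)"

text \<open>Serves to pull pattern avoidance back along the removal of the largest value, with
  \<open>f\<close> the increasing embedding of the remaining positions.\<close>

lemma pattern_transfer:
  assumes "\<And>a b. 1 \<le> a \<Longrightarrow> a < b \<Longrightarrow> b \<le> n \<Longrightarrow> f a < f b" "\<And>a. 1 \<le> a \<Longrightarrow> a \<le> n \<Longrightarrow> 1 \<le> f a \<and> f a \<le> m"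
    and "\<And>a b. 1 \<le> a \<Longrightarrow> a \<le> n \<Longrightarrow> 1 \<le> b \<Longrightarrow> b \<le> n \<Longrightarrow> v' a < v' b \<Longrightarrow> v (f a) < v (f b)"
  shows "pattern321 n v' \<Longrightarrow> pattern321 m v" "pattern3412 n v' \<Longrightarrow> pattern3412 m v"
proof -
  assume "pattern321 n v'"
  then obtain i j k where p: "1 \<le> i" "i < j" "j < k" "k \<le> n" "v' k < v' j" "v' j < v' i"
    unfolding pattern321_def by blast
  then have "1 \<le> f i \<and> f i < f j \<and> f j < f k \<and> f k \<le> m \<and> v (f k) < v (f j) \<and> v (f j) < v (f i)"
    using assms(2)[of i] assms(2)[of k] by (simp add: assms(1,3))
  then show "pattern321 m v" unfolding pattern321_def by blast
next
  assume "pattern3412 n v'"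
  then obtain i j k l where p: "1 \<le> i" "i < j" "j < k" "k < l" "l \<le> n" "v' k < v' l" "v' l < v' i" "v' i < v' j"
    unfolding pattern3412_def by blast
  then have "1 \<le> f i \<and> f i < f j \<and> f j < f k \<and> f k < f l \<and> f l \<le> m \<and>
      v (f k) < v (f l) \<and> v (f l) < v (f i) \<and> v (f i) < v (f j)"
    using assms(2)[of i] assms(2)[of l] by (simp add: assms(1,3))
  then show "pattern3412 m v" unfolding pattern3412_def by blast
qed

text \<open>
  The position of the largest value of a permutation avoiding 321 and 3412 allows to split off the
  simple transposition with the largest index, on the right or on the left.
\<close>

lemma boolean_permutation_word:
  assumes "v permutes {1..n}" "\<not> pattern321 n v" "\<not> pattern3412 n v"
  shows "\<exists>is. distinct is \<and> set is \<subseteq> {1..<n} \<and> v = word_product n is"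
  using assms
proof (induction n arbitrary: v)
  case 0
  then have "v = id" by simp
  then have "v = word_product 0 []" by (simp only: word_product_Nil)
  then show ?case by (intro exI[of _ "[]"]) simp
next
  case (Suc n)
  note v = Suc.prems(1)
  let ?m = "Suc n"
  have restrict: "v' permutes {1..n}" if "v' permutes {1..?m}" "v' ?m = ?m" for v'
    using that by (intro permutes_superset[OF that(1)]) (auto simp: le_Suc_eq)
  have inj: "v a = v b \<longleftrightarrow> a = b" for a b using permutes_inj[OF v] by (simp add: inj_eq)
  have le: "1 \<le> v a \<and> v a \<le> ?m" if "1 \<le> a" "a \<le> ?m" for a
    using permutes_in_image[OF v, of a] that by auto
  show ?case
  proof (cases "v ?m = ?m")
    case True
    have "\<not> pattern321 n v" "\<not> pattern3412 n v"
      using pattern_transfer[of n "\<lambda>a. a" ?m v v] Suc.prems(2,3) by fastforce+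
    then obtain ws where "distinct ws" "set ws \<subseteq> {1..<n}" "v = word_product n ws"
      using Suc.IH[OF restrict[OF v True]] by blast
    then show ?thesis by (intro exI[of _ ws]) (auto intro: word_product_indep)
  next
    case False
    define p q where "p = inv' v ?m" and "q = inv' v n"
    have vp: "v p = ?m" and vq: "v q = n" unfolding p_def q_def using permutes_inverses(1)[OF v] by auto
    have p: "1 \<le> p" "p \<le> ?m"
      using permutes_in_image[OF v, of p] vp by auto
    have pn: "p \<le> n" using p vp False by (metis le_SucE)
    then have n1: "1 \<le> n" using p by simp
    have q: "1 \<le> q" "q \<le> ?m" using permutes_in_image[OF v, of q] vq n1 by auto
    have pq: "p \<noteq> q" using vp vq by auto
    let ?s = "simple_transposition n"
    have s: "?s permutes {1..?m}" using n1 by (intro simple_transposition_permutes) simp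
    show ?thesis
    proof (cases "q < p")
      case True
      \<comment> \<open>Otherwise the last two positions hold values smaller than n, standing after
        both n and n + 1. If these values descend, they form 321 together with n + 1; if they
        ascend, they form 3412 together with n and n + 1.\<close>
      have "p = n"
      proof (rule ccontr)
        assume "p \<noteq> n"
        then have pn': "p < n" using pn by simp
        have "v n \<noteq> ?m" "v n \<noteq> n" "v ?m \<noteq> ?m" "v ?m \<noteq> n"
          using vp vq pn' True inj by (metis less_irrefl less_Suc_eq less_trans)+
        then have vn: "v n < n" "v ?m < n" using le[of n] le[of ?m] n1 by auto
        have "v n \<noteq> v ?m" using inj by simp
        then consider "v ?m < v n" | "v n < v ?m" by linarith
        then show False
        proof cases
          case 1
          then have "pattern321 ?m v"
            unfolding pattern321_def using p pn' vp vn by (intro exI[of _ p] exI[of _ n] exI[of _ ?m]) simp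
          then show False using Suc.prems(2) by simp
        next
          case 2
          then have "pattern3412 ?m v"
            unfolding pattern3412_def using p q True pn' vp vq vn
            by (intro exI[of _ q] exI[of _ p] exI[of _ n] exI[of _ ?m]) simp
          then show False using Suc.prems(3) by simp
        qed
      qed
      define v' where "v' = v \<circ> ?s"
      have v': "v' permutes {1..n}"
        by (rule restrict) (use permutes_compose[OF s v] vp \<open>p = n\<close> in \<open>auto simp: v'_def simple_transposition_apply\<close>)
      let ?f = "\<lambda>a. if a = n then ?m else a"
      have f: "v' a = v (?f a)" if "a \<le> n" for a using that by (simp add: v'_def simple_transposition_apply)
      have "\<not> pattern321 n v'" "\<not> pattern3412 n v'"
      proof -
        have "pattern321 n v' \<Longrightarrow> pattern321 ?m v"
          by (rule pattern_transfer(1)[of n ?f]) (auto simp: f)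
        moreover have "pattern3412 n v' \<Longrightarrow> pattern3412 ?m v"
          by (rule pattern_transfer(2)[of n ?f]) (auto simp: f)
        ultimately show "\<not> pattern321 n v'" "\<not> pattern3412 n v'" using Suc.prems(2,3) by blast+
      qed
      then obtain ws where ws: "distinct ws" "set ws \<subseteq> {1..<n}" "v' = word_product n ws"
        using Suc.IH[OF v'] by blast
      have "v = v' \<circ> ?s" by (auto simp: v'_def fun_eq_iff)
      then have "v = word_product ?m (ws @ [n])"
        unfolding word_product_append word_product_Cons word_product_Nil
        using ws(3) word_product_indep[of n ws ?m] by simp
      then show ?thesis using ws(1,2) n1 by (intro exI[of _ "ws @ [n]"]) auto
    next
      case False
      then have pq': "p < q" using pq by simp
      \<comment> \<open>Here n + 1 stands before n, so any later value would complete the pattern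
        321.\<close>
      have "q = ?m"
      proof (rule ccontr)
        assume "q \<noteq> ?m"
        then have qm: "q < ?m" using q by simp
        have "v ?m \<noteq> ?m" "v ?m \<noteq> n" using vp vq pq' qm inj by (metis less_irrefl less_trans)+
        then have "v ?m < n" using le[of ?m] by simp
        then have "pattern321 ?m v"
          unfolding pattern321_def using p pq' qm vp vq by (intro exI[of _ p] exI[of _ q] exI[of _ ?m]) simp
        then show False using Suc.prems(2) by simp
      qed
      define v' where "v' = ?s \<circ> v"
      have v': "v' permutes {1..n}"
        by (rule restrict) (use permutes_compose[OF v s] vq \<open>q = ?m\<close> in \<open>auto simp: v'_def simple_transposition_apply\<close>)
      have "v a \<noteq> n" if "a \<le> n" for a using that vq \<open>q = ?m\<close> inj by (metis not_less_eq_eq order_refl)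
      moreover have "v a \<le> ?m" if "1 \<le> a" "a \<le> n" for a using le[of a] that by simp
      ultimately have mono: "v a < v b" if "1 \<le> a" "a \<le> n" "1 \<le> b" "b \<le> n" "v' a < v' b" for a b
        using that by (force simp: v'_def simple_transposition_apply split: if_splits)
      have "\<not> pattern321 n v'" "\<not> pattern3412 n v'"
        using pattern_transfer[of n "\<lambda>a. a" ?m v' v] mono Suc.prems(2,3) by auto
      then obtain ws where ws: "distinct ws" "set ws \<subseteq> {1..<n}" "v' = word_product n ws"
        using Suc.IH[OF v'] by blast
      have "v = ?s \<circ> v'" by (auto simp: v'_def fun_eq_iff)
      then have "v = word_product ?m (n # ws)"
        unfolding word_product_Cons using ws(3) word_product_indep[of n ws ?m] by simp
      then show ?thesis using ws(1,2) n1 by (intro exI[of _ "n # ws"]) auto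
    qed
  qed
qed

text \<open>Every simple transposition other than the i-th maps the initial segment up to i to
  itself. For a word with distinct letters this shows that the letter in front raises the
  length.\<close>

lemma word_product_le_iff:
  assumes "i \<notin> set is"
  shows "word_product n is a \<le> i \<longleftrightarrow> a \<le> i"
  using assms by (induction "is") (auto simp: word_product_Nil word_product_Cons simple_transposition_apply)


subsection \<open>Flag minors\<close>

text \<open>
  The minor of \<open>g\<close> with rows \<open>R\<close> and the first \<open>k = card R\<close> columns, up to sign: the remaining
  columns are replaced by the unit vectors with index outside \<open>R\<close>.
\<close>

definition compl_enum :: "nat \<Rightarrow> nat set \<Rightarrow> nat \<Rightarrow> nat" where
  "compl_enum n R j = sorted_list_of_set ({..<n} - R) ! (j - card R)"

definition minor_mat :: "nat \<Rightarrow> nat set \<Rightarrow> complex mat \<Rightarrow> complex mat" where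
  "minor_mat n R g = mat n n (\<lambda>(i, j). if j < card R then g $$ (i, j)
     else if i = compl_enum n R j then 1 else 0)"

definition flag_minor :: "nat \<Rightarrow> nat set \<Rightarrow> complex mat \<Rightarrow> complex" where
  "flag_minor n R g = det (minor_mat n R g)"

lemma minor_mat_carrier: "minor_mat n R g \<in> carrier_mat n n"
  by (simp add: minor_mat_def)

lemma pf_flag_minor: "pf n (flag_minor n R)"
proof -
  have "pmf n n (minor_mat n R)"
    unfolding pmf_def
  proof (intro conjI ballI allI impI minor_mat_carrier)
    fix i j assume ij: "i < n" "j < n"
    show "pf n (\<lambda>A. minor_mat n R A $$ (i, j))"
    proof (cases "j < card R")
      case True then show ?thesis using pf_entry[OF ij] ij by (simp add: minor_mat_def)
    next
      case False then show ?thesis using ij by (simp add: minor_mat_def pf_const)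
    qed
  qed
  from pf_det[OF this] show ?thesis unfolding flag_minor_def by simp
qed

lemma compl_enum:
  assumes "R \<subseteq> {..<n}"
  shows compl_enum_bij: "bij_betw (compl_enum n R) {card R..<n} ({..<n} - R)"
    and compl_enum_mono: "\<And>i j. card R \<le> i \<Longrightarrow> i < j \<Longrightarrow> j < n \<Longrightarrow> compl_enum n R i < compl_enum n R j"
proof -
  let ?xs = "sorted_list_of_set ({..<n} - R)"
  have cR: "card R \<le> n" using card_mono[OF _ assms] by simp
  have len: "length ?xs = n - card R" using assms by (simp add: card_Diff_subset finite_subset)
  have "bij_betw (\<lambda>j. ?xs ! j) {..<n - card R} ({..<n} - R)"
    using bij_betw_nth[of ?xs "{..<n - card R}" "{..<n} - R"] len by simp
  moreover have "bij_betw (\<lambda>j. j - card R) {card R..<n} {..<n - card R}"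
    by (rule bij_betw_byWitness[of _ "\<lambda>j. j + card R"]) (use cR in auto)
  ultimately show "bij_betw (compl_enum n R) {card R..<n} ({..<n} - R)"
    using bij_betw_trans unfolding compl_enum_def comp_def by blast
  fix i j assume "card R \<le> i" "i < j" "j < n"
  then show "compl_enum n R i < compl_enum n R j"
    unfolding compl_enum_def using len
    by (intro sorted_wrt_nth_less[OF strict_sorted_list_of_set]) auto
qed

lemma det_lower_triangular_prod:
  assumes "A \<in> carrier_mat n n" "\<And>i j. i < j \<Longrightarrow> j < n \<Longrightarrow> A $$ (i, j) = (0 :: complex)"
  shows "det A = (\<Prod>i<n. A $$ (i, i))"
  using det_lower_triangular[OF assms(2,1)] assms(1) by (simp add: prod_list_diag_prod atLeast0LessThan)

lemma det_upper_triangular_prod: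
  assumes "A \<in> carrier_mat n n" "\<And>i j. j < i \<Longrightarrow> i < n \<Longrightarrow> A $$ (i, j) = (0 :: complex)"
  shows "det A = (\<Prod>i<n. A $$ (i, i))"
  using det_upper_triangular[of A n] assms by (auto simp: prod_list_diag_prod atLeast0LessThan)

definition block_initial :: "nat \<Rightarrow> nat set \<Rightarrow> nat set \<Rightarrow> bool" where
  "block_initial n I R \<longleftrightarrow> R \<subseteq> {..<n} \<and> (\<forall>i\<in>R. \<forall>j<i. block n I j = block n I i \<longrightarrow> j \<in> R)"

definition levi_lower :: "nat \<Rightarrow> nat set \<Rightarrow> complex mat \<Rightarrow> bool" where
  "levi_lower n I b \<longleftrightarrow> b \<in> carrier (GL n) \<and>
     (\<forall>i<n. \<forall>j<n. block n I i \<noteq> block n I j \<or> i < j \<longrightarrow> b $$ (i, j) = 0)"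

text \<open>Left multiplication by b adds to a row only earlier rows of its block, and for rows in
  \<open>R\<close> these lie in \<open>R\<close> again. As an identity of n by n matrices it needs
  only the multiplicativity of \<open>det\<close>: the left correction factor restores the unit
  vectors in the last columns, the right one carries out the column operations of c on the first
  k.\<close>

lemma minor_mat_semi_invariant:
  assumes R: "block_initial n I R" and b: "levi_lower n I b" and c: "c \<in> upper_borel n"
    and g: "g \<in> carrier_mat n n"
  defines "k \<equiv> card R" and "e \<equiv> compl_enum n R"
  shows "minor_mat n R (b * g * c) *
      mat n n (\<lambda>(i, j). if i < k \<or> j < k then if i = j then 1 else 0 else b $$ (e i, e j)) =
    b * (minor_mat n R g * mat n n (\<lambda>(i, j). if i < k \<and> j < k then c $$ (i, j) else if i = j then 1 else 0))"
    (is "?M * ?D1 = b * (?N * ?D2)")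
proof -
  have Rn: "R \<subseteq> {..<n}" using R by (simp add: block_initial_def)
  have kn: "k \<le> n" using card_mono[OF _ Rn] by (simp add: k_def)
  have bc: "b \<in> carrier_mat n n" using b GL_carrier_mat by (auto simp: levi_lower_def)
  have cc: "c \<in> carrier_mat n n" using upper_borel_carrier[OF c] .
  have eb: "bij_betw e {k..<n} ({..<n} - R)" unfolding e_def k_def by (rule compl_enum_bij[OF Rn])
  have M: "?M \<in> carrier_mat n n" and N: "?N \<in> carrier_mat n n" by (rule minor_mat_carrier)+
  have D1: "?D1 \<in> carrier_mat n n" and D2: "?D2 \<in> carrier_mat n n" by auto
  have bgc: "b * g * c = b * (g * c)" using bc g cc by (rule mat_assoc)
  show ?thesis
  proof (rule eq_matI)
    fix i j assume "i < dim_row (b * (?N * ?D2))" "j < dim_col (b * (?N * ?D2))"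
    then have ij: "i < n" "j < n" using bc by auto
    have ND2: "?N * ?D2 \<in> carrier_mat n n" using N D2 by (rule mult_carrier_mat)
    show "(?M * ?D1) $$ (i, j) = (b * (?N * ?D2)) $$ (i, j)"
    proof (cases "j < k")
      case True
      have "(?M * ?D1) $$ (i, j) = (\<Sum>l<n. if l = j then (b * g * c) $$ (i, l) else 0)"
        unfolding mat_mult_entry[OF M D1 ij]
        using ij True by (intro sum.cong) (auto simp: minor_mat_def simp flip: k_def simp del: index_mult_mat(1))
      then have lhs: "(?M * ?D1) $$ (i, j) = (b * (g * c)) $$ (i, j)" using ij bgc by simp
      have "(?N * ?D2) $$ (l, j) = (g * c) $$ (l, j)" if l: "l < n" for l
        unfolding mat_mult_entry[OF N D2 l ij(2)] mat_mult_entry[OF g cc l ij(2)]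
      proof (rule sum.cong[OF refl])
        fix x assume "x \<in> {..<n}"
        then show "?N $$ (l, x) * ?D2 $$ (x, j) = g $$ (l, x) * c $$ (x, j)"
          using l ij(2) True c cc upper_triangularD[of c j x]
          by (cases "x < k") (auto simp: minor_mat_def upper_borel_iff simp flip: k_def)
      qed
      then have "(b * (?N * ?D2)) $$ (i, j) = (b * (g * c)) $$ (i, j)"
        unfolding mat_mult_entry[OF bc ND2 ij] mat_mult_entry[OF bc mult_carrier_mat[OF g cc] ij]
        by (intro sum.cong) auto
      then show ?thesis using lhs by simp
    next
      case False
      have ej: "e j \<in> {..<n} - R" using eb ij(2) False by (auto dest: bij_betwE)
      have "(?N * ?D2) $$ (l, j) = (if l = e j then 1 else 0)" if l: "l < n" for l
      proof -
        have "(?N * ?D2) $$ (l, j) = (\<Sum>x<n. if x = j then ?N $$ (l, x) else 0)"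
          unfolding mat_mult_entry[OF N D2 l ij(2)] using False ij(2) by (intro sum.cong) auto
        then show ?thesis using ij(2) l False by (simp add: minor_mat_def e_def flip: k_def)
      qed
      then have "(b * (?N * ?D2)) $$ (i, j) = (\<Sum>l<n. if l = e j then b $$ (i, l) else 0)"
        unfolding mat_mult_entry[OF bc ND2 ij] by (intro sum.cong) auto
      then have rhs: "(b * (?N * ?D2)) $$ (i, j) = b $$ (i, e j)" using ej by simp
      have "?M $$ (i, l) * ?D1 $$ (l, j) = (if k \<le> l \<and> i = e l then b $$ (i, e j) else 0)" if "l < n" for l
        using that ij False by (auto simp: minor_mat_def e_def simp flip: k_def)
      then have lhs: "(?M * ?D1) $$ (i, j) = (\<Sum>l<n. if k \<le> l \<and> i = e l then b $$ (i, e j) else 0)"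
        unfolding mat_mult_entry[OF M D1 ij] by (intro sum.cong) auto
      show ?thesis
      proof (cases "i \<in> R")
        case True
        have "i \<noteq> e l" if "k \<le> l" "l < n" for l
          using eb True that by (auto dest: bij_betwE)
        then have "(?M * ?D1) $$ (i, j) = 0" unfolding lhs by (intro sum.neutral) auto
        \<comment> \<open>The shape of \<open>R\<close> enters here: a nonzero entry would place
          \<open>e j\<close> before i in the same block, hence in \<open>R\<close>, while
          \<open>e\<close> enumerates the complement.\<close>
        moreover have "b $$ (i, e j) = 0"
        proof (rule ccontr)
          assume "b $$ (i, e j) \<noteq> 0"
          then have "block n I i = block n I (e j)" "e j \<le> i"
            using b ij ej by (auto simp: levi_lower_def not_less[symmetric])
          moreover have "e j \<noteq> i" using ej True by auto
          ultimately have "e j \<in> R" using R True by (auto simp: block_initial_def)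
          then show False using ej by simp
        qed
        ultimately show ?thesis using rhs by simp
      next
        case False
        then have "i \<in> e ` {k..<n}" using eb ij by (simp add: bij_betw_def)
        then obtain l0 where l0: "k \<le> l0" "l0 < n" "i = e l0" by auto
        have "(k \<le> l \<and> i = e l) \<longleftrightarrow> l = l0" if "l < n" for l
          using eb l0 that by (auto simp: bij_betw_def inj_on_def)
        then have "(?M * ?D1) $$ (i, j) = (\<Sum>l<n. if l = l0 then b $$ (i, e j) else 0)"
          unfolding lhs by (intro sum.cong) auto
        then show ?thesis using l0 rhs by simp
      qed
    qed
  qed (use M D1 bc N D2 in auto)
qed

text \<open>Determinants of the matrix identity. The left correction factor contributes the diagonal
  entries of b outside \<open>R\<close>; cancelling them against \<open>det b\<close> leaves those
  in \<open>R\<close>.\<close>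

lemma flag_minor_semi_invariant:
  assumes R: "block_initial n I R" and b: "levi_lower n I b" and c: "c \<in> upper_borel n"
    and g: "g \<in> carrier_mat n n"
  shows "flag_minor n R (b * g * c) = (\<Prod>r\<in>R. b $$ (r, r)) * (\<Prod>j<card R. c $$ (j, j)) * flag_minor n R g"
proof -
  define k e where "k = card R" and "e = compl_enum n R"
  define D1 where "D1 = mat n n (\<lambda>(i, j). if i < k \<or> j < k then if i = j then 1 else 0 else b $$ (e i, e j))"
  define D2 where "D2 = mat n n (\<lambda>(i, j). if i < k \<and> j < k then c $$ (i, j) else if i = j then 1 else 0)"
  have Rn: "R \<subseteq> {..<n}" using R by (simp add: block_initial_def)
  have kn: "k \<le> n" using card_mono[OF _ Rn] by (simp add: k_def)
  have bG: "b \<in> carrier (GL n)" using b by (simp add: levi_lower_def)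
  have bc: "b \<in> carrier_mat n n" using bG GL_carrier_mat by blast
  have eb: "bij_betw e {k..<n} ({..<n} - R)" unfolding e_def k_def by (rule compl_enum_bij[OF Rn])
  have eq: "minor_mat n R (b * g * c) * D1 = b * (minor_mat n R g * D2)"
    unfolding D1_def D2_def k_def e_def by (rule minor_mat_semi_invariant[OF assms])
  have D: "D1 \<in> carrier_mat n n" "D2 \<in> carrier_mat n n" by (auto simp: D1_def D2_def)
  have detb: "det b = (\<Prod>i<n. b $$ (i, i))"
    by (rule det_lower_triangular_prod[OF bc]) (use b in \<open>auto simp: levi_lower_def\<close>)
  have "det D1 = (\<Prod>i<n. D1 $$ (i, i))"
  proof (rule det_lower_triangular_prod[OF D(1)])
    fix i j assume ij: "i < j" "j < n"
    show "D1 $$ (i, j) = 0"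
    proof (cases "i < k")
      case True then show ?thesis using ij by (simp add: D1_def)
    next
      case False
      then have "e i < e j" using compl_enum_mono[OF Rn, of i j] ij by (simp add: e_def k_def)
      moreover have "e i < n" "e j < n" using eb ij False by (auto dest: bij_betwE)
      ultimately show ?thesis using b ij False by (simp add: D1_def levi_lower_def)
    qed
  qed
  also have "\<dots> = (\<Prod>i\<in>{k..<n}. D1 $$ (i, i))"
    by (rule prod.mono_neutral_right) (auto simp: D1_def)
  also have "\<dots> = (\<Prod>i\<in>{k..<n}. b $$ (e i, e i))"
    by (rule prod.cong) (auto simp: D1_def)
  also have "\<dots> = (\<Prod>r\<in>{..<n} - R. b $$ (r, r))"
    by (rule prod.reindex_bij_betw[OF eb])
  finally have detD1: "det D1 = (\<Prod>r\<in>{..<n} - R. b $$ (r, r))" .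
  have "det D2 = (\<Prod>i<n. D2 $$ (i, i))"
    by (rule det_upper_triangular_prod[OF D(2)])
      (use c upper_borel_carrier[OF c] in \<open>auto simp: D2_def upper_borel_iff\<close>)
  also have "\<dots> = (\<Prod>i<k. D2 $$ (i, i))"
    by (rule prod.mono_neutral_right) (use kn in \<open>auto simp: D2_def\<close>)
  also have "\<dots> = (\<Prod>j<k. c $$ (j, j))"
    by (rule prod.cong) (use kn in \<open>auto simp: D2_def\<close>)
  finally have detD2: "det D2 = (\<Prod>j<k. c $$ (j, j))" .
  have split: "(\<Prod>i<n. b $$ (i, i)) = (\<Prod>r\<in>{..<n} - R. b $$ (r, r)) * (\<Prod>r\<in>R. b $$ (r, r))"
    using prod.subset_diff[OF Rn, of "\<lambda>r. b $$ (r, r)"] by simp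
  have "det b \<noteq> 0" using bG by (simp add: carrier_GL)
  then have nz: "(\<Prod>r\<in>{..<n} - R. b $$ (r, r)) \<noteq> 0" unfolding detb split by simp
  have "flag_minor n R (b * g * c) * det D1 = det b * (flag_minor n R g * det D2)"
    unfolding flag_minor_def
    using arg_cong[OF eq, of det]
    unfolding det_mult[OF minor_mat_carrier D(1)] det_mult[OF bc mult_carrier_mat[OF minor_mat_carrier D(2)]]
      det_mult[OF minor_mat_carrier D(2)] .
  then show ?thesis unfolding detD1 detD2 detb split using nz by (simp add: k_def)
qed

section \<open>Test matrices for the semi-invariants\<close>

definition block_increasing :: "nat \<Rightarrow> nat set \<Rightarrow> (nat \<Rightarrow> nat) \<Rightarrow> bool" where
  "block_increasing n I f \<longleftrightarrow> (\<forall>i j. i < j \<longrightarrow> j < n \<longrightarrow> block n I i = block n I j \<longrightarrow> f i < f j)"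

text \<open>The positions (f s, s) off the diagonal lie above the diagonal blocks. Adding 1 there to
  the identity gives an upper triangular matrix, and it stays so under any permutation within
  blocks.\<close>

definition block_lowering :: "nat \<Rightarrow> nat set \<Rightarrow> (nat \<Rightarrow> nat) \<Rightarrow> bool" where
  "block_lowering n I f \<longleftrightarrow> (\<forall>s<n. f s < n \<and> (f s \<noteq> s \<longrightarrow> block n I (f s) < block n I s))"

definition unit_shift :: "nat \<Rightarrow> (nat \<Rightarrow> nat) \<Rightarrow> complex mat" where
  "unit_shift n f = mat n n (\<lambda>(i, j). if i = j \<or> i = f j then 1 else 0)"

lemma unit_shift_column_sum:
  assumes "u permutes {..<n}" "\<forall>s<n. f s < n" "j < n"
  shows "(\<Sum>i<n. y i * (unit_shift n f * pmat n u) $$ (i, j)) =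
    y (u j) + (if f (u j) = u j then 0 else y (f (u j)))"
proof -
  have uj: "u j < n" using permutes_in_image[OF assms(1), of j] assms(3) by simp
  have "(\<Sum>i<n. y i * (unit_shift n f * pmat n u) $$ (i, j)) =
      (\<Sum>i<n. (if i = u j then y (u j) else 0) + (if i = f (u j) then if f (u j) = u j then 0 else y (f (u j)) else 0))"
    using uj by (intro sum.cong)
      (auto simp: mult_pmat_entry[OF assms(1) _ _ assms(3)] unit_shift_def simp del: index_mult_mat(1))
  then show ?thesis using uj assms(2) by (simp add: sum.distrib)
qed

definition prefix_set :: "nat \<Rightarrow> (nat \<Rightarrow> nat) \<Rightarrow> nat \<Rightarrow> nat set" where
  "prefix_set n u k = {x. x < n \<and> inv' u x < k}"

lemma prefix_set_image:
  assumes "u permutes {..<n}" "k \<le> n"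
  shows "prefix_set n u k = u ` {..<k}"
proof (intro subset_antisym subsetI)
  fix x assume "x \<in> prefix_set n u k"
  then show "x \<in> u ` {..<k}"
    using permutes_inverses(1)[OF assms(1), of x] by (intro image_eqI[of _ _ "inv' u x"]) (auto simp: prefix_set_def)
next
  fix x assume "x \<in> u ` {..<k}"
  then obtain j where j: "x = u j" "j < k" by auto
  then show "x \<in> prefix_set n u k"
    using permutes_inverses(2)[OF assms(1), of j] permutes_in_image[OF assms(1), of j] assms(2)
    by (simp add: prefix_set_def)
qed

lemma card_prefix_set:
  assumes "u permutes {..<n}" "k \<le> n"
  shows "card (prefix_set n u k) = k"
  unfolding prefix_set_image[OF assms] using card_image[OF inj_on_subset[OF permutes_inj[OF assms(1)]]] by simp

lemma finite_prefix_set: "finite (prefix_set n u k)"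
  by (rule finite_subset[of _ "{..<n}"]) (auto simp: prefix_set_def)

text \<open>The hypothesis \<open>ker\<close> excludes nonzero left kernel vectors of the minor
  matrix. The unit columns make such a vector y vanish outside \<open>R\<close>, and the column
  whose permuted index is s gives the equation relating y at s and at f s.\<close>

lemma flag_minor_nonzeroI:
  assumes u: "u permutes {..<n}" and f: "\<forall>s<n. f s < n" and R: "R \<subseteq> {..<n}"
    and ker: "\<And>y. (\<And>r. r < n \<Longrightarrow> r \<notin> R \<Longrightarrow> y r = 0) \<Longrightarrow>
      (\<And>s. s \<in> prefix_set n u (card R) \<Longrightarrow> y s + (if f s = s then 0 else y (f s)) = 0) \<Longrightarrow>
      (\<And>i. i < n \<Longrightarrow> y i = (0 :: complex))"
  shows "flag_minor n R (unit_shift n f * pmat n u) \<noteq> 0"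
proof -
  let ?g = "unit_shift n f * pmat n u" and ?M = "minor_mat n R (unit_shift n f * pmat n u)"
  have kn: "card R \<le> n" using card_mono[OF _ R] by simp
  have MT: "transpose_mat ?M \<in> carrier_mat n n" using minor_mat_carrier by simp
  have "det (transpose_mat ?M) \<noteq> 0"
  proof (rule det_nonzero_if_kernel_zero[OF MT])
    fix y i assume y: "\<And>j. j < n \<Longrightarrow> (\<Sum>i<n. transpose_mat ?M $$ (j, i) * y i) = 0" and i: "i < n"
    have y': "(\<Sum>i<n. y i * ?M $$ (i, j)) = 0" if "j < n" for j
      using y[OF that] that minor_mat_carrier[of n R ?g] by (simp add: mult.commute)
    show "y i = 0"
    proof (rule ker[OF _ _ i])
      fix r assume r: "r < n" "r \<notin> R"
      then have "r \<in> compl_enum n R ` {card R..<n}"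
        using compl_enum_bij[OF R] by (simp add: bij_betw_def)
      then obtain j where j: "card R \<le> j" "j < n" "r = compl_enum n R j" by auto
      have "(\<Sum>i<n. y i * ?M $$ (i, j)) = (\<Sum>i<n. if i = r then y i else 0)"
        using j by (intro sum.cong) (auto simp: minor_mat_def)
      then show "y r = 0" using y'[OF j(2)] r(1) by simp
    next
      fix s assume s: "s \<in> prefix_set n u (card R)"
      then obtain j where j: "s = u j" "j < card R" unfolding prefix_set_image[OF u kn] by auto
      have "(\<Sum>i<n. y i * ?M $$ (i, j)) = (\<Sum>i<n. y i * ?g $$ (i, j))"
        using j(2) kn by (intro sum.cong) (auto simp: minor_mat_def simp del: index_mult_mat(1))
      moreover have jn: "j < n" using j kn by simp
      ultimately have "(\<Sum>i<n. y i * ?g $$ (i, j)) = 0" using y'[OF jn] by (simp only:)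
      then show "y s + (if f s = s then 0 else y (f s)) = 0"
        unfolding unit_shift_column_sum[OF u f jn] j(1) .
    qed
  qed
  then show ?thesis unfolding flag_minor_def using det_transpose[OF minor_mat_carrier] by metis
qed

text \<open>Here y is a nonzero left kernel vector of the minor matrix, given explicitly.\<close>

lemma flag_minor_zeroI:
  assumes u: "u permutes {..<n}" and f: "\<forall>s<n. f s < n" and R: "R \<subseteq> {..<n}"
    and y: "\<And>r. r < n \<Longrightarrow> r \<notin> R \<Longrightarrow> y r = 0"
      "\<And>s. s \<in> prefix_set n u (card R) \<Longrightarrow> y s + (if f s = s then 0 else y (f s)) = 0"
      "i < n" "y i \<noteq> (0 :: complex)"
  shows "flag_minor n R (unit_shift n f * pmat n u) = 0"
proof -
  let ?g = "unit_shift n f * pmat n u" and ?M = "minor_mat n R (unit_shift n f * pmat n u)"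
  have kn: "card R \<le> n" using card_mono[OF _ R] by simp
  have MT: "transpose_mat ?M \<in> carrier_mat n n" using minor_mat_carrier by simp
  have col: "(\<Sum>i<n. ?M $$ (i, j) * y i) = 0" if jn: "j < n" for j
  proof (cases "j < card R")
    case True
    have "(\<Sum>i<n. ?M $$ (i, j) * y i) = (\<Sum>i<n. y i * ?g $$ (i, j))"
      using True kn by (intro sum.cong) (auto simp: minor_mat_def simp del: index_mult_mat(1))
    also have "\<dots> = 0"
      using unit_shift_column_sum[OF u f jn, where y = y] y(2)[of "u j"] True prefix_set_image[OF u kn] by simp
    finally show ?thesis .
  next
    case False
    then have e: "compl_enum n R j \<in> {..<n} - R"
      using compl_enum_bij[OF R] jn by (auto dest: bij_betwE)
    have "(\<Sum>i<n. ?M $$ (i, j) * y i) = (\<Sum>i<n. if i = compl_enum n R j then y i else 0)"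
      using False jn by (intro sum.cong) (auto simp: minor_mat_def)
    then show ?thesis using e y(1) by simp
  qed
  have "transpose_mat ?M *\<^sub>v vec n y = 0\<^sub>v n"
  proof (rule eq_vecI)
    fix j assume "j < dim_vec (0\<^sub>v n :: complex vec)"
    then have jn: "j < n" by simp
    then have "(transpose_mat ?M *\<^sub>v vec n y) $ j = (\<Sum>i<n. ?M $$ (i, j) * y i)"
      using minor_mat_carrier[of n R ?g] by (simp add: scalar_prod_def atLeast0LessThan)
    then show "(transpose_mat ?M *\<^sub>v vec n y) $ j = 0\<^sub>v n $ j" using col jn by simp
  qed (use minor_mat_carrier[of n R ?g] in simp)
  moreover have "vec n y \<noteq> 0\<^sub>v n" using y(3,4) by (metis index_vec index_zero_vec(1))
  ultimately have "det (transpose_mat ?M) = 0"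
    using det_0_iff_vec_prod_zero[OF MT] by (metis vec_carrier)
  then show ?thesis unfolding flag_minor_def using det_transpose[OF minor_mat_carrier] by metis
qed

subsection \<open>Semi-invariants obstruct dense orbits\<close>

lemma levi_borel_conj_lower:
  assumes z: "z permutes {..<n}" and bl: "\<And>i. block n I (inv' z i) = block n I i"
    and dec: "block_decreasing n I (inv' z)" and k: "k \<in> levi_borel n I"
  shows "levi_lower n I (perm_conj n (inv' z) k)" "pmat n z * k = perm_conj n (inv' z) k * pmat n z"
proof -
  have z': "inv' z permutes {..<n}" by (rule permutes_inv[OF z])
  have kG: "k \<in> carrier (GL n)" using k by (simp add: levi_borel_iff)
  have kc: "k \<in> carrier_mat n n" using GL_carrier_mat[OF kG] .
  have "perm_conj n (inv' z) k $$ (i, j) = 0" if ij: "i < n" "j < n" "block n I i \<noteq> block n I j \<or> i < j" for i j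
  proof -
    have lt: "inv' z i < n" "inv' z j < n" using permutes_in_image[OF z'] ij by auto
    have "block n I (inv' z i) \<noteq> block n I (inv' z j) \<or> inv' z j < inv' z i"
      using ij dec unfolding bl block_decreasing_def by blast
    then show ?thesis using k lt ij by (simp add: levi_borel_iff perm_conj_def)
  qed
  then show "levi_lower n I (perm_conj n (inv' z) k)"
    using perm_conj_GL[OF z' kG] by (simp add: levi_lower_def)
  have "pmat n z * k = pmat n z * (k * pmat n (inv' z)) * pmat n z"
    using kc pmat_comp[OF z' z] permutes_inv_o(2)[OF z]
        by (simp add: mat_assoc[of _ n] mult_carrier_sq[of _ n] pmat_carrier perm_conj_carrier pmat_id)
  also have "\<dots> = pmat n z * pmat n (inv' z) * perm_conj n (inv' z) k * pmat n z"
    unfolding mult_pmat[OF z' kc] by (simp add: mat_assoc[of _ n] mult_carrier_sq[of _ n] pmat_carrier perm_conj_carrier)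
  also have "\<dots> = perm_conj n (inv' z) k * pmat n z"
    unfolding pmat_comp[OF z z'] permutes_inv_o(1)[OF z] pmat_id left_mult_one_mat[OF perm_conj_carrier] ..
  finally show "pmat n z * k = perm_conj n (inv' z) k * pmat n z" .
qed

definition common_weight :: "nat \<Rightarrow> nat set \<Rightarrow> (complex mat \<Rightarrow> complex) \<Rightarrow> (complex mat \<Rightarrow> complex) \<Rightarrow> bool" where
  "common_weight n I p q \<longleftrightarrow> pf n p \<and> pf n q \<and>
     (\<forall>b c. levi_lower n I b \<longrightarrow> c \<in> upper_borel n \<longrightarrow>
        (\<exists>a. \<forall>g\<in>carrier_mat n n. p (b * g * c) = a * p g \<and> q (b * g * c) = a * q g))"

text \<open>The combination p(y') q - q(y') p vanishes on the orbit, hence on its closure; at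
  \<open>h2\<close> this leaves q(y') = 0. Then q vanishes on the whole orbit and hence at
  \<open>h1\<close>, a contradiction. Cross-multiplying avoids a division by possibly vanishing
  values.\<close>

lemma no_dense_orbit:
  assumes z: "z permutes {..<n}" and bl: "\<And>i. block n I (inv' z i) = block n I i"
    and dec: "block_decreasing n I (inv' z)" and y: "y \<in> carrier (GL n)"
    and D: "D \<subseteq> vcl n (orbit_coset n (levi_borel n I) y)"
    and pq: "common_weight n I p q"
    and h: "h1 \<in> D" "h2 \<in> D" "q (pmat n z * h1) \<noteq> 0" "q (pmat n z * h2) = 0" "p (pmat n z * h2) \<noteq> 0"
  shows False
proof -
  let ?P = "pmat n z"
  define y' where "y' = ?P * y"
  have yc: "y \<in> carrier_mat n n" "y' \<in> carrier_mat n n"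
    unfolding y'_def using GL_carrier_mat[OF y] mult_carrier_mat[OF pmat_carrier GL_carrier_mat[OF y]] by auto
  have P: "pmf n n (\<lambda>A. ?P * A)" by (intro pmf_mult pmf_const pmf_id pmat_carrier)
  have pf: "pf n (\<lambda>A. p (?P * A))" "pf n (\<lambda>A. q (?P * A))"
    using pq unfolding common_weight_def by (auto intro: pf_comp[OF _ P])
  have orb: "\<exists>a. p (?P * s) = a * p y' \<and> q (?P * s) = a * q y'"
    if s: "s \<in> orbit_coset n (levi_borel n I) y" for s
  proof -
    obtain k c where kc: "k \<in> levi_borel n I" "c \<in> upper_borel n" "s = k * y * c"
      using s unfolding orbit_coset_def by blast
    note low = levi_borel_conj_lower[OF z bl dec kc(1)]
    have k: "k \<in> carrier_mat n n" using kc(1) GL_carrier_mat by (auto simp: levi_borel_iff)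
    have "?P * s = ?P * k * y * c"
      using k yc upper_borel_carrier[OF kc(2)]
        by (simp add: kc(3) mat_assoc[of _ n] mult_carrier_sq[of _ n] pmat_carrier perm_conj_carrier)
    also have "\<dots> = perm_conj n (inv' z) k * y' * c"
      unfolding low(2) y'_def using yc
        by (simp add: mat_assoc[of _ n] mult_carrier_sq[of _ n] pmat_carrier perm_conj_carrier)
    finally have "?P * s = perm_conj n (inv' z) k * y' * c" .
    then show ?thesis using pq low(1) kc(2) yc(2) unfolding common_weight_def by metis
  qed
  have "pf n (\<lambda>A. p y' * q (?P * A) - q y' * p (?P * A))"
    by (intro pf_diff pf_mult pf_const pf)
  moreover have "p y' * q (?P * s) - q y' * p (?P * s) = 0" if "s \<in> orbit_coset n (levi_borel n I) y" for s
    using orb[OF that] by auto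
  ultimately have "p y' * q (?P * h2) - q y' * p (?P * h2) = 0"
    using vclD[of h2 n "orbit_coset n (levi_borel n I) y"] D h(2) by blast
  then have "q y' = 0" using h(4,5) by simp
  then have "q (?P * s) = 0" if "s \<in> orbit_coset n (levi_borel n I) y" for s
    using orb[OF that] by auto
  then have "q (?P * h1) = 0"
    using vclD[OF _ pf(2), of h1 "orbit_coset n (levi_borel n I) y"] D h(1) by blast
  with h(3) show False by simp
qed

text \<open>As z permutes only within blocks, the conjugate of \<open>unit_shift n f\<close> by z is
  still upper triangular and can serve as the left factor of an element of the double coset.\<close>

lemma unit_shift_in_dcoset:
  assumes z: "z permutes {..<n}" and bl: "\<And>i. block n I (inv' z i) = block n I i"
    and w: "w permutes {..<n}"
    and f': "block_lowering n I f"
  obtains h where "h \<in> dcoset n w" "pmat n z * h = unit_shift n f * pmat n (z \<circ> w)"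
proof -
  have f: "\<And>s. s < n \<Longrightarrow> f s < n" "\<And>s. s < n \<Longrightarrow> f s \<noteq> s \<Longrightarrow> block n I (f s) < block n I s"
    using f' by (simp_all add: block_lowering_def)
  let ?x = "unit_shift n f"
  have xc: "?x \<in> carrier_mat n n" by (simp add: unit_shift_def)
  have lt: "f s < s" if "s < n" "f s \<noteq> s" for s
    using f(2)[OF that] block_mono[of s "f s" n I] by (meson leD leI)
  have xup: "upper_triangular ?x"
  proof (rule upper_triangularI)
    fix i j assume ij: "j < i" "i < dim_row ?x"
    then have ijn: "i < n" "j < n" using xc by auto
    have "i \<noteq> f j" using lt[OF ijn(2)] ij(1) by fastforce
    then show "?x $$ (i, j) = 0" using ij(1) ijn by (simp add: unit_shift_def)
  qed
  have "det ?x \<noteq> 0"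
    using upper_triangular_imp_det_eq_0_iff[OF xc xup] xc by (auto simp: unit_shift_def diag_mat_def)
  then have xG: "?x \<in> carrier (GL n)" using xc by (simp add: carrier_GL)
  let ?b = "perm_conj n z ?x"
  have "?b \<in> upper_borel n"
    unfolding upper_borel_iff
  proof (intro conjI perm_conj_GL[OF z xG] upper_triangularI)
    fix i j assume ij: "j < i" "i < dim_row ?b"
    then have ijn: "i < n" "j < n" by (simp_all add: perm_conj_def)
    have zn: "z i < n" "z j < n" "z i \<noteq> z j"
      using ijn ij permutes_in_image[OF z] permutes_inj[OF z] by (auto simp: inj_eq)
    have zb: "block n I (z i) = block n I i" for i
      using bl[of "z i"] permutes_inverses(2)[OF z] by simp
    have "z i \<noteq> f (z j)"
    proof
      assume eq: "z i = f (z j)"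
      then have "block n I (f (z j)) < block n I (z j)" using f(2)[OF zn(2)] zn(3) by simp
      then have "block n I i < block n I j" unfolding eq[symmetric] zb .
      then show False using block_mono[of j i n I] ij by simp
    qed
    then show "?b $$ (i, j) = 0" using ijn zn by (simp add: perm_conj_def unit_shift_def)
  qed
  then have "?b * pmat n w * 1\<^sub>m n \<in> dcoset n w" using dcosetI upper_borel_one by blast
  moreover have "pmat n z * (?b * pmat n w * 1\<^sub>m n) = ?x * pmat n (z \<circ> w)"
  proof -
    have "pmat n z * (?b * pmat n w * 1\<^sub>m n) = pmat n z * ?b * pmat n w"
      by (simp add: mat_assoc[of _ n] mult_carrier_sq[of _ n] pmat_carrier perm_conj_carrier right_mult_one_mat[of _ n n])
    also have "\<dots> = ?x * (pmat n z * pmat n w)"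
      unfolding mult_pmat[OF z xc, symmetric] using xc
        by (simp add: mat_assoc[of _ n] mult_carrier_sq[of _ n] pmat_carrier perm_conj_carrier)
    finally show ?thesis unfolding pmat_comp[OF z w] .
  qed
  ultimately show ?thesis using that by blast
qed

lemma block_initial_prefix:
  assumes "block_increasing n I (inv' u)"
  shows "block_initial n I (prefix_set n u k)"
  unfolding block_initial_def
proof (intro conjI ballI allI impI)
  fix i j assume "i \<in> prefix_set n u k" "j < i" "block n I j = block n I i"
  then have "i < n" "inv' u i < k" "inv' u j < inv' u i"
    using assms by (auto simp: prefix_set_def block_increasing_def)
  then show "j \<in> prefix_set n u k" using \<open>j < i\<close> by (simp add: prefix_set_def)
qed (auto simp: prefix_set_def)


lemma flag_minor_semi_card:
  assumes "block_initial n I R" "levi_lower n I b" "c \<in> upper_borel n" "g \<in> carrier_mat n n" "card R = k"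
  shows "flag_minor n R (b * g * c) = (\<Prod>r\<in>R. b $$ (r, r)) * (\<Prod>j<k. c $$ (j, j)) * flag_minor n R g"
  using flag_minor_semi_invariant[OF assms(1-4)] assms(5) by simp

lemma card_exchange:
  assumes "finite S" "c \<in> S" "a \<notin> S"
  shows "card (insert a (S - {c})) = card S"
proof -
  have "0 < card S" using assms(1,2) card_gt_0_iff by blast
  then show ?thesis using assms by (simp add: card_Diff_singleton)
qed

lemma block_initial_insert:
  assumes "block_initial n I S" "a < n" "\<And>j. j < a \<Longrightarrow> block n I j = block n I a \<Longrightarrow> j \<in> S"
  shows "block_initial n I (insert a S)"
  using assms unfolding block_initial_def by blast

lemma block_initial_remove:
  assumes "block_initial n I S" "\<And>i. i \<in> S \<Longrightarrow> c < i \<Longrightarrow> block n I c \<noteq> block n I i"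
  shows "block_initial n I (S - {c})"
  using assms unfolding block_initial_def by blast

text \<open>
  In the two obstruction lemmas, the minors with rows obtained from prefixes of \<open>u\<close> by exchanging
  values of the pattern evaluate to monomials (up to sign) in the root coordinates of the pattern.
  A linear relation among the inversions of the pattern yields two products of minors of the
  same weight.
\<close>

lemma pattern321_obstruction:
  assumes u: "u permutes {..<n}"
    and binc: "block_increasing n I (inv' u)"
    and pat: "i0 < j0" "j0 < k0" "k0 < n" "u k0 < u j0" "u j0 < u i0"
  obtains p q f1 f2 where "common_weight n I p q" "block_lowering n I f1" "block_lowering n I f2"
    "q (unit_shift n f1 * pmat n u) \<noteq> 0" "q (unit_shift n f2 * pmat n u) = 0"
    "p (unit_shift n f2 * pmat n u) \<noteq> 0"
proof -
  have inc: "inv' u i < inv' u j" if "i < j" "j < n" "block n I i = block n I j" for i j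
    using binc that by (simp add: block_increasing_def)
  have ui: "inv' u (u x) = x" "u (inv' u x) = x" for x using permutes_inverses[OF u] by auto
  have un: "u x < n \<longleftrightarrow> x < n" "inv' u x < n \<longleftrightarrow> x < n" for x
    using permutes_in_image[OF u] permutes_in_image[OF permutes_inv[OF u]] by auto
  \<comment> \<open>The pattern is made tight around its middle value b: c is the last larger value
    before b, and a the first smaller value after it. Without this choice the exchanged row sets
    need not meet every block in an initial segment.\<close>
  define P where "P = {i. i < j0 \<and> u j0 < u i}"
  define pc where "pc = Max P"
  have finP: "finite P" unfolding P_def by simp
  have neP: "P \<noteq> {}" unfolding P_def using pat by auto
  have "pc \<in> P" unfolding pc_def by (rule Max_in[OF finP neP])
  then have pc: "pc < j0" "u j0 < u pc" by (auto simp: P_def)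
  have pcmax: "i \<le> pc" if "i < j0" "u j0 < u i" for i
    unfolding pc_def by (rule Max_ge[OF finP]) (use that in \<open>simp add: P_def\<close>)
  define pa where "pa = (LEAST k. j0 < k \<and> u k < u j0)"
  have pa: "j0 < pa" "u pa < u j0" using LeastI[of "\<lambda>k. j0 < k \<and> u k < u j0" k0] pat unfolding pa_def by auto
  have pamin: "pa \<le> k" if "j0 < k" "u k < u j0" for k unfolding pa_def using that by (intro Least_le) simp
  have pan: "pa < n" using pamin[of k0] pat by simp
  define a b c where "a = u pa" and "b = u j0" and "c = u pc"
  have abc: "a < b" "b < c" "a < n" "b < n" "c < n"
    using pc pa pan pat by (auto simp: a_def b_def c_def un)
  have pos: "inv' u a = pa" "inv' u b = j0" "inv' u c = pc" by (simp_all add: a_def b_def c_def ui)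
  define S1 where "S1 = prefix_set n u j0"
  define S2 where "S2 = insert b S1"
  have mem: "x \<in> S1 \<longleftrightarrow> x < n \<and> inv' u x < j0" for x by (simp add: S1_def prefix_set_def)
  have S2: "prefix_set n u (Suc j0) = S2"
  proof (rule Set.set_eqI)
    fix x
    have "inv' u x = j0 \<longleftrightarrow> x = b" using ui(2)[of x] pos(2) unfolding b_def by metis
    then show "x \<in> prefix_set n u (Suc j0) \<longleftrightarrow> x \<in> S2"
      using abc(4) unfolding S2_def prefix_set_def by (simp add: mem less_Suc_eq) blast
  qed
  have fin: "finite S1" by (simp add: S1_def finite_prefix_set)
  have card1: "card S1 = j0" using card_prefix_set[OF u, of j0] pat by (simp add: S1_def)
  have in1: "c \<in> S1" "a \<notin> S1" "b \<notin> S1" using abc pos pc pa by (auto simp: mem)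
  have card2: "card S2 = Suc j0" using fin in1 card1 by (simp add: S2_def)
  \<comment> \<open>In the prefix before b, \<open>R1\<close> exchanges c for a and
    \<open>R1'\<close> exchanges c for b; \<open>R2'\<close> is the prefix ending with b in which b
    is exchanged for a. Going from c to a directly, or by way of b, gives the same total
    weight.\<close>
  define R1 where "R1 = insert a (S1 - {c})"
  define R1' where "R1' = insert b (S1 - {c})"
  define R2' where "R2' = insert a S1"
  have card: "card R1 = j0" "card R1' = j0" "card R2' = Suc j0"
    using card_exchange[OF fin in1(1)] in1 card1 fin by (auto simp: R1_def R1'_def R2'_def)
  have apre: "j \<in> S1" if "j < a" "block n I j = block n I a" for j
  proof -
    have jn: "j < n" using that abc by simp
    have "j \<noteq> b" using that abc by simp
    then have "inv' u j \<noteq> j0" using ui(2)[of j] by (auto simp: b_def)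
    moreover have "\<not> j0 < inv' u j"
    proof
      assume "j0 < inv' u j"
      then have "pa \<le> inv' u j" using pamin[of "inv' u j"] that abc by (simp add: ui b_def)
      then show False using inc[OF that(1) abc(3) that(2)] pos by simp
    qed
    ultimately show ?thesis using jn by (simp add: mem)
  qed
  have cmax: "j \<noteq> c" if "i \<in> S1" "j < i" "block n I j = block n I i" for i j
  proof
    assume "j = c"
    then have "pc < inv' u i" using inc[OF that(2) _ that(3)] that(1) pos by (simp add: mem)
    moreover have "inv' u i \<le> pc" using that abc \<open>j = c\<close> by (intro pcmax) (auto simp: mem ui b_def)
    ultimately show False by simp
  qed
  have bpre: "j \<in> S1" if "j < b" "block n I j = block n I b" for j
    using inc[OF that(1) abc(4) that(2)] that abc pos by (simp add: mem)
  have iS1: "block_initial n I S1" unfolding S1_def by (rule block_initial_prefix[OF binc])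
  have iT: "block_initial n I (S1 - {c})" by (rule block_initial_remove[OF iS1]) (use cmax in metis)
  have init: "block_initial n I R1" "block_initial n I R1'" "block_initial n I S2" "block_initial n I R2'"
  proof -
    show "block_initial n I R1" unfolding R1_def
      by (rule block_initial_insert[OF iT abc(3)]) (use apre abc in auto)
    show "block_initial n I R1'" unfolding R1'_def
      by (rule block_initial_insert[OF iT abc(4)]) (use bpre abc in auto)
    show "block_initial n I S2" unfolding S2_def by (rule block_initial_insert[OF iS1 abc(4) bpre])
    show "block_initial n I R2'" unfolding R2'_def by (rule block_initial_insert[OF iS1 abc(3) apre])
  qed
  define p where "p g = flag_minor n R1 g * flag_minor n S2 g" for g
  define q where "q g = flag_minor n R1' g * flag_minor n R2' g" for g
  have "common_weight n I p q"
    unfolding common_weight_def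
  proof (intro conjI allI impI)
    show "pf n p" "pf n q" unfolding p_def q_def by (intro pf_mult pf_flag_minor)+
    fix M N assume MN: "levi_lower n I M" "N \<in> upper_borel n"
    let ?w = "M $$ (a, a) * M $$ (b, b) * (\<Prod>r\<in>S1 - {c}. M $$ (r, r)) * (\<Prod>r\<in>S1. M $$ (r, r)) *
      (\<Prod>j<j0. N $$ (j, j)) * (\<Prod>j<Suc j0. N $$ (j, j))"
    have prods: "(\<Prod>r\<in>R1. M $$ (r, r)) = M $$ (a, a) * (\<Prod>r\<in>S1 - {c}. M $$ (r, r))"
      "(\<Prod>r\<in>R1'. M $$ (r, r)) = M $$ (b, b) * (\<Prod>r\<in>S1 - {c}. M $$ (r, r))"
      "(\<Prod>r\<in>S2. M $$ (r, r)) = M $$ (b, b) * (\<Prod>r\<in>S1. M $$ (r, r))"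
      "(\<Prod>r\<in>R2'. M $$ (r, r)) = M $$ (a, a) * (\<Prod>r\<in>S1. M $$ (r, r))"
      using fin in1 by (simp_all add: R1_def R1'_def S2_def R2'_def)
    show "\<exists>w. \<forall>g\<in>carrier_mat n n. p (M * g * N) = w * p g \<and> q (M * g * N) = w * q g"
    proof (intro exI[of _ ?w] ballI)
      fix g :: "complex mat" assume g: "g \<in> carrier_mat n n"
      note semi = flag_minor_semi_card[OF _ MN g]
      show "p (M * g * N) = ?w * p g \<and> q (M * g * N) = ?w * q g"
        unfolding p_def q_def semi[OF init(1) card(1)] semi[OF init(2) card(2)]
          semi[OF init(3) card2] semi[OF init(4) card(3)] prods
        by (simp add: ac_simps)
    qed
  qed
  moreover
  have blk: "block n I i < block n I j" if "i < j" "j < n" "inv' u j < inv' u i" for i j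
    using inc[OF that(1,2)] block_mono[of i j n I] that by (cases "block n I i = block n I j") auto
  have bl: "block n I a < block n I b" "block n I b < block n I c" "block n I a < block n I c"
    using blk[of a b] blk[of b c] blk[of a c] abc pos pc pa by auto
  \<comment> \<open>\<open>f1\<close> supplies the entries for the detour from c to b and from b to
    a, on which q is nonzero. \<open>f2\<close> supplies only the direct entry from c to a, so the
    minor of \<open>R1'\<close> vanishes while both factors of p survive.\<close>
  define f1 where "f1 s = (if s = b then a else if s = c then b else s)" for s
  define f2 where "f2 s = (if s = c then a else s)" for s
  have f1: "\<forall>s<n. f1 s < n" "block_lowering n I f1"
    using abc bl by (auto simp: f1_def block_lowering_def)
  have f2: "\<forall>s<n. f2 s < n" "block_lowering n I f2"
    using abc bl by (auto simp: f2_def block_lowering_def)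
  have Rn: "R1 \<subseteq> {..<n}" "R1' \<subseteq> {..<n}" "S2 \<subseteq> {..<n}" "R2' \<subseteq> {..<n}"
    using init by (auto simp: block_initial_def)
  have q1: "flag_minor n R1' (unit_shift n f1 * pmat n u) \<noteq> 0"
  proof (rule flag_minor_nonzeroI[OF u f1(1) Rn(2)])
    fix y :: "nat \<Rightarrow> complex" and i
    assume y0: "\<And>r. r < n \<Longrightarrow> r \<notin> R1' \<Longrightarrow> y r = 0" and i: "i < n"
      and "\<And>s. s \<in> prefix_set n u (card R1') \<Longrightarrow> y s + (if f1 s = s then 0 else y (f1 s)) = 0"
    then have ys: "y s + (if f1 s = s then 0 else y (f1 s)) = 0" if "s \<in> S1" for s
      using that by (simp add: card S1_def)
    have "y c = 0" using y0[of c] abc by (simp add: R1'_def)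
    then have "y b = 0" using ys[OF in1(1)] abc by (simp add: f1_def)
    moreover have "y s = 0" if "s \<in> S1" "s \<noteq> c" for s
      using ys[OF that(1)] that in1 by (auto simp: f1_def split: if_splits)
    ultimately show "y i = 0" using y0[OF i] by (auto simp: R1'_def)
  qed
  have q2: "flag_minor n R2' (unit_shift n f1 * pmat n u) \<noteq> 0"
  proof (rule flag_minor_nonzeroI[OF u f1(1) Rn(4)])
    fix y :: "nat \<Rightarrow> complex" and i
    assume y0: "\<And>r. r < n \<Longrightarrow> r \<notin> R2' \<Longrightarrow> y r = 0" and i: "i < n"
      and "\<And>s. s \<in> prefix_set n u (card R2') \<Longrightarrow> y s + (if f1 s = s then 0 else y (f1 s)) = 0"
    then have ys: "y s + (if f1 s = s then 0 else y (f1 s)) = 0" if "s \<in> S2" for s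
      using that by (simp add: card S2)
    have yb: "y b = 0" using y0[of b] abc in1 by (simp add: R2'_def)
    then have "y a = 0" using ys[of b] abc by (simp add: f1_def S2_def)
    moreover have "y s = 0" if "s \<in> S1" for s
      using ys[of s] that in1 yb by (auto simp: f1_def S2_def split: if_splits)
    ultimately show "y i = 0" using y0[OF i] by (auto simp: R2'_def)
  qed
  have q3: "flag_minor n R1' (unit_shift n f2 * pmat n u) = 0"
  proof (rule flag_minor_zeroI[OF u f2(1) Rn(2), where y = "\<lambda>r. if r = b then 1 else 0" and i = b])
    fix s assume "s \<in> prefix_set n u (card R1')"
    then have "s \<in> S1" by (simp add: card S1_def)
    then show "(if s = b then 1 else 0) + (if f2 s = s then 0 else if f2 s = b then 1 else 0) = (0 :: complex)"
      using in1 abc by (auto simp: f2_def)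
  qed (use abc in \<open>auto simp: R1'_def\<close>)
  have p1: "flag_minor n R1 (unit_shift n f2 * pmat n u) \<noteq> 0"
  proof (rule flag_minor_nonzeroI[OF u f2(1) Rn(1)])
    fix y :: "nat \<Rightarrow> complex" and i
    assume y0: "\<And>r. r < n \<Longrightarrow> r \<notin> R1 \<Longrightarrow> y r = 0" and i: "i < n"
      and "\<And>s. s \<in> prefix_set n u (card R1) \<Longrightarrow> y s + (if f2 s = s then 0 else y (f2 s)) = 0"
    then have ys: "y s + (if f2 s = s then 0 else y (f2 s)) = 0" if "s \<in> S1" for s
      using that by (simp add: card S1_def)
    have "y c = 0" using y0[of c] abc by (simp add: R1_def)
    then have "y a = 0" using ys[OF in1(1)] abc by (simp add: f2_def)
    moreover have "y s = 0" if "s \<in> S1" "s \<noteq> c" for s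
      using ys[OF that(1)] that in1 by (auto simp: f2_def split: if_splits)
    ultimately show "y i = 0" using y0[OF i] by (auto simp: R1_def)
  qed
  have p2: "flag_minor n S2 (unit_shift n f2 * pmat n u) \<noteq> 0"
  proof (rule flag_minor_nonzeroI[OF u f2(1) Rn(3)])
    fix y :: "nat \<Rightarrow> complex" and i
    assume y0: "\<And>r. r < n \<Longrightarrow> r \<notin> S2 \<Longrightarrow> y r = 0" and i: "i < n"
      and "\<And>s. s \<in> prefix_set n u (card S2) \<Longrightarrow> y s + (if f2 s = s then 0 else y (f2 s)) = 0"
    then have ys: "y s + (if f2 s = s then 0 else y (f2 s)) = 0" if "s \<in> S2" for s
      using that by (simp add: card2 S2)
    have "y a = 0" using y0[of a] abc in1 by (simp add: S2_def)
    then have "y s = 0" if "s \<in> S2" for s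
      using ys[OF that] by (auto simp: f2_def split: if_splits)
    then show "y i = 0" using y0[OF i] by blast
  qed
  have "q (unit_shift n f1 * pmat n u) \<noteq> 0" "q (unit_shift n f2 * pmat n u) = 0"
    "p (unit_shift n f2 * pmat n u) \<noteq> 0"
    unfolding p_def q_def using q1 q2 q3 p1 p2 by simp_all
  ultimately show ?thesis using that f1(2) f2(2) by blast
qed

lemma pattern3412_obstruction:
  assumes u: "u permutes {..<n}"
    and binc: "block_increasing n I (inv' u)"
    and avoid: "\<forall>i j k. i < j \<longrightarrow> j < k \<longrightarrow> k < n \<longrightarrow> u k < u j \<longrightarrow> \<not> u j < u i"
    and pat: "i0 < j0" "j0 < k0" "k0 < l0" "l0 < n" "u k0 < u l0" "u l0 < u i0" "u i0 < u j0"
  obtains p q f1 f2 where "common_weight n I p q" "block_lowering n I f1" "block_lowering n I f2"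
    "q (unit_shift n f1 * pmat n u) \<noteq> 0" "q (unit_shift n f2 * pmat n u) = 0"
    "p (unit_shift n f2 * pmat n u) \<noteq> 0"
proof -
  have inc: "inv' u i < inv' u j" if "i < j" "j < n" "block n I i = block n I j" for i j
    using binc that by (simp add: block_increasing_def)
  have no321: False if "i < j" "j < k" "k < n" "u k < u j" "u j < u i" for i j k
    using avoid that by blast
  have ui: "inv' u (u x) = x" "u (inv' u x) = x" for x using permutes_inverses[OF u] by auto
  have un: "u x < n \<longleftrightarrow> x < n" "inv' u x < n \<longleftrightarrow> x < n" for x
    using permutes_in_image[OF u] permutes_in_image[OF permutes_inv[OF u]] by auto
  have inj: "u x = u y \<longleftrightarrow> x = y" for x y using permutes_inj[OF u] by (simp add: inj_eq)
  \<comment> \<open>Among all occurrences of 3412 one of least total spread, outer distance plus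
    inner distance, is taken. Minimality and the absence of 321 exclude the values that would spoil
    the block condition for the exchanged row sets.\<close>
  define Q where "Q = (\<lambda>(i, j, k, l). i < j \<and> j < k \<and> k < l \<and> l < n \<and> u k < u l \<and> u l < u i \<and> u i < u j)"
  define \<mu> :: "nat \<times> nat \<times> nat \<times> nat \<Rightarrow> nat" where "\<mu> = (\<lambda>(i, j, k, l). (l - i) + (k - j))"
  have "Q (i0, j0, k0, l0)" using pat by (simp add: Q_def)
  from ex_has_least_nat[of Q, OF this, of \<mu>] obtain t where t: "Q t" "\<And>t'. Q t' \<Longrightarrow> \<mu> t \<le> \<mu> t'" by blast
  obtain pc pd pa pb where t': "t = (pc, pd, pa, pb)" by (metis prod.exhaust)
  have ord: "pc < pd" "pd < pa" "pa < pb" "pb < n" "u pa < u pb" "u pb < u pc" "u pc < u pd"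
    using t(1) by (auto simp: t' Q_def)
  have min: "\<not> (l - i) + (k - j) < (pb - pc) + (pa - pd)"
    if "i < j" "j < k" "k < l" "l < n" "u k < u l" "u l < u i" "u i < u j" for i j k l
    using t(2)[of "(i, j, k, l)"] that by (simp add: t' Q_def \<mu>_def)
  \<comment> \<open>The value right after the second position yields a tighter 3412 if it is above d
    or below a, and a 321 with d and a if it lies between them.\<close>
  have paS: "pa = Suc pd"
  proof (rule ccontr)
    assume "pa \<noteq> Suc pd"
    then have lt: "Suc pd < pa" using ord by simp
    have "u (Suc pd) \<noteq> u pd" "u (Suc pd) \<noteq> u pa" using lt by (auto simp: inj)
    then consider "u pd < u (Suc pd)" | "u (Suc pd) < u pa" | "u pa < u (Suc pd)" "u (Suc pd) < u pd" by linarith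
    then show False
    proof cases
      case 1
      then show False using min[of pc "Suc pd" pa pb] ord lt by simp
    next
      case 2
      then show False using min[of pc pd "Suc pd" pb] ord lt by simp
    next
      case 3
      then show False using no321[of pd "Suc pd" pa] ord lt by simp
    qed
  qed
  define a b c d where "a = u pa" and "b = u pb" and "c = u pc" and "d = u pd"
  have abcd: "a < b" "b < c" "c < d" "a < n" "b < n" "c < n" "d < n"
    using ord by (auto simp: a_def b_def c_def d_def un)
  have pos: "inv' u a = pa" "inv' u b = pb" "inv' u c = pc" "inv' u d = pd"
    by (simp_all add: a_def b_def c_def d_def ui)
  define S1 where "S1 = prefix_set n u pd"
  define S2 where "S2 = insert d S1"
  define S3 where "S3 = insert a S2"
  have mem: "x \<in> S1 \<longleftrightarrow> x < n \<and> inv' u x < pd" for x by (simp add: S1_def prefix_set_def)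
  have posd: "inv' u x = pd \<longleftrightarrow> x = d" and posa: "inv' u x = pa \<longleftrightarrow> x = a" for x
    using ui(2)[of x] pos(1,4) unfolding a_def d_def by metis+
  have S2: "prefix_set n u (Suc pd) = S2"
  proof (rule Set.set_eqI)
    fix x show "x \<in> prefix_set n u (Suc pd) \<longleftrightarrow> x \<in> S2"
      using abcd(7) posd[of x] unfolding S2_def prefix_set_def by (simp add: mem less_Suc_eq) blast
  qed
  have S3: "prefix_set n u (Suc (Suc pd)) = S3"
  proof (rule Set.set_eqI)
    fix x
    have "inv' u x < Suc (Suc pd) \<longleftrightarrow> inv' u x < Suc pd \<or> x = a"
      using posa[of x] by (simp add: paS less_Suc_eq)
    then show "x \<in> prefix_set n u (Suc (Suc pd)) \<longleftrightarrow> x \<in> S3"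
      using abcd(4) unfolding S3_def S2[symmetric] prefix_set_def by blast
  qed
  have fin: "finite S1" by (simp add: S1_def finite_prefix_set)
  have card1: "card S1 = pd" using card_prefix_set[OF u, of pd] ord by (simp add: S1_def)
  have in1: "c \<in> S1" "a \<notin> S1" "b \<notin> S1" "d \<notin> S1" using abcd pos ord by (auto simp: mem)
  have card2: "card S2 = Suc pd" using fin in1 card1 by (simp add: S2_def)
  have card3: "card S3 = Suc (Suc pd)" using fin in1 card2 abcd by (simp add: S3_def S2_def)
  \<comment> \<open>\<open>R1\<close> exchanges c for a in the prefix before d, \<open>R3\<close>
    exchanges d for b in the prefix ending with a, and \<open>R2\<close> replaces c and d by a and b
    in the prefix ending with d. The prefixes themselves fill up the products so that both have the
    same weight.\<close>
  define R1 where "R1 = insert a (S1 - {c})"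
  define R2 where "R2 = insert b (insert a (S1 - {c}))"
  define R3 where "R3 = insert b (insert a S1)"
  have card: "card R1 = pd" "card R2 = Suc pd" "card R3 = Suc (Suc pd)"
  proof -
    show R1: "card R1 = pd" using card_exchange[OF fin in1(1,2)] card1 by (simp add: R1_def)
    show "card R2 = Suc pd" using R1 fin in1 abcd unfolding R2_def R1_def by simp
    show "card R3 = Suc (Suc pd)" using fin in1 abcd card1 by (simp add: R3_def)
  qed
  have apre: "j \<in> S1 - {c}" if "j < a" "block n I j = block n I a" for j
  proof -
    have "inv' u j < Suc pd" using inc[OF that(1) abcd(4) that(2)] pos paS by simp
    moreover have "inv' u j \<noteq> pd" using posd that abcd by auto
    ultimately show ?thesis using that abcd by (simp add: mem)
  qed
  \<comment> \<open>A later value of the block of c standing before d would give a tighter 3412 if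
    it is below d, and a 321 ending with d and a otherwise.\<close>
  have cmax: "j \<noteq> c" if i: "i \<in> S1" and j: "j < i" "block n I j = block n I i" for i j
  proof
    assume jc: "j = c"
    define r where "r = inv' u i"
    have r: "pc < r" "r < pd" "u r = i" "i < n"
      using inc[OF j(1) _ j(2)] i pos by (auto simp: mem jc r_def ui)
    have "i \<noteq> d" using i in1 by auto
    then consider "i < d" | "d < i" by linarith
    then show False
    proof cases
      case 1
      have "u pb < u r" using j(1) abcd(2) by (simp add: r(3) jc b_def)
      moreover have "u r < u pd" using 1 by (simp add: r(3) d_def)
      moreover have "pb - r + (pa - pd) < pb - pc + (pa - pd)" using r ord by linarith
      ultimately show False using min[of r pd pa pb] r(2) ord(2-5) by blast
    next
      case 2
      then show False using no321[of r pd pa] r ord abcd by (simp add: a_def b_def c_def d_def)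
    qed
  qed
  have bpre: "j = a \<or> j \<in> S1 - {c}" if j: "j < b" "block n I j = block n I b" for j
  proof -
    define r where "r = inv' u j"
    have r: "r < pb" "u r = j" using inc[OF j(1) abcd(5) j(2)] pos by (auto simp: r_def ui)
    consider "r < pd" | "r = pd" | "r = pa" | "pa < r" using paS by linarith
    then show ?thesis
    proof cases
      case 1 then show ?thesis using j abcd by (simp add: mem r_def)
    next
      case 2 then show ?thesis using posd[of j] j abcd by (simp add: r_def)
    next
      case 3 then show ?thesis using posa[of j] by (simp add: r_def)
    next
      case 4
      have "j \<noteq> a" using 4 pos by (auto simp: r_def)
      then consider "a < j" | "j < a" by linarith
      then show ?thesis
      proof cases
        case 1
        then have "u pa < u r" by (simp add: r a_def)
        moreover have "u r < u pc" using j(1) abcd(2) by (simp add: r c_def)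
        moreover have "r - pc + (pa - pd) < pb - pc + (pa - pd)" using r(1) 4 ord by linarith
        moreover have "r < n" using r(1) ord by linarith
        ultimately show ?thesis using min[of pc pd pa r] 4 ord(1,2,7) by blast
      next
        case 2
        then show ?thesis
          using no321[of pc pa r] 4 r ord j abcd by (simp add: a_def b_def c_def d_def)
      qed
    qed
  qed
  have init: "block_initial n I R1" "block_initial n I R2" "block_initial n I R3"
      "block_initial n I S1" "block_initial n I S2" "block_initial n I S3"
  proof -
    show S1: "block_initial n I S1" and "block_initial n I S2" "block_initial n I S3"
      unfolding S1_def S2[symmetric] S3[symmetric] by (rule block_initial_prefix[OF binc])+
    have T: "block_initial n I (S1 - {c})" by (rule block_initial_remove[OF S1]) (use cmax in metis)
    show R1: "block_initial n I R1"
      unfolding R1_def by (rule block_initial_insert[OF T abcd(4) apre])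
    show "block_initial n I R2" unfolding R2_def R1_def[symmetric]
      by (rule block_initial_insert[OF R1 abcd(5)]) (use bpre in \<open>auto simp: R1_def\<close>)
    have "block_initial n I (insert a S1)" by (rule block_initial_insert[OF S1 abcd(4)]) (use apre in auto)
    then show "block_initial n I R3" unfolding R3_def
      by (rule block_initial_insert[OF _ abcd(5)]) (use bpre in auto)
  qed
  define p where "p g = flag_minor n R2 g * flag_minor n S1 g * flag_minor n S3 g" for g
  define q where "q g = flag_minor n S2 g * flag_minor n R1 g * flag_minor n R3 g" for g
  have "common_weight n I p q"
    unfolding common_weight_def
  proof (intro conjI allI impI)
    show "pf n p" "pf n q" unfolding p_def q_def by (intro pf_mult pf_flag_minor)+
    fix M N assume MN: "levi_lower n I M" "N \<in> upper_borel n"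
    let ?S = "\<Prod>r\<in>S1. M $$ (r, r)" and ?S' = "\<Prod>r\<in>S1 - {c}. M $$ (r, r)"
    let ?w = "M $$ (a, a) * M $$ (a, a) * M $$ (b, b) * M $$ (d, d) * ?S' * ?S * ?S *
      (\<Prod>j<pd. N $$ (j, j)) * (\<Prod>j<Suc pd. N $$ (j, j)) * (\<Prod>j<Suc (Suc pd). N $$ (j, j))"
    have prods: "(\<Prod>r\<in>R1. M $$ (r, r)) = M $$ (a, a) * ?S'"
      "(\<Prod>r\<in>R2. M $$ (r, r)) = M $$ (b, b) * (M $$ (a, a) * ?S')"
      "(\<Prod>r\<in>R3. M $$ (r, r)) = M $$ (b, b) * (M $$ (a, a) * ?S)"
      "(\<Prod>r\<in>S2. M $$ (r, r)) = M $$ (d, d) * ?S"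
      "(\<Prod>r\<in>S3. M $$ (r, r)) = M $$ (a, a) * (M $$ (d, d) * ?S)"
      using fin in1 abcd by (simp_all add: R1_def R2_def R3_def S2_def S3_def)
    show "\<exists>w. \<forall>g\<in>carrier_mat n n. p (M * g * N) = w * p g \<and> q (M * g * N) = w * q g"
    proof (intro exI[of _ ?w] ballI)
      fix g :: "complex mat" assume g: "g \<in> carrier_mat n n"
      note semi = flag_minor_semi_card[OF _ MN g]
      show "p (M * g * N) = ?w * p g \<and> q (M * g * N) = ?w * q g"
        unfolding p_def q_def semi[OF init(1) card(1)] semi[OF init(2) card(2)] semi[OF init(3) card(3)]
          semi[OF init(4) card1] semi[OF init(5) card2] semi[OF init(6) card3] prods
        by (simp add: ac_simps)
    qed
  qed
  moreover
  have blk: "block n I i < block n I j" if "i < j" "j < n" "inv' u j < inv' u i" for i j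
    using inc[OF that(1,2)] block_mono[of i j n I] that by (cases "block n I i = block n I j") auto
  have bl: "block n I a < block n I c" "block n I b < block n I c" "block n I a < block n I d" "block n I b < block n I d"
    using blk[of a c] blk[of b c] blk[of a d] blk[of b d] abcd pos ord by auto
  \<comment> \<open>The two ways of sending c and d to a and b. The minor of \<open>R2\<close> is
    nonzero for \<open>f2\<close>, but that of \<open>R1\<close> requires c to go to a; hence q
    vanishes for \<open>f2\<close> and not for \<open>f1\<close>.\<close>
  define f1 where "f1 s = (if s = c then a else if s = d then b else s)" for s
  define f2 where "f2 s = (if s = c then b else if s = d then a else s)" for s
  have f1: "\<forall>s<n. f1 s < n" "block_lowering n I f1"
    using abcd bl by (auto simp: f1_def block_lowering_def)
  have f2: "\<forall>s<n. f2 s < n" "block_lowering n I f2"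
    using abcd bl by (auto simp: f2_def block_lowering_def)
  have Rn: "R1 \<subseteq> {..<n}" "R2 \<subseteq> {..<n}" "R3 \<subseteq> {..<n}" "S1 \<subseteq> {..<n}" "S2 \<subseteq> {..<n}" "S3 \<subseteq> {..<n}"
    using init by (auto simp: block_initial_def)
  have pre: "prefix_set n u (card R1) = S1" "prefix_set n u (card R2) = S2" "prefix_set n u (card R3) = S3"
    "prefix_set n u (card S1) = S1" "prefix_set n u (card S2) = S2" "prefix_set n u (card S3) = S3"
    by (simp_all only: card card1 card2 card3 S2 S3) (simp_all only: S1_def)
  have f1v: "f1 c = a" "f1 d = b" "\<And>s. s \<noteq> c \<Longrightarrow> s \<noteq> d \<Longrightarrow> f1 s = s" using abcd by (auto simp: f1_def)
  have f2v: "f2 c = b" "f2 d = a" "\<And>s. s \<noteq> c \<Longrightarrow> s \<noteq> d \<Longrightarrow> f2 s = s" using abcd by (auto simp: f2_def)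
  have q1: "flag_minor n S2 (unit_shift n f1 * pmat n u) \<noteq> 0"
  proof (rule flag_minor_nonzeroI[OF u f1(1) Rn(5)], unfold pre)
    fix y :: "nat \<Rightarrow> complex" and i
    assume y0: "\<And>r. r < n \<Longrightarrow> r \<notin> S2 \<Longrightarrow> y r = 0" and i: "i < n"
      and ys: "\<And>s. s \<in> S2 \<Longrightarrow> y s + (if f1 s = s then 0 else y (f1 s)) = 0"
    have "y a = 0" "y b = 0" using y0[of a] y0[of b] abcd in1 by (auto simp: S2_def)
    then have "y s = 0" if "s \<in> S2" for s
      using ys[OF that] by (auto simp: f1_def split: if_splits)
    then show "y i = 0" using y0[OF i] by blast
  qed
  have q2: "flag_minor n R1 (unit_shift n f1 * pmat n u) \<noteq> 0"
  proof (rule flag_minor_nonzeroI[OF u f1(1) Rn(1)], unfold pre)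
    fix y :: "nat \<Rightarrow> complex" and i
    assume y0: "\<And>r. r < n \<Longrightarrow> r \<notin> R1 \<Longrightarrow> y r = 0" and i: "i < n"
      and ys: "\<And>s. s \<in> S1 \<Longrightarrow> y s + (if f1 s = s then 0 else y (f1 s)) = 0"
    have "y c = 0" using y0[of c] abcd by (simp add: R1_def)
    then have "y a = 0" using ys[OF in1(1)] abcd by (simp add: f1v)
    moreover have "y s = 0" if "s \<in> S1" "s \<noteq> c" for s
      using ys[OF that(1)] f1v(3)[of s] that in1 by (cases "s = d") auto
    ultimately show "y i = 0" using y0[OF i] by (auto simp: R1_def)
  qed
  have q3: "flag_minor n R3 (unit_shift n f1 * pmat n u) \<noteq> 0"
  proof (rule flag_minor_nonzeroI[OF u f1(1) Rn(3)], unfold pre)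
    fix y :: "nat \<Rightarrow> complex" and i
    assume y0: "\<And>r. r < n \<Longrightarrow> r \<notin> R3 \<Longrightarrow> y r = 0" and i: "i < n"
      and ys: "\<And>s. s \<in> S3 \<Longrightarrow> y s + (if f1 s = s then 0 else y (f1 s)) = 0"
    have "y d = 0" using y0[of d] abcd in1 by (simp add: R3_def)
    then have yb: "y b = 0" using ys[of d] abcd by (simp add: f1v S3_def S2_def)
    have ya: "y a = 0" using ys[of a] abcd f1v(3)[of a] by (simp add: S3_def)
    then have yc: "y c = 0" using ys[of c] abcd in1 by (simp add: f1v S3_def S2_def)
    moreover have "y s = 0" if "s \<in> S1" "s \<noteq> c" for s
      using ys[of s] f1v(3)[of s] that in1 by (cases "s = d") (auto simp: S3_def S2_def)
    ultimately show "y i = 0" using y0[OF i] ya yb by (auto simp: R3_def)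
  qed
  have q4: "flag_minor n R1 (unit_shift n f2 * pmat n u) = 0"
  proof (rule flag_minor_zeroI[OF u f2(1) Rn(1), where y = "\<lambda>r. if r = a then 1 else 0" and i = a], unfold pre)
    fix s assume "s \<in> S1"
    then show "(if s = a then 1 else 0) + (if f2 s = s then 0 else if f2 s = a then 1 else 0) = (0 :: complex)"
      using in1 abcd by (auto simp: f2_def)
  qed (use abcd in \<open>auto simp: R1_def\<close>)
  have p1: "flag_minor n R2 (unit_shift n f2 * pmat n u) \<noteq> 0"
  proof (rule flag_minor_nonzeroI[OF u f2(1) Rn(2)], unfold pre)
    fix y :: "nat \<Rightarrow> complex" and i
    assume y0: "\<And>r. r < n \<Longrightarrow> r \<notin> R2 \<Longrightarrow> y r = 0" and i: "i < n"
      and ys: "\<And>s. s \<in> S2 \<Longrightarrow> y s + (if f2 s = s then 0 else y (f2 s)) = 0"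
    have "y d = 0" "y c = 0" using y0[of d] y0[of c] abcd in1 by (auto simp: R2_def)
    then have yab: "y a = 0" "y b = 0" using ys[of d] ys[of c] abcd in1 by (auto simp: f2v S2_def)
    have "y s = 0" if "s \<in> S1" "s \<noteq> c" for s
      using ys[of s] f2v(3)[of s] that in1 by (cases "s = d") (auto simp: S2_def)
    then show "y i = 0" using y0[OF i] yab by (auto simp: R2_def)
  qed
  have p2: "flag_minor n S1 (unit_shift n f2 * pmat n u) \<noteq> 0"
  proof (rule flag_minor_nonzeroI[OF u f2(1) Rn(4)], unfold pre)
    fix y :: "nat \<Rightarrow> complex" and i
    assume y0: "\<And>r. r < n \<Longrightarrow> r \<notin> S1 \<Longrightarrow> y r = 0" and i: "i < n"
      and ys: "\<And>s. s \<in> S1 \<Longrightarrow> y s + (if f2 s = s then 0 else y (f2 s)) = 0"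
    have "y a = 0" "y b = 0" using y0[of a] y0[of b] abcd in1 by auto
    then have "y s = 0" if "s \<in> S1" for s
      using ys[OF that] by (auto simp: f2_def split: if_splits)
    then show "y i = 0" using y0[OF i] by blast
  qed
  have p3: "flag_minor n S3 (unit_shift n f2 * pmat n u) \<noteq> 0"
  proof (rule flag_minor_nonzeroI[OF u f2(1) Rn(6)], unfold pre)
    fix y :: "nat \<Rightarrow> complex" and i
    assume y0: "\<And>r. r < n \<Longrightarrow> r \<notin> S3 \<Longrightarrow> y r = 0" and i: "i < n"
      and ys: "\<And>s. s \<in> S3 \<Longrightarrow> y s + (if f2 s = s then 0 else y (f2 s)) = 0"
    have yb: "y b = 0" using y0[of b] abcd in1 by (auto simp: S3_def S2_def)
    have ya: "y a = 0" using ys[of a] abcd f2v(3)[of a] by (simp add: S3_def)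
    have "y s = 0" if "s \<in> S3" for s
      using ys[OF that] ya yb by (auto simp: f2_def split: if_splits)
    then show "y i = 0" using y0[OF i] by blast
  qed
  have "q (unit_shift n f1 * pmat n u) \<noteq> 0" "q (unit_shift n f2 * pmat n u) = 0"
    "p (unit_shift n f2 * pmat n u) \<noteq> 0"
    unfolding p_def q_def using q1 q2 q3 q4 p1 p2 p3 by simp_all
  ultimately show ?thesis using that f1(2) f2(2) by blast
qed


subsection \<open>A dense torus orbit for products of distinct simple transpositions\<close>

definition diag_mat_of :: "nat \<Rightarrow> (nat \<Rightarrow> complex) \<Rightarrow> complex mat" where
  "diag_mat_of n t = mat n n (\<lambda>(i, j). if i = j then t i else 0)"

definition elem_mat :: "nat \<Rightarrow> nat \<Rightarrow> complex \<Rightarrow> complex mat" where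
  "elem_mat n i c = mat n n (\<lambda>(p, q). if p = q then 1 else if Suc p = i \<and> q = i then c else 0)"

text \<open>The product of \<open>elem_mat n i c\<close> and the permutation matrix of the \<open>i\<close>-th simple transposition.\<close>

definition step_mat :: "nat \<Rightarrow> nat \<Rightarrow> complex \<Rightarrow> complex mat" where
  "step_mat n i c = mat n n (\<lambda>(p, q). if Suc p = i \<and> Suc q = i then c
     else if Suc p = i \<and> q = i \<or> p = i \<and> Suc q = i then 1
     else if p = q \<and> p \<noteq> i then 1 else 0)"

fun word_mat :: "nat \<Rightarrow> (nat \<times> complex) list \<Rightarrow> complex mat" where
  "word_mat n [] = 1\<^sub>m n"
| "word_mat n ((i, c) # ps) = step_mat n i c * word_mat n ps"

lemma diag_mat_of_carrier: "diag_mat_of n t \<in> carrier_mat n n"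
  and elem_mat_carrier: "elem_mat n i c \<in> carrier_mat n n"
  and step_mat_carrier: "step_mat n i c \<in> carrier_mat n n"
  by (simp_all add: diag_mat_of_def elem_mat_def step_mat_def)

lemma word_mat_carrier: "word_mat n ps \<in> carrier_mat n n"
  by (induction ps rule: word_mat.induct) (auto intro: mult_carrier_mat[OF step_mat_carrier])

lemmas sq_simps = mat_assoc mult_carrier_sq

lemmas carrier_simps = pmat_carrier perm_conj_carrier diag_mat_of_carrier elem_mat_carrier
  step_mat_carrier word_mat_carrier

lemma diag_mult_entry:
  assumes "A \<in> carrier_mat n n" "i < n" "j < n"
  shows "(diag_mat_of n t * A) $$ (i, j) = t i * A $$ (i, j)"
proof -
  have "(diag_mat_of n t * A) $$ (i, j) = (\<Sum>l<n. if l = i then t i * A $$ (l, j) else 0)"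
    unfolding mat_mult_entry[OF diag_mat_of_carrier assms] using assms
    by (intro sum.cong) (auto simp: diag_mat_of_def)
  then show ?thesis using assms by simp
qed

lemma mult_diag_entry:
  assumes "A \<in> carrier_mat n n" "i < n" "j < n"
  shows "(A * diag_mat_of n t) $$ (i, j) = A $$ (i, j) * t j"
proof -
  have "(A * diag_mat_of n t) $$ (i, j) = (\<Sum>l<n. if l = j then A $$ (i, l) * t j else 0)"
    unfolding mat_mult_entry[OF assms(1) diag_mat_of_carrier assms(2,3)] using assms
    by (intro sum.cong) (auto simp: diag_mat_of_def)
  then show ?thesis using assms by simp
qed

lemma diag_mat_of_mult: "diag_mat_of n s * diag_mat_of n t = diag_mat_of n (\<lambda>i. s i * t i)"
proof (rule eq_matI)
  fix i j assume "i < dim_row (diag_mat_of n (\<lambda>i. s i * t i))" "j < dim_col (diag_mat_of n (\<lambda>i. s i * t i))"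
  then have ij: "i < n" "j < n" by (auto simp: diag_mat_of_def)
  show "(diag_mat_of n s * diag_mat_of n t) $$ (i, j) = diag_mat_of n (\<lambda>i. s i * t i) $$ (i, j)"
    unfolding diag_mult_entry[OF diag_mat_of_carrier ij] using ij by (simp add: diag_mat_of_def)
qed (auto simp: diag_mat_of_def)

lemma diag_mat_of_one: "diag_mat_of n (\<lambda>i. 1) = 1\<^sub>m n"
  by (rule eq_matI) (auto simp: diag_mat_of_def)

lemma diag_mat_of_levi_borel:
  assumes "\<And>i. t i \<noteq> 0"
  shows "diag_mat_of n t \<in> levi_borel n I"
proof -
  have up: "upper_triangular (diag_mat_of n t)" by (rule upper_triangularI) (auto simp: diag_mat_of_def)
  have "det (diag_mat_of n t) \<noteq> 0"
    using upper_triangular_imp_det_eq_0_iff[OF diag_mat_of_carrier up] assms by (auto simp: diag_mat_def diag_mat_of_def)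
  then show ?thesis
    by (auto simp: levi_borel_iff carrier_GL diag_mat_of_carrier) (auto simp: diag_mat_of_def)
qed

lemma diag_mat_of_upper_borel: "(\<And>i. t i \<noteq> 0) \<Longrightarrow> diag_mat_of n t \<in> upper_borel n"
  using diag_mat_of_levi_borel[of t n "{}"] by (simp add: levi_borel_def)

lemma elem_mat_upper_borel:
  shows "elem_mat n i c \<in> upper_borel n"
proof -
  have up: "upper_triangular (elem_mat n i c)" by (rule upper_triangularI) (auto simp: elem_mat_def)
  have "det (elem_mat n i c) \<noteq> 0"
    using upper_triangular_imp_det_eq_0_iff[OF elem_mat_carrier up] by (auto simp: diag_mat_def elem_mat_def)
  then show ?thesis using up by (simp add: upper_borel_iff carrier_GL elem_mat_carrier)
qed

section \<open>Simple transpositions and Bruhat double cosets\<close>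

lemma shift_simple_transposition:
  assumes "1 \<le> i"
  shows "shift (simple_transposition i) p = (if Suc p = i then i else if p = i then i - 1 else p)"
  using assms by (auto simp: shift_def simple_transposition_apply)

lemma step_mat_elem:
  assumes "i \<in> {1..<n}"
  shows "step_mat n i c = elem_mat n i c * pmat n (shift (simple_transposition i))"
proof (rule eq_matI)
  fix p q assume "p < dim_row (elem_mat n i c * pmat n (shift (simple_transposition i)))"
    "q < dim_col (elem_mat n i c * pmat n (shift (simple_transposition i)))"
  then have pq: "p < n" "q < n" by (auto simp: elem_mat_def pmat_def)
  have "(elem_mat n i c * pmat n (shift (simple_transposition i))) $$ (p, q) =
      elem_mat n i c $$ (p, shift (simple_transposition i) q)"
    by (rule mult_pmat_entry[OF shift_permutes[OF simple_transposition_permutes[OF assms]] elem_mat_carrier pq])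
  also have "\<dots> = step_mat n i c $$ (p, q)"
    using assms pq by (auto simp: shift_simple_transposition elem_mat_def step_mat_def)
  finally show "step_mat n i c $$ (p, q) =
      (elem_mat n i c * pmat n (shift (simple_transposition i))) $$ (p, q)" by simp
qed (auto simp: step_mat_def elem_mat_def pmat_def)

text \<open>Conjugation by the i-th simple transposition moves only the position (i - 1, i) from
  above the diagonal to below it, and the entry there is assumed to vanish.\<close>

lemma perm_conj_simple_upper:
  assumes i: "i \<in> {1..<n}" and b: "b \<in> upper_borel n" "b $$ (i - 1, i) = 0"
  shows "perm_conj n (shift (simple_transposition i)) b \<in> upper_borel n"
  unfolding upper_borel_iff
proof (intro conjI upper_triangularI)
  let ?t = "shift (simple_transposition i)"
  show "perm_conj n ?t b \<in> carrier (GL n)"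
    using perm_conj_GL[OF shift_permutes[OF simple_transposition_permutes[OF i]] upper_borel_GL[OF b(1)]] .
  fix p q assume pq: "q < p" "p < dim_row (perm_conj n ?t b)"
  then have pqn: "p < n" "q < n" by (auto simp: perm_conj_def)
  have up: "b $$ (r, s) = 0" if "s < r" "r < n" for r s
    using b(1) upper_borel_carrier[OF b(1)] that upper_triangularD[of b s r] by (simp add: upper_borel_iff)
  show "perm_conj n ?t b $$ (p, q) = 0"
  proof (cases "p = i \<and> Suc q = i")
    case True
    then show ?thesis using pqn i b(2) by (auto simp: perm_conj_def shift_simple_transposition)
  next
    case False
    then have "?t q < ?t p" "?t p < n" using pq pqn i by (auto simp: shift_simple_transposition)
    then show ?thesis using pqn up by (simp add: perm_conj_def)
  qed
qed

lemma simple_transposition_pmat_upper: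
  assumes i: "i \<in> {1..<n}" and b: "b \<in> upper_borel n" "b $$ (i - 1, i) = 0"
  shows "pmat n (shift (simple_transposition i)) * b =
    perm_conj n (shift (simple_transposition i)) b * pmat n (shift (simple_transposition i))"
proof -
  let ?t = "shift (simple_transposition i)"
  have t: "?t permutes {..<n}" by (rule shift_permutes[OF simple_transposition_permutes[OF i]])
  have tt: "?t (?t p) = p" for p using i by (auto simp: shift_simple_transposition)
  have bc: "b \<in> carrier_mat n n" by (rule upper_borel_carrier[OF b(1)])
  have tn: "?t p < n" if "p < n" for p using permutes_in_image[OF t, of p] that by simp
  have "perm_conj n ?t (perm_conj n ?t b) = b"
  proof (rule eq_matI)
    fix p q assume "p < dim_row b" "q < dim_col b"
    then have pq: "p < n" "q < n" using bc by auto
    show "perm_conj n ?t (perm_conj n ?t b) $$ (p, q) = b $$ (p, q)"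
      unfolding perm_conj_def using pq tn by (simp add: tt)
  qed (use bc in \<open>simp_all add: perm_conj_def\<close>)
  then show ?thesis unfolding mult_pmat[OF t perm_conj_carrier[of n ?t b]] by (simp only:)
qed

text \<open>Write b as \<open>b1\<close> times an elementary matrix so that \<open>b1\<close> has
  entry 0 at (i - 1, i). Then \<open>b1\<close> passes the transposition to its left, and the
  elementary matrix passes u to its right because u has an ascent there.\<close>

lemma step_mat_dcoset:
  assumes i: "i \<in> {1..<n}" and u: "u permutes {..<n}" "inv' u (i - 1) < inv' u i"
    and A: "A \<in> dcoset n u"
  shows "step_mat n i c * A \<in> dcoset n (shift (simple_transposition i) \<circ> u)"
proof -
  let ?t = "shift (simple_transposition i)"
  have t: "?t permutes {..<n}" by (rule shift_permutes[OF simple_transposition_permutes[OF i]])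
  obtain b b' where b: "b \<in> upper_borel n" "b' \<in> upper_borel n" "A = b * pmat n u * b'"
    using A unfolding dcoset_def by blast
  have i': "i - 1 < n" "i < n" "Suc (i - 1) = i" using i by auto
  have bc: "b \<in> carrier_mat n n" "b' \<in> carrier_mat n n" using b upper_borel_carrier by auto
  have brr: "b $$ (i - 1, i - 1) \<noteq> 0"
    using upper_triangular_diag_nonzero[of b n "i - 1"] b(1) i' by (simp add: upper_borel_iff)
  define a where "a = b $$ (i - 1, i) / b $$ (i - 1, i - 1)"
  let ?x = "elem_mat n i a"
  define b1 where "b1 = b * elem_mat n i (- a)"
  have b1B: "b1 \<in> upper_borel n" unfolding b1_def by (intro upper_borel_mult b(1) elem_mat_upper_borel)
  have ee: "elem_mat n i (- a) * ?x = 1\<^sub>m n"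
  proof (rule eq_matI)
    fix p q assume "p < dim_row (1\<^sub>m n :: complex mat)" "q < dim_col (1\<^sub>m n :: complex mat)"
    then have pq: "p < n" "q < n" by auto
    have "(elem_mat n i (- a) * ?x) $$ (p, q) = (\<Sum>l<n. (if l = p then ?x $$ (p, q) else 0) +
        (if l = i then if Suc p = i then - a * ?x $$ (i, q) else 0 else 0))"
      unfolding mat_mult_entry[OF elem_mat_carrier elem_mat_carrier pq]
      using pq i' by (intro sum.cong) (auto simp: elem_mat_def)
    then show "(elem_mat n i (- a) * ?x) $$ (p, q) = 1\<^sub>m n $$ (p, q)"
      using pq i' by (auto simp: sum.distrib elem_mat_def)
  qed (auto simp: elem_mat_def)
  have bx: "b = b1 * ?x"
    using bc ee by (simp add: b1_def sq_simps[where n = n] carrier_simps)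
  have "b1 $$ (i - 1, i) = (\<Sum>l<n. b $$ (i - 1, l) * elem_mat n i (- a) $$ (l, i))"
    unfolding b1_def by (rule mat_mult_entry[OF bc(1) elem_mat_carrier i'(1,2)])
  also have "\<dots> = (\<Sum>l<n. (if l = i then b $$ (i - 1, i) else 0) + (if l = i - 1 then b $$ (i - 1, i - 1) * (- a) else 0))"
    using i by (intro sum.cong) (auto simp: elem_mat_def)
  also have "\<dots> = 0" using i' brr by (simp add: sum.distrib a_def)
  finally have b10: "b1 $$ (i - 1, i) = 0" .
  have xB: "perm_conj n u ?x \<in> upper_borel n"
    unfolding upper_borel_iff
  proof (intro conjI upper_triangularI)
    show "perm_conj n u ?x \<in> carrier (GL n)"
      using perm_conj_GL[OF u(1) upper_borel_GL[OF elem_mat_upper_borel]] .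
    fix p q assume pq: "q < p" "p < dim_row (perm_conj n u ?x)"
    then have pqn: "p < n" "q < n" by (auto simp: perm_conj_def)
    have un: "u p < n" "u q < n" "u p \<noteq> u q"
      using pqn pq permutes_in_image[OF u(1)] permutes_inj[OF u(1)] by (auto simp: inj_eq)
    have "\<not> (Suc (u p) = i \<and> u q = i)"
    proof
      assume *: "Suc (u p) = i \<and> u q = i"
      then have "u p = i - 1" by auto
      then have "p = inv' u (i - 1)" "q = inv' u i" using permutes_inverses(2)[OF u(1)] * by metis+
      then show False using u(2) pq by simp
    qed
    then show "perm_conj n u ?x $$ (p, q) = 0" using un pqn by (auto simp: perm_conj_def elem_mat_def)
  qed
  have "step_mat n i c * A = elem_mat n i c * (pmat n ?t * b1) * (?x * pmat n u) * b'"
    unfolding step_mat_elem[OF i] b(3) using bx bc upper_borel_carrier[OF b1B]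
    by (simp add: sq_simps[where n = n] carrier_simps)
  also have "\<dots> = elem_mat n i c * perm_conj n ?t b1 * (pmat n ?t * pmat n u) * (perm_conj n u ?x * b')"
    unfolding simple_transposition_pmat_upper[OF i b1B b10] mult_pmat[OF u(1) elem_mat_carrier]
    using bc by (simp add: sq_simps[where n = n] carrier_simps)
  finally show ?thesis
    unfolding pmat_comp[OF t u(1)]
    by (simp add: dcosetI[OF upper_borel_mult[OF elem_mat_upper_borel perm_conj_simple_upper[OF i b1B b10]]
          upper_borel_mult[OF xB b(2)]])
qed

lemma shift_word_product_Cons:
  assumes "set (i # is) \<subseteq> {1..<n}"
  shows "shift (word_product n (i # is)) = shift (simple_transposition i) \<circ> shift (word_product n is)"
  unfolding word_product_Cons using assms by (intro shift_comp[OF word_product_permutes]) auto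

text \<open>Each new letter on the left does not occur in the rest of the word, so the rest has an
  ascent there and the double cosets multiply.\<close>

lemma word_mat_dcoset:
  assumes "distinct (map fst ps)" "fst ` set ps \<subseteq> {1..<n}"
  shows "word_mat n ps \<in> dcoset n (shift (word_product n (map fst ps)))"
  using assms
proof (induction ps)
  case Nil
  have "1\<^sub>m n * pmat n id * 1\<^sub>m n \<in> dcoset n id" by (intro dcosetI upper_borel_one)
  moreover have "shift (word_product n (map fst ([] :: (nat \<times> complex) list))) = id"
    by (simp only: list.map word_product_Nil shift_id)
  ultimately show ?case by (simp add: pmat_id del: id_apply)
next
  case (Cons x ps)
  obtain i c where x: "x = (i, c)" by (cases x)
  let ?ws = "map fst ps"
  let ?v = "word_product n ?ws"
  have i: "i \<in> {1..<n}" and ws: "set ?ws \<subseteq> {1..<n}" and ni: "i \<notin> set ?ws" using Cons.prems x by auto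
  have v: "?v permutes {1..n}" by (rule word_product_permutes[OF ws])
  have vi: "?v (inv' ?v a) = a" for a using permutes_inverses(1)[OF v] .
  have "inv' ?v i \<le> i" "\<not> inv' ?v (Suc i) \<le> i"
    using word_product_le_iff[OF ni, of n "inv' ?v i"] word_product_le_iff[OF ni, of n "inv' ?v (Suc i)"] vi by auto
  then have lt: "inv' ?v i < inv' ?v (Suc i)" by simp
  have "inv' (shift ?v) (i - 1) < inv' (shift ?v) i"
    unfolding shift_inv[OF v, symmetric] shift_def
    using lt i permutes_pos[OF permutes_inv[OF v], of "i - 1"] by simp
  then have "step_mat n i c * word_mat n ps \<in> dcoset n (shift (simple_transposition i) \<circ> shift ?v)"
    using Cons x by (intro step_mat_dcoset[OF i shift_permutes[OF v]]) auto
  moreover have "shift (word_product n (map fst (x # ps))) = shift (simple_transposition i) \<circ> shift ?v"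
    using shift_word_product_Cons[of i ?ws n] i ws by (simp add: x)
  ultimately show ?case by (simp only: x word_mat.simps)
qed

text \<open>The letters are taken off from the left: an elementary matrix with coordinate c is split
  off b so that the rest has entry 0 at (i - 1, i) and passes the transposition. The triangular
  matrix left at the end is the factor on the right.\<close>

lemma dcoset_word_mat:
  assumes "set is \<subseteq> {1..<n}" "A \<in> dcoset n (shift (word_product n is))"
  shows "\<exists>ps b. map fst ps = is \<and> b \<in> upper_borel n \<and> A = word_mat n ps * b"
  using assms
proof (induction "is" arbitrary: A)
  case Nil
  have "shift (word_product n []) = id" by (simp only: word_product_Nil shift_id)
  then have "A \<in> dcoset n id" using Nil.prems(2) by (simp only:)
  then obtain b b' where b: "b \<in> upper_borel n" "b' \<in> upper_borel n" "A = b * pmat n id * b'"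
    unfolding dcoset_def by blast
  have c: "b \<in> carrier_mat n n" "b' \<in> carrier_mat n n" using b upper_borel_carrier by auto
  have "A = word_mat n [] * (b * b')"
    unfolding b(3) pmat_id using c by (simp add: mult_carrier_sq[of _ n])
  then show ?case using upper_borel_mult[OF b(1,2)] by (intro exI[of _ "[]"]) auto
next
  case (Cons i "is")
  let ?t = "shift (simple_transposition i)" and ?u = "shift (word_product n is)"
  have i: "i \<in> {1..<n}" and ws: "set is \<subseteq> {1..<n}" using Cons.prems by auto
  have t: "?t permutes {..<n}" by (rule shift_permutes[OF simple_transposition_permutes[OF i]])
  have u: "?u permutes {..<n}" by (rule shift_permutes[OF word_product_permutes[OF ws]])
  have "A \<in> dcoset n (?t \<circ> ?u)" using Cons.prems(2) shift_word_product_Cons[OF Cons.prems(1)] by (simp only:)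
  then obtain b b' where b: "b \<in> upper_borel n" "b' \<in> upper_borel n" "A = b * pmat n (?t \<circ> ?u) * b'"
    unfolding dcoset_def by blast
  have i': "i - 1 < n" "i < n" "Suc (i - 1) = i" using i by auto
  have bc: "b \<in> carrier_mat n n" "b' \<in> carrier_mat n n" using b upper_borel_carrier by auto
  have bii: "b $$ (i, i) \<noteq> 0"
    using upper_triangular_diag_nonzero[of b n i] b(1) i' by (simp add: upper_borel_iff)
  define c where "c = b $$ (i - 1, i) / b $$ (i, i)"
  let ?x = "elem_mat n i c"
  define b1 where "b1 = elem_mat n i (- c) * b"
  have b1B: "b1 \<in> upper_borel n" unfolding b1_def by (intro upper_borel_mult b(1) elem_mat_upper_borel)
  have ee: "?x * elem_mat n i (- c) = 1\<^sub>m n"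
  proof (rule eq_matI)
    fix p q assume "p < dim_row (1\<^sub>m n :: complex mat)" "q < dim_col (1\<^sub>m n :: complex mat)"
    then have pq: "p < n" "q < n" by auto
    have "(?x * elem_mat n i (- c)) $$ (p, q) = (\<Sum>l<n. (if l = p then elem_mat n i (- c) $$ (p, q) else 0) +
        (if l = i then if Suc p = i then c * elem_mat n i (- c) $$ (i, q) else 0 else 0))"
      unfolding mat_mult_entry[OF elem_mat_carrier elem_mat_carrier pq]
      using pq i' by (intro sum.cong) (auto simp: elem_mat_def)
    then show "(?x * elem_mat n i (- c)) $$ (p, q) = 1\<^sub>m n $$ (p, q)"
      using pq i' by (auto simp: sum.distrib elem_mat_def)
  qed (auto simp: elem_mat_def)
  have "?x * b1 = ?x * elem_mat n i (- c) * b"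
    unfolding b1_def using bc by (simp add: sq_simps[where n = n] carrier_simps)
  then have bx: "b = ?x * b1" using ee bc by simp
  have "b1 $$ (i - 1, i) = (\<Sum>l<n. elem_mat n i (- c) $$ (i - 1, l) * b $$ (l, i))"
    unfolding b1_def by (rule mat_mult_entry[OF elem_mat_carrier bc(1) i'(1,2)])
  also have "\<dots> = (\<Sum>l<n. (if l = i - 1 then b $$ (i - 1, i) else 0) + (if l = i then (- c) * b $$ (i, i) else 0))"
    using i by (intro sum.cong) (auto simp: elem_mat_def)
  also have "\<dots> = 0" using i' bii by (simp add: sum.distrib c_def)
  finally have b10: "b1 $$ (i - 1, i) = 0" .
  let ?b2 = "perm_conj n ?t b1"
  have b2: "?b2 \<in> upper_borel n" by (rule perm_conj_simple_upper[OF i b1B b10])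
  have "?b2 * pmat n ?u * b' \<in> dcoset n ?u" by (rule dcosetI[OF b2 b(2)])
  then obtain ps d where ps: "map fst ps = is" "d \<in> upper_borel n" "?b2 * pmat n ?u * b' = word_mat n ps * d"
    using Cons.IH[OF ws] by blast
  have "A = ?x * (b1 * pmat n ?t) * pmat n ?u * b'"
    unfolding b(3) pmat_comp[OF t u, symmetric] using bx bc upper_borel_carrier[OF b1B]
    by (simp add: sq_simps[where n = n] carrier_simps)
  also have "\<dots> = step_mat n i c * (?b2 * pmat n ?u * b')"
    unfolding mult_pmat[OF t upper_borel_carrier[OF b1B]] step_mat_elem[OF i] using bc
    by (simp add: sq_simps[where n = n] carrier_simps)
  also have "\<dots> = word_mat n ((i, c) # ps) * d"
    unfolding ps(3) using upper_borel_carrier[OF ps(2)] by (simp add: sq_simps[where n = n] carrier_simps)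
  finally show ?case using ps(1,2) by (intro exI[of _ "(i, c) # ps"] exI[of _ d]) simp
qed

text \<open>A step with letter j mixes only the indices j - 1 and j. For j different from i they lie
  on the same side of i, where the diagonal matrix is scalar.\<close>

lemma diag_commute_word_mat:
  fixes n :: nat and l :: complex
  assumes "i \<notin> fst ` set ps"
  defines "D \<equiv> diag_mat_of n (\<lambda>j. if j < i then l else 1)"
  shows "D * word_mat n ps = word_mat n ps * D"
  using assms(1)
proof (induction ps)
  case Nil
  then show ?case by (simp add: D_def left_mult_one_mat[OF diag_mat_of_carrier] right_mult_one_mat[OF diag_mat_of_carrier])
next
  case (Cons x ps)
  obtain j c where x: "x = (j, c)" by (cases x)
  have ji: "j \<noteq> i" using Cons.prems x by auto
  have Dc: "D \<in> carrier_mat n n" by (simp add: D_def diag_mat_of_carrier)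
  have comm: "D * step_mat n j c = step_mat n j c * D"
  proof (rule eq_matI)
    fix p q assume "p < dim_row (step_mat n j c * D)" "q < dim_col (step_mat n j c * D)"
    then have pq: "p < n" "q < n" by (auto simp: D_def step_mat_def diag_mat_of_def)
    show "(D * step_mat n j c) $$ (p, q) = (step_mat n j c * D) $$ (p, q)"
      unfolding D_def diag_mult_entry[OF step_mat_carrier pq] mult_diag_entry[OF step_mat_carrier pq]
      using pq ji by (auto simp: step_mat_def)
  qed (auto simp: D_def step_mat_def diag_mat_of_def)
  have IH: "D * word_mat n ps = word_mat n ps * D" using Cons by simp
  have "D * word_mat n (x # ps) = D * step_mat n j c * word_mat n ps"
    using Dc by (simp add: x sq_simps[where n = n] carrier_simps)
  also have "\<dots> = step_mat n j c * (D * word_mat n ps)"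
    unfolding comm using Dc by (simp add: sq_simps[where n = n] carrier_simps)
  also have "\<dots> = word_mat n (x # ps) * D"
    unfolding IH using Dc by (simp add: x sq_simps[where n = n] carrier_simps)
  finally show ?case .
qed

text \<open>
  Since the letters are distinct, a coordinate can be rescaled without disturbing the coordinates to
  the right of it, by a torus element that is constant on the first \<open>i\<close> and on the remaining indices.
\<close>

lemma torus_scales_word_mat:
  assumes "distinct (map fst ps)" "fst ` set ps \<subseteq> {1..<n}" "\<forall>x\<in>set ps. snd x \<noteq> 0"
  shows "\<exists>t t'. (\<forall>i. t i \<noteq> 0) \<and> (\<forall>i. t' i \<noteq> 0) \<and>
    diag_mat_of n t * word_mat n (map (\<lambda>(i, c). (i, 1)) ps) = word_mat n ps * diag_mat_of n t'"
  using assms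
proof (induction ps)
  case Nil
  show ?case by (intro exI[of _ "\<lambda>i. 1"]) (simp add: diag_mat_of_one)
next
  case (Cons x ps)
  obtain i c where x: "x = (i, c)" by (cases x)
  let ?Y1 = "word_mat n (map (\<lambda>(i, c). (i, 1)) ps)" and ?Y = "word_mat n ps"
  have i: "i \<in> {1..<n}" and c: "c \<noteq> 0" and ni: "i \<notin> fst ` set ps" using Cons.prems x by auto
  obtain t t' where t: "\<And>i. t i \<noteq> 0" "\<And>i. t' i \<noteq> 0" "diag_mat_of n t * ?Y1 = ?Y * diag_mat_of n t'"
    using Cons.IH Cons.prems by auto
  \<comment> \<open>Chosen so that \<open>s i = c * s (i - 1)\<close>, which is what turns the
    coordinate 1 of the first step into c.\<close>
  define l where "l = t i / (c * t (i - 1))"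
  define d where "d = (\<lambda>j. if j < i then l else 1)"
  have l0: "l \<noteq> 0" using t c by (simp add: l_def)
  have d0: "d j \<noteq> 0" for j using l0 by (simp add: d_def)
  define s where "s j = d j * t j" for j
  define s' where "s' = s \<circ> shift (simple_transposition i)"
  have s0: "s j \<noteq> 0" "s' j \<noteq> 0" for j using d0 t by (auto simp: s_def s'_def)
  have step: "diag_mat_of n s' * step_mat n i 1 = step_mat n i c * diag_mat_of n s"
  proof (rule eq_matI)
    fix p q assume "p < dim_row (step_mat n i c * diag_mat_of n s)" "q < dim_col (step_mat n i c * diag_mat_of n s)"
    then have pq: "p < n" "q < n" by (auto simp: step_mat_def diag_mat_of_def)
    have si: "s i = c * s (i - 1)" using i t c by (simp add: s_def d_def l_def)
    show "(diag_mat_of n s' * step_mat n i 1) $$ (p, q) = (step_mat n i c * diag_mat_of n s) $$ (p, q)"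
      unfolding diag_mult_entry[OF step_mat_carrier pq] mult_diag_entry[OF step_mat_carrier pq]
      using pq i si by (auto simp: step_mat_def s'_def shift_simple_transposition)
  qed (auto simp: step_mat_def diag_mat_of_def)
  have comm: "diag_mat_of n d * ?Y = ?Y * diag_mat_of n d"
    unfolding d_def by (rule diag_commute_word_mat[OF ni])
  have "diag_mat_of n s' * word_mat n (map (\<lambda>(i, c). (i, 1)) (x # ps)) = diag_mat_of n s' * step_mat n i 1 * ?Y1"
    by (simp add: x sq_simps[where n = n] carrier_simps)
  also have "\<dots> = step_mat n i c * (diag_mat_of n d * (diag_mat_of n t * ?Y1))"
    unfolding step s_def diag_mat_of_mult[symmetric] by (simp add: sq_simps[where n = n] carrier_simps)
  also have "\<dots> = step_mat n i c * (diag_mat_of n d * ?Y) * diag_mat_of n t'"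
    unfolding t(3) by (simp add: sq_simps[where n = n] carrier_simps)
  also have "\<dots> = word_mat n (x # ps) * (diag_mat_of n d * diag_mat_of n t')"
    unfolding comm by (simp add: x sq_simps[where n = n] carrier_simps)
  also have "\<dots> = word_mat n (x # ps) * diag_mat_of n (\<lambda>j. d j * t' j)"
    unfolding diag_mat_of_mult ..
  finally have "diag_mat_of n s' * word_mat n (map (\<lambda>(i, c). (i, 1)) (x # ps)) =
    word_mat n (x # ps) * diag_mat_of n (\<lambda>j. d j * t' j)" .
  then show ?case using s0 d0 t(2) by (intro exI[of _ s'] exI[of _ "\<lambda>j. d j * t' j"]) simp
qed

lemma poly_curve_word_mat: "poly_curve n (\<lambda>t. word_mat n (map (\<lambda>(i, c). (i, c + t)) ps))"
proof (induction ps)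
  case Nil
  show ?case by (simp add: poly_curve_const)
next
  case (Cons x ps)
  obtain i c where x: "x = (i, c)" by (cases x)
  have "poly_curve n (\<lambda>t. step_mat n i (c + t))"
    unfolding poly_curve_def
  proof (intro conjI allI impI step_mat_carrier)
    fix p q assume pq: "p < n" "q < n"
    have "poly_fun (\<lambda>t. c + t)" by (intro poly_fun_add poly_fun_const poly_fun_id)
    then show "poly_fun (\<lambda>t. step_mat n i (c + t) $$ (p, q))"
      using pq by (cases "Suc p = i"; cases "Suc q = i") (simp_all add: step_mat_def poly_fun_const)
  qed
  then show ?case using poly_curve_mult[OF _ Cons.IH] by (simp add: x)
qed

lemma word_mat_GL:
  assumes "fst ` set ps \<subseteq> {1..<n}"
  shows "word_mat n ps \<in> carrier (GL n)"
  using assms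
proof (induction ps)
  case Nil
  show ?case by (simp add: one_GL)
next
  case (Cons x ps)
  obtain i c where x: "x = (i, c)" by (cases x)
  have i: "i \<in> {1..<n}" using Cons.prems x by simp
  have "step_mat n i c \<in> carrier (GL n)"
    unfolding step_mat_elem[OF i]
    by (intro GL_mult_closed upper_borel_GL elem_mat_upper_borel pmat_GL shift_permutes simple_transposition_permutes i)
  then show ?case using Cons by (simp add: x GL_mult_closed)
qed

text \<open>The base point has all coordinates equal to 1. Elements with nonzero coordinates lie in
  its torus orbit up to the Borel subgroup on the right; the others are reached by adding one
  parameter t to all coordinates. The part of an element of the double coset inside the blocks is
  absorbed by the Levi subgroup.\<close>

lemma dense_orbit_of_coxeter_element:
  assumes ws: "distinct ws" "set ws \<subseteq> {1..<n}"
    and z: "z permutes {..<n}" and zbl: "\<And>i. block n I (z i) = block n I i"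
    and w: "w permutes {..<n}" "block_decreasing n I (inv' w)"
    and zw: "z \<circ> w = shift (word_product n ws)"
  obtains y where "y \<in> vcl n (dcoset n w)" "dcoset n w \<subseteq> vcl n (orbit_coset n (levi_borel n I) y)"
proof -
  let ?u = "shift (word_product n ws)" and ?P = "pmat n (inv' z)"
  have z': "inv' z permutes {..<n}" by (rule permutes_inv[OF z])
  have u: "?u permutes {..<n}" by (rule shift_permutes[OF word_product_permutes[OF ws(2)]])
  have zbl': "block n I (inv' z i) = block n I i" for i
    using zbl[of "inv' z i"] permutes_inverses(1)[OF z] by simp
  have wu: "inv' z \<circ> ?u = w"
    unfolding zw[symmetric] using permutes_inverses(2)[OF z] by (auto simp: fun_eq_iff)
  have Pw: "pmat n w = ?P * pmat n ?u" using pmat_comp[OF z' u] wu by simp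
  have levi: "pmat n v \<in> levi n I" if "v permutes {..<n}" "\<And>i. block n I (v i) = block n I i" for v
    using that pmat_GL[OF that(1)] by (auto simp: levi_iff pmat_def)
  define Y1 where "Y1 = word_mat n (map (\<lambda>i. (i, 1)) ws)"
  define y where "y = ?P * Y1"
  let ?O = "orbit_coset n (levi_borel n I) y"
  have Y1c: "Y1 \<in> carrier_mat n n" by (simp add: Y1_def word_mat_carrier)
  \<comment> \<open>The word matrix lies in the double coset of z w. Since z permutes within blocks,
    its matrix belongs to the Levi subgroup, so this double coset is contained in the closure of
    that of w.\<close>
  have "y \<in> vcl n (dcoset n w)"
  proof -
    have "map fst (map (\<lambda>i. (i, 1 :: complex)) ws) = ws" by (simp add: comp_def)
    then have "Y1 \<in> dcoset n ?u"
      using word_mat_dcoset[of "map (\<lambda>i. (i, 1)) ws" n] ws by (simp add: Y1_def image_image)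
    then obtain b b' where b: "b \<in> upper_borel n" "b' \<in> upper_borel n" "Y1 = b * pmat n ?u * b'"
      unfolding dcoset_def by blast
    have "1\<^sub>m n * pmat n w * b' \<in> vcl n (dcoset n w)"
      using vcl_subset[OF dcoset_GL[OF w(1)]] dcosetI[OF upper_borel_one b(2)] by blast
    then have "pmat n z * (1\<^sub>m n * pmat n w * b') \<in> vcl n (dcoset n w)"
      by (rule vcl_dcoset_levi[OF w levi[OF z zbl]])
    then have "b * (pmat n z * (1\<^sub>m n * pmat n w * b')) \<in> vcl n (dcoset n w)"
      by (rule vcl_dcoset_left[OF w(1) _ b(1)])
    also have "b * (pmat n z * (1\<^sub>m n * pmat n w * b')) = b * (pmat n z * pmat n w) * b'"
      using upper_borel_carrier[OF b(1)] upper_borel_carrier[OF b(2)] left_mult_one_mat[OF pmat_carrier, of n w]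
      by (simp add: sq_simps[where n = n] carrier_simps)
    also have "\<dots> = Y1" unfolding pmat_comp[OF z w(1)] zw b(3) ..
    finally have "Y1 \<in> vcl n (dcoset n w)" .
    then show ?thesis unfolding y_def by (rule vcl_dcoset_levi[OF w levi[OF z' zbl']])
  qed
  moreover have "dcoset n w \<subseteq> vcl n ?O"
  proof
    have yG: "y \<in> carrier (GL n)" using \<open>y \<in> vcl n (dcoset n w)\<close> by (rule vcl_GL)
    have yc: "y \<in> carrier_mat n n" using GL_carrier_mat[OF yG] .
    have OG: "?O \<subseteq> carrier (GL n)"
      unfolding orbit_coset_def using yG upper_borel_GL GL_mult_closed by (auto simp: levi_borel_def)
    have cell: "?P * word_mat n ps * b \<in> vcl n ?O" if ps: "map fst ps = ws" and b: "b \<in> upper_borel n" for ps b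
    proof -
      have fs: "fst ` set ps \<subseteq> {1..<n}" using ps ws(2) by (metis list.set_map)
      have bc: "b \<in> carrier_mat n n" by (rule upper_borel_carrier[OF b])
      let ?ps = "\<lambda>t. map (\<lambda>(i, c). (i, c + t)) ps"
      let ?M = "\<lambda>t. ?P * word_mat n (?ps t) * b"
      have psf: "map fst (?ps t) = ws" for t using ps by (auto simp: case_prod_unfold comp_def)
      have curve: "poly_curve n ?M"
        by (intro poly_curve_mult poly_curve_const poly_curve_word_mat pmat_carrier bc)
      \<comment> \<open>The excluded parameters are those at which some shifted coordinate c + t
        vanishes.\<close>
      have fin: "finite ((\<lambda>x. - snd x) ` set ps)" by simp
      have "?M 0 \<in> vcl n ?O"
      proof (rule vcl_poly_curve[OF curve fin])
        show "?M 0 \<in> carrier (GL n)"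
          using fs by (intro GL_mult_closed pmat_GL[OF z'] upper_borel_GL[OF b] word_mat_GL) auto
        fix t assume t: "t \<notin> (\<lambda>x. - snd x) ` set ps"
        have nz: "\<forall>x\<in>set (?ps t). snd x \<noteq> 0"
          using t by (force simp: add_eq_0_iff)
        have fs': "fst ` set (?ps t) \<subseteq> {1..<n}" using fs by auto
        have "map (\<lambda>(i, c). (i, 1)) (?ps t) = map (\<lambda>i. (i, 1 :: complex)) ws"
          unfolding psf[of t, symmetric] by (auto simp: case_prod_unfold)
        then obtain s s' where s: "\<And>i. s i \<noteq> 0" "\<And>i. s' i \<noteq> 0"
          "diag_mat_of n s * Y1 = word_mat n (?ps t) * diag_mat_of n s'"
          using torus_scales_word_mat[of "?ps t" n] psf[of t] ws(1) fs' nz unfolding Y1_def by metis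
        define r where "r = (\<lambda>i. inverse (s' i))"
        have r0: "r i \<noteq> 0" for i using s(2) by (simp add: r_def)
        have "word_mat n (?ps t) = word_mat n (?ps t) * (diag_mat_of n s' * diag_mat_of n r)"
          unfolding diag_mat_of_mult r_def using s(2) right_mult_one_mat[OF word_mat_carrier]
          by (simp add: diag_mat_of_one)
        also have "\<dots> = diag_mat_of n s * Y1 * diag_mat_of n r"
          unfolding s(3) by (simp add: sq_simps[where n = n] carrier_simps)
        finally have Y: "word_mat n (?ps t) = diag_mat_of n s * Y1 * diag_mat_of n r" .
        have comm: "?P * diag_mat_of n s = diag_mat_of n (s \<circ> z) * ?P"
        proof -
          have "perm_conj n (inv' z) (diag_mat_of n (s \<circ> z)) = diag_mat_of n s"
            using permutes_in_image[OF z'] permutes_inj[OF z'] permutes_inverses(1)[OF z]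
            by (auto simp: perm_conj_def diag_mat_of_def inj_eq intro!: eq_matI)
          then show ?thesis using mult_pmat[OF z' diag_mat_of_carrier, of "s \<circ> z"] by simp
        qed
        have "?M t = ?P * diag_mat_of n s * Y1 * (diag_mat_of n r * b)"
          unfolding Y using Y1c bc by (simp add: sq_simps[where n = n] carrier_simps)
        also have "\<dots> = diag_mat_of n (s \<circ> z) * y * (diag_mat_of n r * b)"
          unfolding comm y_def using Y1c bc by (simp add: sq_simps[where n = n] carrier_simps)
        finally have "?M t = diag_mat_of n (s \<circ> z) * y * (diag_mat_of n r * b)" .
        moreover have "diag_mat_of n (s \<circ> z) \<in> levi_borel n I" using s(1) by (intro diag_mat_of_levi_borel) simp
        moreover have "diag_mat_of n r * b \<in> upper_borel n" using r0 b by (intro upper_borel_mult diag_mat_of_upper_borel)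
        ultimately have "?M t \<in> ?O" unfolding orbit_coset_def by blast
        then show "?M t \<in> vcl n ?O" using vcl_subset[OF OG] by blast
      qed
      then show ?thesis by (simp add: case_prod_unfold)
    qed
    have Oleft: "g * A \<in> vcl n ?O" if g: "g \<in> levi_borel n I" and A: "A \<in> vcl n ?O" for g A
    proof -
      have gG: "g \<in> carrier (GL n)" using g by (simp add: levi_borel_iff)
      have "(*) g ` ?O \<subseteq> ?O"
      proof
        fix x assume "x \<in> (*) g ` ?O"
        then obtain k c where kc: "k \<in> levi_borel n I" "c \<in> upper_borel n" "x = g * (k * y * c)"
          unfolding orbit_coset_def by blast
        have "k \<in> carrier_mat n n" using kc(1) GL_carrier_mat by (auto simp: levi_borel_iff)
        then have "x = g * k * y * c"
          using kc(3) GL_carrier_mat[OF gG] yc upper_borel_carrier[OF kc(2)] by (simp add: sq_simps[where n = n])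
        moreover have "g * k \<in> levi_borel n I" by (rule subgroup_GL_mult[OF subgroup_levi_borel g kc(1)])
        ultimately show "x \<in> ?O" unfolding orbit_coset_def using kc(2) by blast
      qed
      then show ?thesis using vcl_mono[of "(*) g ` ?O" ?O n] vcl_mult_left[OF gG A] by blast
    qed
    fix A assume "A \<in> dcoset n w"
    then obtain b b' where b: "b \<in> upper_borel n" "b' \<in> upper_borel n" "A = b * pmat n w * b'"
      unfolding dcoset_def by blast
    have bc: "b \<in> carrier_mat n n" "b' \<in> carrier_mat n n" using b upper_borel_carrier by auto
    have bup: "b $$ (i, j) = 0" if "j < i" "i < n" for i j
      using b(1) bc that upper_triangularD[of b j i] by (simp add: upper_borel_iff)
    \<comment> \<open>The block diagonal part of b. It belongs to the triangular group of the Levi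
      subgroup, and b = g m with m equal to the identity inside each block.\<close>
    define g where "g = mat n n (\<lambda>(i, j). if block n I i = block n I j then b $$ (i, j) else 0)"
    have gc: "g \<in> carrier_mat n n" by (simp add: g_def)
    have gup: "upper_triangular g" by (rule upper_triangularI) (auto simp: g_def bup)
    have "det g \<noteq> 0"
      using upper_triangular_imp_det_eq_0_iff[OF gc gup] upper_triangular_diag_nonzero[of b n] b(1)
      by (auto simp: diag_mat_def g_def upper_borel_iff)
    then have gG: "g \<in> carrier (GL n)" using gc by (simp add: carrier_GL)
    have gB: "g \<in> levi_borel n I" using gG bup by (auto simp: levi_borel_iff g_def)
    have giB: "GL_inv n g \<in> levi_borel n I" by (rule subgroup.m_inv_closed[OF subgroup_levi_borel gB])
    have gic: "GL_inv n g \<in> carrier_mat n n" by (rule GL_inv_carrier_mat[OF gG])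
    define m where "m = GL_inv n g * b"
    have mB: "m \<in> upper_borel n" unfolding m_def using giB b(1) by (intro upper_borel_mult) (simp add: levi_borel_def)
    have mc: "m \<in> carrier_mat n n" by (rule upper_borel_carrier[OF mB])
    have mblk: "m $$ (i, j) = 1\<^sub>m n $$ (i, j)" if ij: "i < n" "j < n" "block n I i = block n I j" for i j
    proof -
      have "m $$ (i, j) = (\<Sum>l<n. GL_inv n g $$ (i, l) * g $$ (l, j))"
        unfolding m_def mat_mult_entry[OF gic bc(1) ij(1,2)]
      proof (rule sum.cong[OF refl])
        fix l assume "l \<in> {..<n}"
        then show "GL_inv n g $$ (i, l) * b $$ (l, j) = GL_inv n g $$ (i, l) * g $$ (l, j)"
          using giB ij by (cases "block n I i = block n I l") (auto simp: g_def levi_borel_iff)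
      qed
      also have "\<dots> = (GL_inv n g * g) $$ (i, j)" by (rule mat_mult_entry[OF gic gc ij(1,2), symmetric])
      finally show ?thesis by (simp add: GL_inv_left[OF gG])
    qed
    \<comment> \<open>As m is the identity within blocks and z only permutes inside them, this
      conjugate remains upper triangular.\<close>
    let ?m' = "perm_conj n (inv' z) m"
    have m'B: "?m' \<in> upper_borel n"
      unfolding upper_borel_iff
    proof (intro conjI upper_triangularI perm_conj_GL[OF z' upper_borel_GL[OF mB]])
      fix i j assume ij: "j < i" "i < dim_row ?m'"
      then have ijn: "i < n" "j < n" by (auto simp: perm_conj_def)
      have zn: "inv' z i < n" "inv' z j < n" "inv' z i \<noteq> inv' z j"
        using ijn ij permutes_in_image[OF z'] permutes_inj[OF z'] by (auto simp: inj_eq)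
      show "?m' $$ (i, j) = 0"
      proof (cases "block n I i = block n I j")
        case True
        then show ?thesis using mblk[OF zn(1,2)] zn ijn by (simp add: zbl' perm_conj_def)
      next
        case False
        then have "block n I (inv' z j) < block n I (inv' z i)"
          using block_mono[of j i n I] ij by (simp add: zbl')
        then have "inv' z j < inv' z i" using block_mono[of "inv' z i" "inv' z j" n I] by (meson leD leI)
        then show ?thesis
          using mB mc zn ijn upper_triangularD[of m "inv' z j" "inv' z i"] by (simp add: perm_conj_def upper_borel_iff)
      qed
    qed
    obtain ps c where ps: "map fst ps = ws" "c \<in> upper_borel n" "?m' * pmat n ?u * b' = word_mat n ps * c"
      using dcoset_word_mat[OF ws(2) dcosetI[OF m'B b(2)]] by blast
    have "b = g * m" unfolding m_def using GL_cancel(2)[OF gG bc(1)] by simp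
    then have "A = g * (m * ?P) * pmat n ?u * b'"
      unfolding b(3) Pw using gc mc bc by (simp add: sq_simps[where n = n] carrier_simps)
    also have "\<dots> = g * (?P * (?m' * pmat n ?u * b'))"
      unfolding mult_pmat[OF z' mc] using gc bc by (simp add: sq_simps[where n = n] carrier_simps)
    also have "\<dots> = g * (?P * word_mat n ps * c)"
      unfolding ps(3) using gc upper_borel_carrier[OF ps(2)] by (simp add: sq_simps[where n = n] carrier_simps)
    finally show "A \<in> vcl n ?O" using Oleft[OF gB cell[OF ps(1,2)]] by simp
  qed
  ultimately show ?thesis using that by blast
qed

subsection \<open>The classification\<close>

text \<open>A cut after i and up to j would be counted for j but not for i.\<close>

lemma same_block_interval:
  assumes "i < d" "d \<le> j" "j < n" "block n I i = block n I j"
  shows "d \<in> I"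
proof (rule ccontr)
  assume "d \<notin> I"
  let ?D = "\<lambda>i. {d \<in> {1..<n} - I. d \<le> i}"
  have "d \<in> ?D j" "d \<notin> ?D i" using assms \<open>d \<notin> I\<close> by auto
  moreover have "?D i \<subseteq> ?D j" using assms by auto
  ultimately have "?D i \<subset> ?D j" by blast
  then have "card (?D i) < card (?D j)" by (intro psubset_card_mono) auto
  then show False using assms(4) by (simp add: block_def)
qed

lemma block_decreasing_shift:
  assumes f: "f permutes {1..n}" and dec: "\<And>i. i \<in> I \<Longrightarrow> f (Suc i) < f i"
  shows "block_decreasing n I (shift f)"
  unfolding block_decreasing_def
proof (intro allI impI)
  fix i j assume ij: "i < j" "j < n" "block n I i = block n I j"
  have "f (Suc k) < f (Suc i)" if "i < k" "k \<le> j" for k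
    using that
  proof (induction k)
    case (Suc k)
    have "Suc k \<in> I" using same_block_interval[OF _ _ ij(2,3)] Suc.prems by blast
    then have "f (Suc (Suc k)) < f (Suc k)" by (rule dec)
    moreover have "f (Suc k) \<le> f (Suc i)" using Suc by (cases "k = i") auto
    ultimately show ?case by simp
  qed simp
  then have "f (Suc j) < f (Suc i)" using ij by simp
  then show "shift f j < shift f i" using permutes_pos[OF f, of j] by (simp add: shift_def)
qed

theorem theorem1p5:
  fixes n :: nat and w :: "nat \<Rightarrow> nat" and I :: "nat set"
  assumes "w \<in> carrier (sym_group n)"
    and "I \<subseteq> left_descents n w"
  shows "levi_spherical n I (schubert_variety n w) \<longleftrightarrow> I_spherical n I w"
proof -
  have w: "w permutes {1..n}" using assms(1) by (simp add: sym_group_carrier)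
  have I: "I \<subseteq> {1..<n}" using assms(2) by (auto simp: left_descents_def)
  define x where "x = longest_element n I"
  have xP: "x \<in> parabolic_subgroup n I" unfolding x_def by (rule longest_element_props(1)[OF I])
  have x: "x permutes {1..n}" by (rule parabolic_subgroup_permutes[OF xP I])
  define z where "z = shift x"
  let ?w = "shift w"
  have z: "z permutes {..<n}" unfolding z_def by (rule shift_permutes[OF x])
  have w': "?w permutes {..<n}" by (rule shift_permutes[OF w])
  have zw: "z \<circ> ?w = shift (x \<circ> w)" unfolding z_def by (rule shift_comp[OF w, symmetric])
  have zbl: "block n I (z i) = block n I i" for i
    using parabolic_subgroup_block[OF xP I, of "Suc i"] by (simp add: z_def shift_def)
  have zbl': "block n I (inv' z i) = block n I i" for i
    using zbl[of "inv' z i"] permutes_inverses(1)[OF z] by simp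
  have zdec: "block_decreasing n I (inv' z)"
    unfolding z_def shift_inv[OF x, symmetric]
    by (rule block_decreasing_shift[OF permutes_inv[OF x]]) (simp add: x_def longest_element_props(2)[OF I])
  have wdec: "block_decreasing n I (inv' ?w)"
    unfolding shift_inv[OF w, symmetric]
  proof (rule block_decreasing_shift[OF permutes_inv[OF w]])
    fix i assume "i \<in> I"
    then show "inv' w (Suc i) < inv' w i" using assms(2) by (auto simp: left_descents_def)
  qed
  show ?thesis
  proof
    assume "levi_spherical n I (schubert_variety n w)"
    then obtain y where y: "y \<in> carrier (GL n)"
      "dcoset n ?w \<subseteq> vcl n (orbit_coset n (levi_borel n I) y)"
      using levi_spherical_imp[OF w wdec] by blast
    let ?u = "z \<circ> ?w"
    have u: "?u permutes {..<n}" by (rule permutes_compose[OF w' z])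
    have iu: "inv' ?u = inv' ?w \<circ> inv' z"
      by (rule o_inv_distrib[OF permutes_bij[OF z] permutes_bij[OF w']])
    \<comment> \<open>Both \<open>inv' z\<close> and the inverse of the shifted w reverse the order
      within blocks, and \<open>inv' z\<close> maps every block to itself; composed, they restore
      the order.\<close>
    have inc': "inv' ?u i < inv' ?u j" if "i < j" "j < n" "block n I i = block n I j" for i j
    proof -
      have "inv' z j < inv' z i" using zdec that unfolding block_decreasing_def by blast
      moreover have "inv' z i < n" using permutes_in_image[OF permutes_inv[OF z], of i] that by simp
      moreover have "block n I (inv' z j) = block n I (inv' z i)" using that by (simp add: zbl')
      ultimately have "inv' ?w (inv' z i) < inv' ?w (inv' z j)" using wdec unfolding block_decreasing_def by blast
      then show ?thesis unfolding iu by simp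
    qed
    have inc: "block_increasing n I (inv' ?u)" using inc' by (simp add: block_increasing_def)
    have obstruct: False
      if pq: "common_weight n I p q"
        and f1: "block_lowering n I f1" and f2: "block_lowering n I f2"
        and v: "q (unit_shift n f1 * pmat n ?u) \<noteq> 0" "q (unit_shift n f2 * pmat n ?u) = 0"
          "p (unit_shift n f2 * pmat n ?u) \<noteq> 0" for p q f1 f2
    proof -
      obtain h1 where h1: "h1 \<in> dcoset n ?w" "pmat n z * h1 = unit_shift n f1 * pmat n ?u"
        using unit_shift_in_dcoset[OF z zbl' w' f1] by blast
      obtain h2 where h2: "h2 \<in> dcoset n ?w" "pmat n z * h2 = unit_shift n f2 * pmat n ?u"
        using unit_shift_in_dcoset[OF z zbl' w' f2] by blast
      show False
        by (rule no_dense_orbit[OF z zbl' zdec y pq h1(1) h2(1)]) (use v in \<open>simp_all only: h1(2) h2(2) not_False_eq_True\<close>)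
    qed
    have no321: False if ijk: "i < j" "j < k" "k < n" "?u k < ?u j" "?u j < ?u i" for i j k
      by (rule pattern321_obstruction[OF u inc ijk]) (rule obstruct)
    have no3412: False
      if ijkl: "i < j" "j < k" "k < l" "l < n" "?u k < ?u l" "?u l < ?u i" "?u i < ?u j" for i j k l
    proof (rule pattern3412_obstruction[OF u inc _ ijkl])
      show "\<forall>i j k. i < j \<longrightarrow> j < k \<longrightarrow> k < n \<longrightarrow> ?u k < ?u j \<longrightarrow> \<not> ?u j < ?u i" using no321 by blast
    qed (rule obstruct)
    let ?v = "x \<circ> w"
    have v: "?v permutes {1..n}" by (rule permutes_compose[OF w x])
    have uv: "?u (i - 1) < ?u (j - 1)" if "?v i < ?v j" "1 \<le> i" "1 \<le> j" for i j
      unfolding zw shift_def using that permutes_pos[OF v, of "i - 1"] by simp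
    have "\<not> pattern321 n ?v"
    proof
      assume "pattern321 n ?v"
      then obtain i j k where ijk: "1 \<le> i" "i < j" "j < k" "k \<le> n" "?v k < ?v j" "?v j < ?v i"
        unfolding pattern321_def by blast
      then have "i - 1 < j - 1" "j - 1 < k - 1" "k - 1 < n" "1 \<le> j" "1 \<le> k" by linarith+
      then show False using no321[OF _ _ _ uv[OF ijk(5)] uv[OF ijk(6)]] ijk(1) by blast
    qed
    moreover have "\<not> pattern3412 n ?v"
    proof
      assume "pattern3412 n ?v"
      then obtain i j k l where ijkl: "1 \<le> i" "i < j" "j < k" "k < l" "l \<le> n"
        "?v k < ?v l" "?v l < ?v i" "?v i < ?v j"
        unfolding pattern3412_def by blast
      then have "i - 1 < j - 1" "j - 1 < k - 1" "k - 1 < l - 1" "l - 1 < n" "1 \<le> j" "1 \<le> k" "1 \<le> l"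
        by linarith+
      then show False
        using no3412[OF _ _ _ _ uv[OF ijkl(6)] uv[OF ijkl(7)] uv[OF ijkl(8)]] ijkl(1) by blast
    qed
    ultimately obtain ws where "distinct ws" "set ws \<subseteq> {1..<n}" "?v = word_product n ws"
      using boolean_permutation_word[OF v] by blast
    then show "I_spherical n I w"
      unfolding I_spherical_def standard_coxeter_element_def sym_group_mult x_def[symmetric] by blast
  next
    assume "I_spherical n I w"
    then obtain ws where ws: "distinct ws" "set ws \<subseteq> {1..<n}" "x \<circ> w = word_product n ws"
      unfolding I_spherical_def standard_coxeter_element_def sym_group_mult x_def[symmetric] by blast
    have "z \<circ> ?w = shift (word_product n ws)" unfolding zw ws(3) ..
    then obtain y where "y \<in> vcl n (dcoset n ?w)" "dcoset n ?w \<subseteq> vcl n (orbit_coset n (levi_borel n I) y)"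
      using dense_orbit_of_coxeter_element[OF ws(1,2) z zbl w' wdec] by blast
    then show "levi_spherical n I (schubert_variety n w)" by (rule levi_spherical_if[OF w])
  qed
qed

end
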